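(* Let $p$ be an odd prime and $G\in\mathcal{F}_n^p$, with walk matrix $W$. Then $G$ is not DGS if and only if every nontrivial integral solution $z$ (i.e., $z\not\equiv0\pmod p$) of $W^{\mathrm T}z\equiv 0\pmod p$ can generate some primitive matrix.
   Context: Graphs are finite, simple, undirected. For a graph $G$ on $n$ vertices with adjacency matrix $A$, $W=W(G)=[e,Ae,\ldots,A^{n-1}e]$ with $e$ the all-one vector. Two graphs are generalized cospectral if their adjacency matrices have the same spectrum and the adjacency matrices of their complements have the same spectrum; $G$ is DGS if every graph generalized cospectral with $G$ is isomorphic to $G$. $\mathcal{F}_n$ is the family of graphs on $n$ vertices whose walk matrix has Smith normal form $\mathrm{diag}[1,\ldots,1,2,\ldots,2,2p^2b]$ ($\lceil n/2\rceil$ ones followed by $\lfloor n/2\rfloor$ entries $2,\ldots,2,2p^2b$), where $b$ is odd and square-free, $p$ is an odd prime and $p\nmid b$; $\mathcal{F}_n^p=\{G\in\mathcal{F}_n:p^2\mid\det W\}$. An orthogonal matrix $Q$ is regular if $Qe=e$; the level of a rational matrix $Q$ is the least positive integer $k$ with $kQ$ integral. A primitive matrix is a regular rational orthogonal matrix $Q$ of level $p$ with $\mathrm{rank}(pQ)=1$ over $\mathbb{F}_p$. An integral vector $v$ generates a primitive matrix $Q$ (of order equal to the dimension of $v$) if each column of $pQ$ is a multiple of $v$ over $\mathbb{F}_p$. *)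

theory Defs
  imports
    "Jordan_Normal_Form.Char_Poly"
    "HOL-Number_Theory.Cong"
    "HOL-Computational_Algebra.Squarefree"
begin

text \<open>A graph on \<open>n\<close> vertices has vertex set \<open>{0..<n}\<close>, which fixes the order of the rows of
  its adjacency matrix, and is given by its set \<open>E\<close> of edges (two-element sets of vertices).\<close>

definition complete_edges :: "nat \<Rightarrow> nat set set" where
  "complete_edges n = {e. e \<subseteq> {0..<n} \<and> card e = 2}"

definition simple_graph :: "nat \<Rightarrow> nat set set \<Rightarrow> bool" where
  "simple_graph n E \<longleftrightarrow> E \<subseteq> complete_edges n"

definition complement_graph :: "nat \<Rightarrow> nat set set \<Rightarrow> nat set set" where
  "complement_graph n E = complete_edges n - E"

definition graph_iso :: "nat \<Rightarrow> nat set set \<Rightarrow> nat \<Rightarrow> nat set set \<Rightarrow> bool" where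
  "graph_iso n E m F \<longleftrightarrow>
    (\<exists>f. bij_betw f {0..<n} {0..<m} \<and>
         (\<forall>u\<in>{0..<n}. \<forall>v\<in>{0..<n}. {u, v} \<in> E \<longleftrightarrow> {f u, f v} \<in> F))"

definition adj_mat :: "nat \<Rightarrow> nat set set \<Rightarrow> int mat" where
  "adj_mat n E = mat n n (\<lambda>(i, j). if {i, j} \<in> E then 1 else 0)"

definition all_ones_vec :: "nat \<Rightarrow> 'a :: one vec" where
  "all_ones_vec n = vec n (\<lambda>_. 1)"

definition walk_mat :: "nat \<Rightarrow> nat set set \<Rightarrow> int mat" where
  "walk_mat n E =
    mat_of_cols n (map (\<lambda>k. (adj_mat n E ^\<^sub>m k) *\<^sub>v all_ones_vec n) [0..<n])"

text \<open>The spectrum is the multiset of complex eigenvalues, counted with algebraic multiplicity.\<close>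

definition mat_spectrum :: "int mat \<Rightarrow> complex multiset" where
  "mat_spectrum A = proots (char_poly (map_mat of_int A))"

definition generalized_cospectral :: "nat \<Rightarrow> nat set set \<Rightarrow> nat \<Rightarrow> nat set set \<Rightarrow> bool" where
  "generalized_cospectral n E m F \<longleftrightarrow>
    mat_spectrum (adj_mat n E) = mat_spectrum (adj_mat m F) \<and>
    mat_spectrum (adj_mat n (complement_graph n E)) =
      mat_spectrum (adj_mat m (complement_graph m F))"

definition DGS :: "nat \<Rightarrow> nat set set \<Rightarrow> bool" where
  "DGS n E \<longleftrightarrow>
    (\<forall>m F. simple_graph m F \<and> generalized_cospectral m F n E \<longrightarrow> graph_iso m F n E)"

text \<open>For integer matrices, \<^const>\<open>invertible_mat\<close> means unimodular.\<close>

definition has_smith_normal_form :: "nat \<Rightarrow> int mat \<Rightarrow> (nat \<Rightarrow> int) \<Rightarrow> bool" where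
  "has_smith_normal_form n A d \<longleftrightarrow>
    (\<forall>i<n. d i \<ge> 0) \<and> (\<forall>i. Suc i < n \<longrightarrow> d i dvd d (Suc i)) \<and>
    (\<exists>U\<in>carrier_mat n n. \<exists>V\<in>carrier_mat n n.
       invertible_mat U \<and> invertible_mat V \<and> U * A * V = mat_diag n d)"

text \<open>The number \<open>(n + 1) div 2\<close> of leading ones is the ceiling of \<open>n / 2\<close>.\<close>

definition family_diag :: "nat \<Rightarrow> nat \<Rightarrow> nat \<Rightarrow> nat \<Rightarrow> int" where
  "family_diag n p b i =
    (if i < (n + 1) div 2 then 1 else if i < n - 1 then 2 else 2 * int p ^ 2 * int b)"

definition family_F :: "nat \<Rightarrow> nat set set set" where
  "family_F n =
    {E. simple_graph n E \<and>
        (\<exists>p b :: nat. prime p \<and> odd p \<and> odd b \<and> squarefree b \<and> \<not> p dvd b \<and>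
           has_smith_normal_form n (walk_mat n E) (family_diag n p b))}"

definition family_Fp :: "nat \<Rightarrow> nat \<Rightarrow> nat set set set" where
  "family_Fp n p = {E \<in> family_F n. int p ^ 2 dvd det (walk_mat n E)}"

definition vec_cong :: "nat \<Rightarrow> int vec \<Rightarrow> int vec \<Rightarrow> bool" where
  "vec_cong p u v \<longleftrightarrow> dim_vec u = dim_vec v \<and> (\<forall>i<dim_vec v. [u $ i = v $ i] (mod int p))"

text \<open>The prime \<open>p\<close> is a term, so linear algebra over the field with \<open>p\<close> elements is expressed by
  congruences on integer representatives; the rank is the largest number of linearly independent
  columns.\<close>

definition cols_indep_mod :: "nat \<Rightarrow> int mat \<Rightarrow> nat set \<Rightarrow> bool" where
  "cols_indep_mod p M J \<longleftrightarrow>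
    (\<forall>c :: nat \<Rightarrow> int.
       (\<forall>i<dim_row M. [(\<Sum>j\<in>J. c j * M $$ (i, j)) = 0] (mod int p)) \<longrightarrow>
       (\<forall>j\<in>J. [c j = 0] (mod int p)))"

definition rank_mod :: "nat \<Rightarrow> int mat \<Rightarrow> nat" where
  "rank_mod p M = Max (card ` {J. J \<subseteq> {0..<dim_col M} \<and> cols_indep_mod p M J})"

text \<open>The library's \<^const>\<open>orthogonal_mat\<close> only asks for pairwise orthogonal nonzero columns.\<close>

definition regular_orthogonal :: "nat \<Rightarrow> rat mat \<Rightarrow> bool" where
  "regular_orthogonal n Q \<longleftrightarrow>
    Q \<in> carrier_mat n n \<and> Q * transpose_mat Q = 1\<^sub>m n \<and> transpose_mat Q * Q = 1\<^sub>m n \<and>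
    Q *\<^sub>v all_ones_vec n = all_ones_vec n"

definition mat_level :: "rat mat \<Rightarrow> nat" where
  "mat_level Q = (LEAST k. k > 0 \<and> elements_mat (of_nat k \<cdot>\<^sub>m Q) \<subseteq> \<int>)"

text \<open>If \<open>Q\<close> has level \<open>p\<close> then \<open>p Q\<close> is integral and \<open>floor\<close> is a mere change of type.\<close>

definition scaled_int_mat :: "nat \<Rightarrow> rat mat \<Rightarrow> int mat" where
  "scaled_int_mat p Q = map_mat floor (of_nat p \<cdot>\<^sub>m Q)"

definition primitive_mat :: "nat \<Rightarrow> nat \<Rightarrow> rat mat \<Rightarrow> bool" where
  "primitive_mat p n Q \<longleftrightarrow>
    regular_orthogonal n Q \<and> mat_level Q = p \<and> rank_mod p (scaled_int_mat p Q) = 1"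

definition generates_primitive :: "nat \<Rightarrow> int vec \<Rightarrow> rat mat \<Rightarrow> bool" where
  "generates_primitive p v Q \<longleftrightarrow>
    primitive_mat p (dim_vec v) Q \<and>
    (\<forall>j<dim_vec v. \<exists>c. vec_cong p (col (scaled_int_mat p Q) j) (c \<cdot>\<^sub>v v))"

end

theory Submission
  imports
    Defs
    "HOL-Computational_Algebra.Formal_Laurent_Series"
    "HOL-Computational_Algebra.Fundamental_Theorem_Algebra"
begin

text \<open>
  Let \<open>A\<close> be the adjacency matrix of \<open>G\<close>, \<open>e\<close> the all-one vector and \<open>d = 2 p\<^sup>2 b\<close> the last invariant
  factor of \<open>W\<close>. Modulo an odd divisor of \<open>d\<close>, the kernel of \<open>W\<^sup>T\<close> is cyclic and \<open>A\<close>-invariant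
  (Cayley-Hamilton), so \<open>A\<close> acts on it as a scalar.

  If \<open>Q\<close> is a primitive matrix generated by a kernel vector, this scalar action modulo \<open>p\<^sup>2\<close> and
  \<open>(p Q)\<^sup>T (p Q) = p\<^sup>2 I\<close> show that \<open>Q\<^sup>T A Q\<close> is integral. It has the same entry sum, sum of squared
  entries and trace as \<open>A\<close>, so it is the adjacency matrix of a graph cospectral with \<open>G\<close>. An
  isomorphism of the two graphs would force \<open>Q\<close> to be a permutation matrix, because \<open>W\<close> is nonsingular.

  Conversely, generalized cospectral graphs have the same numbers of walks \<open>e\<^sup>T A\<^sup>k e\<close>, hence walk matrices
  with the same Gram matrix, and \<open>Q = W(G) W(H)\<^sup>-\<^sup>1\<close> is regular orthogonal with \<open>Q\<^sup>T A Q\<close> the adjacency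
  matrix of \<open>H\<close>. The level of \<open>Q\<close> is odd by an argument modulo 4, and it is not divisible by the
  exact power of an odd prime in \<open>d\<close>. So it is 1, and then \<open>Q\<close> is a permutation matrix, or it is \<open>p\<close>, and
  then all columns of \<open>p Q\<close> lie in the cyclic kernel of \<open>W\<^sup>T\<close> modulo \<open>p\<close>.
\<close>

section \<open>Walk vectors and the Cayley-Hamilton theorem\<close>

text \<open>The kernel of W^T modulo p is a line, so the condition on every nontrivial solution is
  equivalent to the condition on a single one. The exponent 2 of p in d governs both directions. A
  prime power N dividing the level makes some column of the scaled matrix isotropic modulo N^2,
  which is absurd when N is the full power of its prime in d. This excludes the primes dividing b at
  once, whereas for p it excludes only the level p^2, and the level p survives. In the other
  direction the columns of p Q lie in the kernel merely modulo p, yet integrality of Q^T A Q asks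
  for divisibility by p^2; this works because the kernel generator is an eigenvector of A even
  modulo p^2. The prime 2 resists this method: modulo 2 the kernel has dimension floor(n/2) and is
  not cyclic in general. There a basis of walk vectors takes the place of the generator, and the
  fact that no invariant factor is divisible by 4 takes the place of the exact prime power.\<close>

text \<open>Vectors and matrices are functions of which only the values at indices below \<open>n\<close> matter;
  \<open>walk_vec n a k\<close> is \<open>A\<^sup>k e\<close>.\<close>

definition dot :: "nat \<Rightarrow> (nat \<Rightarrow> 'a) \<Rightarrow> (nat \<Rightarrow> 'a) \<Rightarrow> 'a :: comm_ring_1" where
  "dot n x y = (\<Sum>i<n. x i * y i)"

definition mat_apply :: "nat \<Rightarrow> (nat \<Rightarrow> nat \<Rightarrow> 'a) \<Rightarrow> (nat \<Rightarrow> 'a) \<Rightarrow> nat \<Rightarrow> 'a :: comm_ring_1" where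
  "mat_apply n a x = (\<lambda>i. \<Sum>j<n. a i j * x j)"

definition walk_vec :: "nat \<Rightarrow> (nat \<Rightarrow> nat \<Rightarrow> 'a) \<Rightarrow> nat \<Rightarrow> nat \<Rightarrow> 'a :: comm_ring_1" where
  "walk_vec n a k = (mat_apply n a ^^ k) (\<lambda>_. 1)"

lemma dot_commute: "dot n x y = dot n y x"
  by (simp add: dot_def mult.commute)

lemma dot_add_right: "dot n x (\<lambda>i. y i + z i) = dot n x y + dot n x z"
  by (simp add: dot_def distrib_left sum.distrib)

lemma dot_diff_right: "dot n x (\<lambda>i. y i - z i) = dot n x y - dot n x z"
  by (simp add: dot_def right_diff_distrib sum_subtractf)

lemma dot_scale_right: "dot n x (\<lambda>i. c * y i) = c * dot n x y"
  by (simp add: dot_def sum_distrib_left mult.left_commute)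

lemma dot_sum_right: "dot n x (\<lambda>i. \<Sum>k\<in>K. y k i) = (\<Sum>k\<in>K. dot n x (y k))"
  by (induction K rule: infinite_finite_induct) (simp_all add: dot_add_right, simp_all add: dot_def)

lemma dot_add_left: "dot n (\<lambda>i. y i + z i) x = dot n y x + dot n z x"
  by (simp add: dot_commute[of n _ x] dot_add_right)

lemma dot_diff_left: "dot n (\<lambda>i. y i - z i) x = dot n y x - dot n z x"
  by (simp add: dot_commute[of n _ x] dot_diff_right)

lemma dot_scale_left: "dot n (\<lambda>i. c * y i) x = c * dot n y x"
  by (simp add: dot_commute[of n _ x] dot_scale_right)

lemma dot_sum_left: "dot n (\<lambda>i. \<Sum>k\<in>K. y k i) x = (\<Sum>k\<in>K. dot n (y k) x)"
  by (simp add: dot_commute[of n _ x] dot_sum_right)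

lemmas dot_linear = dot_add_right dot_diff_right dot_scale_right dot_add_left dot_diff_left dot_scale_left

lemma dot_cong: "(\<And>i. i < n \<Longrightarrow> x i = x' i) \<Longrightarrow> (\<And>i. i < n \<Longrightarrow> y i = y' i) \<Longrightarrow> dot n x y = dot n x' y'"
  by (simp add: dot_def)

lemma dot_unit_right: "j < n \<Longrightarrow> dot n x (\<lambda>i. if i = j then 1 else 0) = x j"
  by (simp add: dot_def if_distrib[of "\<lambda>t. _ * t"] cong: if_cong)

lemma dot_dvd_right:
  fixes N :: "'a :: comm_ring_1"
  shows "(\<And>i. i < n \<Longrightarrow> N dvd y i) \<Longrightarrow> N dvd dot n x y"
  by (auto simp: dot_def intro!: dvd_sum)

lemma dot_dvd_diff_right:
  fixes N :: "'a :: comm_ring_1"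
  shows "(\<And>i. i < n \<Longrightarrow> N dvd y i - z i) \<Longrightarrow> N dvd dot n x y - dot n x z"
  using dot_dvd_right[of n N "\<lambda>i. y i - z i" x] by (simp add: dot_diff_right)

lemma mat_apply_eq_ip: "mat_apply n a x i = dot n (a i) x"
  by (simp add: mat_apply_def dot_def)

lemma mat_apply_add: "mat_apply n a (\<lambda>i. x i + y i) i = mat_apply n a x i + mat_apply n a y i"
  by (simp add: mat_apply_eq_ip dot_linear)

lemma mat_apply_scale: "mat_apply n a (\<lambda>i. c * x i) i = c * mat_apply n a x i"
  by (simp add: mat_apply_eq_ip dot_linear)

lemma mat_apply_sum: "mat_apply n a (\<lambda>i. \<Sum>k\<in>K. x k i) i = (\<Sum>k\<in>K. mat_apply n a (x k) i)"
  by (simp add: mat_apply_eq_ip dot_sum_right)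

lemma mat_apply_cong: "(\<And>i. i < n \<Longrightarrow> x i = y i) \<Longrightarrow> mat_apply n a x = mat_apply n a y"
  by (auto simp: mat_apply_def)

lemma mat_apply_dvd_diff:
  fixes N :: "'a :: comm_ring_1"
  shows "(\<And>i. i < n \<Longrightarrow> N dvd x i - y i) \<Longrightarrow> N dvd mat_apply n a x i - mat_apply n a y i"
  by (simp add: mat_apply_eq_ip dot_dvd_diff_right)

lemma mat_apply_dvd: "(\<And>i. i < n \<Longrightarrow> N dvd x i) \<Longrightarrow> N dvd mat_apply n a x i"
  by (simp add: mat_apply_eq_ip dot_dvd_right)

lemma mat_apply_pow_dvd: "(\<And>i. i < n \<Longrightarrow> N dvd x i) \<Longrightarrow> i < n \<Longrightarrow> N dvd (mat_apply n a ^^ k) x i"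
  by (induction k arbitrary: i) (auto intro: mat_apply_dvd)

lemma walk_vec_0: "walk_vec n a 0 = (\<lambda>_. 1)"
  by (simp add: walk_vec_def)

lemma walk_vec_Suc: "walk_vec n a (Suc k) = mat_apply n a (walk_vec n a k)"
  by (simp add: walk_vec_def)

lemma index_mult_mat_sum:
  assumes "A \<in> carrier_mat n m" "B \<in> carrier_mat m k" "i < n" "j < k"
  shows "(A * B) $$ (i, j) = (\<Sum>l<m. A $$ (i, l) * B $$ (l, j))"
proof -
  have "dim_row A = n" "dim_col A = m" "dim_row B = m" "dim_col B = k" using assms by auto
  thus ?thesis using assms(3,4) by (simp add: scalar_prod_def lessThan_atLeast0)
qed

text \<open>The adjugate proof, valid over any commutative ring. With \<open>B\<close> the adjugate
  of x I - A, comparing the coefficients of x^k in B (x I - A) = f I turns each summand into a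
  difference of consecutive terms \<open>T k\<close>, and the sum telescopes.\<close>

lemma cayley_hamilton_walk:
  fixes a :: "nat \<Rightarrow> nat \<Rightarrow> 'a :: comm_ring_1"
  assumes "i < n"
  shows "(\<Sum>k\<le>n. coeff (char_poly (mat n n (\<lambda>(i, j). a i j))) k * walk_vec n a k i) = 0"
proof -
  let ?A = "mat n n (\<lambda>(i, j). a i j)"
  let ?M = "char_poly_matrix ?A"
  let ?f = "char_poly ?A"
  define B where "B = Determinant.adj_mat ?M"
  have A: "?A \<in> carrier_mat n n" by simp
  have M: "?M \<in> carrier_mat n n" using A by simp
  have B: "B \<in> carrier_mat n n" unfolding B_def using adj_mat(1)[OF M] .
  have BM: "B * ?M = ?f \<cdot>\<^sub>m 1\<^sub>m n"
    unfolding B_def char_poly_def using adj_mat(3)[OF M] .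
  have ent: "(if i = j then ?f else 0) =
      monom 1 1 * B $$ (i, j) - (\<Sum>l<n. Polynomial.smult (a l j) (B $$ (i, l)))" if j: "j < n" for j
  proof -
    have "(if i = j then ?f else 0) = (B * ?M) $$ (i, j)"
      unfolding BM using assms j by simp
    also have "\<dots> = (\<Sum>l<n. B $$ (i, l) * ?M $$ (l, j))"
      by (rule index_mult_mat_sum[OF B M assms j])
    also have "\<dots> = (\<Sum>l<n. (if l = j then monom 1 1 * B $$ (i, l) else 0) - Polynomial.smult (a l j) (B $$ (i, l)))"
      using j by (intro sum.cong) (auto simp: char_poly_matrix_def monom_altdef algebra_simps)
    also have "\<dots> = monom 1 1 * B $$ (i, j) - (\<Sum>l<n. Polynomial.smult (a l j) (B $$ (i, l)))"
      using j by (simp add: sum_subtractf)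
    finally show ?thesis .
  qed
  \<comment> \<open>Row \<open>i\<close> of the coefficient of x^(k-1) in \<open>B\<close>. The
    value 0 at \<open>k = 0\<close> stands for the missing coefficient of x^(-1) and makes
    \<open>T 0\<close> vanish.\<close>
  define b where "b k j = (if k = 0 then 0 else coeff (B $$ (i, j)) (k - 1))" for k j
  define T where "T k = (\<Sum>j<n. b k j * walk_vec n a k j)" for k
  have step: "coeff ?f k * walk_vec n a k i = T k - T (Suc k)" for k
  proof -
    have co: "(if i = j then coeff ?f k else 0) = b k j - (\<Sum>l<n. a l j * b (Suc k) l)" if j: "j < n" for j
      using arg_cong[OF ent[OF j], of "\<lambda>g. coeff g k"]
      by (cases k) (simp_all add: b_def coeff_sum coeff_monom_mult split: if_splits)
    have "coeff ?f k * walk_vec n a k i = (\<Sum>j<n. (if i = j then coeff ?f k else 0) * walk_vec n a k j)"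
      using assms by (simp add: if_distrib[of "\<lambda>t. t * _"] cong: if_cong)
    also have "\<dots> = (\<Sum>j<n. (b k j - (\<Sum>l<n. a l j * b (Suc k) l)) * walk_vec n a k j)"
      using co by simp
    also have "\<dots> = T k - (\<Sum>j<n. \<Sum>l<n. a l j * b (Suc k) l * walk_vec n a k j)"
      by (simp add: T_def left_diff_distrib sum_subtractf sum_distrib_right)
    also have "(\<Sum>j<n. \<Sum>l<n. a l j * b (Suc k) l * walk_vec n a k j) = T (Suc k)"
      unfolding T_def walk_vec_Suc mat_apply_def sum_distrib_left
      by (subst sum.swap) (simp add: mult_ac)
    finally show ?thesis .
  qed
  define K where "K = Max (insert n ((\<lambda>j. Suc (degree (B $$ (i, j)))) ` {..<n}))"
  have nK: "n \<le> K" unfolding K_def by (intro Max_ge) auto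
  have bK: "b (Suc K) j = 0" if "j < n" for j
  proof -
    have "Suc (degree (B $$ (i, j))) \<le> K" unfolding K_def using that by (intro Max_ge) auto
    thus ?thesis by (simp add: b_def coeff_eq_0)
  qed
  have deg: "degree ?f = n" using degree_monic_char_poly[OF A] by simp
  have "(\<Sum>k\<le>n. coeff ?f k * walk_vec n a k i) = (\<Sum>k\<le>K. coeff ?f k * walk_vec n a k i)"
    using nK deg by (intro sum.mono_neutral_left) (auto simp: coeff_eq_0)
  also have "\<dots> = T 0 - T (Suc K)"
    unfolding step by (rule sum_telescope)
  also have "\<dots> = 0" using bK by (simp add: T_def b_def)
  finally show ?thesis .
qed

locale symmetric_walks =
  fixes n :: nat and a :: "nat \<Rightarrow> nat \<Rightarrow> 'a :: comm_ring_1"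
  assumes sym: "a i j = a j i"
begin

abbreviation "L \<equiv> mat_apply n a"
abbreviation "w \<equiv> walk_vec n a"
abbreviation inner (infixl "\<cdot>" 70) where "x \<cdot> y \<equiv> dot n x y"

lemma mat_apply_adjoint: "L x \<cdot> y = x \<cdot> L y"
proof -
  have "L x \<cdot> y = (\<Sum>i<n. \<Sum>j<n. a i j * x j * y i)"
    by (simp add: dot_def mat_apply_def sum_distrib_right)
  also have "\<dots> = (\<Sum>j<n. \<Sum>i<n. a i j * x j * y i)" by (rule sum.swap)
  also have "\<dots> = x \<cdot> L y"
    unfolding dot_def mat_apply_def sum_distrib_left
    by (intro sum.cong refl) (metis sym mult.assoc mult.commute)
  finally show ?thesis .
qed

lemma mat_apply_pow_adjoint: "(L ^^ k) x \<cdot> y = x \<cdot> (L ^^ k) y"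
  by (induction k arbitrary: x) (simp_all add: mat_apply_adjoint funpow_swap1)

lemma walk_vec_add: "w (k + j) = (L ^^ k) (w j)"
  by (simp add: walk_vec_def funpow_add)

lemma walk_vec_inner_lin: "w k \<cdot> L x = w (Suc k) \<cdot> x"
  by (simp add: walk_vec_Suc mat_apply_adjoint)

lemma walk_vec_inner_wk: "w i \<cdot> w j = w 0 \<cdot> w (i + j)"
  by (simp add: walk_vec_add walk_vec_def[of _ _ i] walk_vec_0 mat_apply_pow_adjoint)

text \<open>The Cayley-Hamilton relation rewrites A^n e through lower powers. For
  \<open>k = m + n\<close> the surplus A^m is moved to \<open>x\<close> by symmetry and moved back
  afterwards, so all resulting indices are below \<open>k\<close>.\<close>

lemma walk_vec_dvd_all:
  assumes "\<And>k. k < n \<Longrightarrow> N dvd w k \<cdot> x"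
  shows "N dvd w k \<cdot> x"
proof (induction k rule: less_induct)
  case (less k)
  show ?case
  proof (cases "k < n")
    case True thus ?thesis by (rule assms)
  next
    case False
    define m where "m = k - n"
    have k: "k = m + n" using False by (simp add: m_def)
    let ?f = "char_poly (mat n n (\<lambda>(i, j). a i j))"
    have "coeff ?f n = 1" using degree_monic_char_poly[of "mat n n (\<lambda>(i, j). a i j)" n] by simp
    hence z: "(\<Sum>j<n. coeff ?f j * w j i) + w n i = 0" if "i < n" for i
      using cayley_hamilton_walk[OF that, of a] by (simp add: lessThan_Suc_atMost[symmetric])
    have "w k \<cdot> x = w n \<cdot> (L ^^ m) x"
      unfolding k walk_vec_add by (rule mat_apply_pow_adjoint)
    also have "\<dots> = (\<lambda>i. - (\<Sum>j<n. coeff ?f j * w j i)) \<cdot> (L ^^ m) x"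
      using z by (intro dot_cong refl) (simp add: eq_neg_iff_add_eq_0 add.commute)
    also have "\<dots> = - (\<Sum>j<n. coeff ?f j * (w (m + j) \<cdot> x))"
      using dot_scale_left[of n "-1" "\<lambda>i. \<Sum>j<n. coeff ?f j * w j i"]
      by (simp add: dot_sum_left dot_scale_left walk_vec_add mat_apply_pow_adjoint)
    finally have e: "w k \<cdot> x = - (\<Sum>j<n. coeff ?f j * (w (m + j) \<cdot> x))" .
    show ?thesis unfolding e dvd_minus_iff
      by (intro dvd_sum dvd_mult less) (simp add: k)
  qed
qed

end

section \<open>Isotropic kernel vectors modulo odd prime powers\<close>

text \<open>The data that the Smith normal form of the walk matrix provides: \<open>d\<close> is its last invariant
  factor, the other ones divide 2, and \<open>r\<close> is the last row of the left transforming matrix.\<close>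

locale smith_walks = symmetric_walks n a for n :: nat and a :: "nat \<Rightarrow> nat \<Rightarrow> int" +
  fixes d :: int and r :: "nat \<Rightarrow> int"
  assumes d_pos: "d > 0"
    and kernel_odd: "odd N \<Longrightarrow> N dvd d \<Longrightarrow> (\<And>k. k < n \<Longrightarrow> N dvd w k \<cdot> x) \<Longrightarrow>
        \<exists>c. \<forall>i<n. N dvd x i - c * r i"
    and r_kernel: "k < n \<Longrightarrow> d dvd w k \<cdot> r"
    and r_nonzero: "\<not> is_unit q \<Longrightarrow> \<exists>i<n. \<not> q dvd r i"
    and dual_vector: "\<exists>x. \<forall>k<n. w k \<cdot> x = (if k = n - 1 then d else 0)"
    and inner_wk_eq_0: "(\<And>k. k < n \<Longrightarrow> w k \<cdot> x = 0) \<Longrightarrow> i < n \<Longrightarrow> x i = 0"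
begin

text \<open>Modulo \<open>q ^ s\<close> the kernel is generated by \<open>r\<close>. A kernel vector
  that is nonzero modulo \<open>q\<close> is a unit multiple of \<open>r\<close> there, so it can
  replace \<open>r\<close> as a generator.\<close>

lemma kernel_generator:
  fixes N q :: int
  assumes q: "prime q" "odd q" and N: "N = q ^ s" "N dvd d"
    and u: "\<And>k. k < n \<Longrightarrow> N dvd w k \<cdot> u" and i: "i < n" "\<not> q dvd u i"
    and x: "\<And>k. k < n \<Longrightarrow> N dvd w k \<cdot> x"
  shows "\<exists>c. \<forall>i<n. N dvd x i - c * u i"
proof (cases "s = 0")
  case True
  thus ?thesis using N by auto
next
  case False
  have oddN: "odd N" using q N by simp
  obtain cu where cu: "N dvd u i - cu * r i" if "i < n" for i
    using kernel_odd[OF oddN N(2) u] by blast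
  obtain cx where cx: "N dvd x i - cx * r i" if "i < n" for i
    using kernel_odd[OF oddN N(2) x] by blast
  have "\<not> q dvd cu"
  proof
    assume "q dvd cu"
    moreover have "q dvd N" using N(1) False by simp
    hence "q dvd u i - cu * r i" using cu[OF i(1)] dvd_trans by blast
    ultimately show False using i(2) by (metis dvd_add_right_iff dvd_mult2 diff_add_cancel)
  qed
  hence "coprime cu N" unfolding N(1)
    using q(1) by (metis coprime_commute coprime_power_left_iff prime_imp_coprime)
  then obtain b where b: "[cu * b = 1] (mod N)" using cong_solve_coprime_int by blast
  have "N dvd x i - (cx * b) * u i" if "i < n" for i
  proof -
    have "N dvd (1 - cu * b)" using b by (metis cong_iff_dvd_diff dvd_diff_commute)
    hence "N dvd (x i - cx * r i) - cx * b * (u i - cu * r i) + (1 - cu * b) * (cx * r i)"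
      using cx[OF that] cu[OF that] by auto
    also have "(x i - cx * r i) - cx * b * (u i - cu * r i) + (1 - cu * b) * (cx * r i)
       = x i - (cx * b) * u i" by (simp add: algebra_simps)
    finally show ?thesis .
  qed
  thus ?thesis by blast
qed

text \<open>Write x = c r + q s and y = c' r + q t. Since \<open>r\<close> lies in the kernel even
  modulo q^2, A r = m r holds modulo q^2, so every term of x^T (A - m) y that contains
  \<open>r\<close> vanishes and q^2 s^T (A - m) t remains. Hence x^T A y = m x^T y modulo
  q^2.\<close>

lemma kernel_inner_lin:
  fixes q :: int
  assumes q: "prime q" "odd q" "q\<^sup>2 dvd d"
    and x: "\<And>k. k < n \<Longrightarrow> q dvd w k \<cdot> x" and y: "\<And>k. k < n \<Longrightarrow> q dvd w k \<cdot> y"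
    and xy: "q\<^sup>2 dvd x \<cdot> y"
  shows "q\<^sup>2 dvd x \<cdot> L y"
proof -
  have qd: "q dvd d" using q(3) by (metis dvd_mult_left power2_eq_square)
  have rd: "q\<^sup>2 dvd w k \<cdot> r" if "k < n" for k using r_kernel[OF that] q(3) dvd_trans by blast
  obtain i where i: "i < n" "\<not> q dvd r i" using r_nonzero q(1) not_prime_unit by blast
  obtain m where m: "q\<^sup>2 dvd L r i - m * r i" if "i < n" for i
    using kernel_generator[OF q(1,2) refl q(3), of r i "L r"] rd i walk_vec_dvd_all[of "q\<^sup>2" r]
    unfolding walk_vec_inner_lin by blast
  have ex: "\<exists>c s. \<forall>i<n. x i = c * r i + q * s i" if x: "\<And>k. k < n \<Longrightarrow> q dvd w k \<cdot> x" for x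
  proof -
    obtain c where c: "\<And>i. i < n \<Longrightarrow> q dvd x i - c * r i"
      using kernel_odd[OF q(2) qd, of x] x by blast
    have "\<forall>i. \<exists>s. i < n \<longrightarrow> x i - c * r i = q * s" using c by (auto elim!: dvdE)
    then obtain s where "\<And>i. i < n \<Longrightarrow> x i - c * r i = q * s i" by metis
    thus ?thesis by (intro exI[of _ c] exI[of _ s]) (auto simp: algebra_simps)
  qed
  obtain c s where xs: "\<And>i. i < n \<Longrightarrow> x i = c * r i + q * s i" using ex[of x] x by blast
  obtain c' t where yt: "\<And>i. i < n \<Longrightarrow> y i = c' * r i + q * t i" using ex[of y] y by blast
  have "\<forall>i. \<exists>v. i < n \<longrightarrow> L r i - m * r i = q\<^sup>2 * v" using m by (auto elim!: dvdE)
  then obtain v where v: "\<And>i. i < n \<Longrightarrow> L r i = m * r i + q\<^sup>2 * v i"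
    by (metis add.commute diff_add_cancel)
  have Lr: "L r \<cdot> f = m * (r \<cdot> f) + q\<^sup>2 * (v \<cdot> f)" for f
  proof -
    have "L r \<cdot> f = (\<lambda>i. m * r i + q\<^sup>2 * v i) \<cdot> f" using v by (intro dot_cong) auto
    thus ?thesis by (simp add: dot_linear)
  qed
  have e1: "x \<cdot> f = c * (r \<cdot> f) + q * (s \<cdot> f)" for f
  proof -
    have "x \<cdot> f = (\<lambda>i. c * r i + q * s i) \<cdot> f" using xs by (intro dot_cong) auto
    thus ?thesis by (simp add: dot_linear)
  qed
  have e2: "f \<cdot> y = c' * (f \<cdot> r) + q * (f \<cdot> t)" for f
  proof -
    have "f \<cdot> y = f \<cdot> (\<lambda>i. c' * r i + q * t i)" using yt by (intro dot_cong) auto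
    thus ?thesis by (simp add: dot_linear)
  qed
  have "x \<cdot> L y = L x \<cdot> y" by (simp add: mat_apply_adjoint)
  also have "\<dots> = c' * (x \<cdot> L r) + q * (x \<cdot> L t)" by (simp add: e2 mat_apply_adjoint)
  also have "\<dots> = c' * (L r \<cdot> x) + q * (c * (L r \<cdot> t) + q * (s \<cdot> L t))"
    using e1[of "L t"] by (simp only: mat_apply_adjoint[of r t] dot_commute[of n x "L r"])
  also have "\<dots> = m * (x \<cdot> y) + q\<^sup>2 * (c' * (v \<cdot> x) + c * q * (v \<cdot> t) + s \<cdot> L t - m * (s \<cdot> t))"
    unfolding Lr e1[of y] e2 dot_commute[of n r x] e1[of r] e1[of t]
    by (simp add: algebra_simps power2_eq_square)
  finally show ?thesis using xy by (simp add: dvd_add)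
qed

lemma kernel_lin:
  assumes "\<And>k. k < n \<Longrightarrow> N dvd w k \<cdot> x"
  shows "N dvd w k \<cdot> L x"
  unfolding walk_vec_inner_lin using walk_vec_dvd_all[OF assms] by blast

text \<open>Let \<open>X\<close> be the lattice of all \<open>x\<close> with \<open>W\<^sup>T x\<close> divisible by \<open>d\<close>, which is generated by the
  vectors \<open>A\<^sup>k x\<^sub>0\<close> for the dual vector \<open>x\<^sub>0\<close>.  An isotropic \<open>u\<close> would make \<open>A\<close> act as a scalar on \<open>X\<close>
  modulo the sublattice \<open>K\<close> below, so that \<open>X / K\<close> would be a cyclic group, but the
  classes of \<open>d' u\<close> and \<open>d e\<^sub>i\<close> do not lie in a common cyclic subgroup.\<close>

lemma no_isotropic_kernel_vector:
  fixes N q d' :: int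
  assumes q: "prime q" "odd q" and N: "N = q ^ s" "d = N * d'" "\<not> q dvd d'"
    and u: "\<And>k. k < n \<Longrightarrow> N dvd w k \<cdot> u"
    and i: "i < n" "\<not> q dvd u i"
    and iso: "N\<^sup>2 dvd u \<cdot> u" "N\<^sup>2 dvd u \<cdot> L u" and s: "s > 0"
  shows False
proof -
  have Nd: "N dvd d" using N by simp
  have N0: "N \<noteq> 0" using N(2) d_pos by (cases "N = 0") simp_all
  have cop: "coprime c N" if "\<not> q dvd c" for c
    unfolding N(1) using q(1) that
    by (metis coprime_commute coprime_power_left_iff prime_imp_coprime)
  have qN: "q dvd N" using N(1) s by simp
  have gen: "\<exists>c. \<forall>i<n. N dvd x i - c * u i" if "\<And>k. k < n \<Longrightarrow> N dvd w k \<cdot> x" for x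
    using kernel_generator[OF q N(1) Nd, of u i x] u i that by blast
  obtain m where m: "\<And>i. i < n \<Longrightarrow> N dvd L u i - m * u i"
    using gen[of "L u"] kernel_lin[OF u] by blast
  have "\<forall>i. \<exists>t. i < n \<longrightarrow> L u i - m * u i = N * t" using m by (auto elim!: dvdE)
  then obtain t where t: "\<And>i. i < n \<Longrightarrow> L u i - m * u i = N * t i" by metis
  \<comment> \<open>Isotropy enters here: u^T (A - m) u is divisible by N^2 and equals N u^T t, so
    the deviation \<open>t\<close> is orthogonal to \<open>u\<close> modulo
    \<open>N\<close>.\<close>
  have "N * (u \<cdot> t) = u \<cdot> (\<lambda>i. L u i - m * u i)"
    unfolding dot_scale_right[symmetric] by (intro dot_cong) (simp_all add: t)
  also have "\<dots> = u \<cdot> L u - m * (u \<cdot> u)" by (simp add: dot_linear)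
  also have "N * N dvd \<dots>" using iso by (simp add: power2_eq_square)
  finally have ut: "N dvd u \<cdot> t" using N0 by simp

  define X where "X = {x. \<forall>k<n. d dvd w k \<cdot> x}"
  \<comment> \<open>The vectors N t with \<open>t\<close> orthogonal to \<open>u\<close> modulo
    \<open>N\<close>; pairing with \<open>u\<close> maps \<open>K\<close> into the multiples of
    N^2.\<close>
  define K where "K = {x. \<exists>t. (\<forall>i<n. x i = N * t i) \<and> N dvd u \<cdot> t}"
  have K_add: "(\<lambda>i. x i + y i) \<in> K" if x: "x \<in> K" and y: "y \<in> K" for x y
  proof -
    obtain t1 where "\<forall>i<n. x i = N * t1 i" "N dvd u \<cdot> t1" using x unfolding K_def by blast
    moreover obtain t2 where "\<forall>i<n. y i = N * t2 i" "N dvd u \<cdot> t2" using y unfolding K_def by blast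
    ultimately show ?thesis unfolding K_def
      by (intro CollectI exI[of _ "\<lambda>i. t1 i + t2 i"]) (auto simp: dot_linear distrib_left)
  qed
  have K_scale: "(\<lambda>i. c * x i) \<in> K" if x: "x \<in> K" for x c
  proof -
    obtain t1 where "\<forall>i<n. x i = N * t1 i" "N dvd u \<cdot> t1" using x unfolding K_def by blast
    thus ?thesis unfolding K_def
      by (intro CollectI exI[of _ "\<lambda>i. c * t1 i"]) (auto simp: dot_linear mult_ac)
  qed
  have X_lin: "L x \<in> X" if "x \<in> X" for x
    using kernel_lin[of d x] that unfolding X_def by auto
  have scalar: "(\<lambda>i. L x i - m * x i) \<in> K" if "x \<in> X" for x
  proof -
    have xN: "\<And>k. k < n \<Longrightarrow> N dvd w k \<cdot> x" using that Nd unfolding X_def by (auto intro: dvd_trans)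
    obtain c where c: "\<And>i. i < n \<Longrightarrow> N dvd x i - c * u i" using gen[OF xN] by blast
    have "N dvd L x i - m * x i" if "i < n" for i
    proof -
      have "N dvd L x i - L (\<lambda>i. c * u i) i" using c by (intro mat_apply_dvd_diff) auto
      hence "N dvd L x i - c * L u i" by (simp add: mat_apply_scale)
      hence "N dvd (L x i - c * L u i) + c * (L u i - m * u i) - m * (x i - c * u i)"
        using m[OF that] c[OF that] by auto
      also have "(L x i - c * L u i) + c * (L u i - m * u i) - m * (x i - c * u i) = L x i - m * x i"
        by (simp add: algebra_simps)
      finally show ?thesis .
    qed
    hence "\<forall>i. \<exists>t. i < n \<longrightarrow> L x i - m * x i = N * t" by (auto elim!: dvdE)
    then obtain t' where t': "\<And>i. i < n \<Longrightarrow> L x i - m * x i = N * t' i" by metis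
    \<comment> \<open>A - m is self-adjoint and moves from \<open>x\<close> onto \<open>u\<close>,
      where it yields \<open>N\<close> times \<open>t\<close>. Since \<open>x\<close> is a multiple
      of \<open>u\<close> modulo \<open>N\<close> and \<open>t\<close> is orthogonal to
      \<open>u\<close> modulo \<open>N\<close>, the result is divisible by N^2.\<close>
    have "N * (u \<cdot> t') = u \<cdot> (\<lambda>i. L x i - m * x i)"
      unfolding dot_scale_right[symmetric] by (intro dot_cong) (simp_all add: t')
    also have "\<dots> = (\<lambda>i. L u i - m * u i) \<cdot> x" by (simp add: dot_linear mat_apply_adjoint)
    also have "\<dots> = N * (t \<cdot> x)"
      unfolding dot_scale_left[symmetric] by (intro dot_cong) (simp_all add: t)
    finally have e: "u \<cdot> t' = t \<cdot> x" using N0 by simp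
    have "N dvd t \<cdot> x - t \<cdot> (\<lambda>i. c * u i)" using c by (intro dot_dvd_diff_right)
    moreover have "N dvd t \<cdot> (\<lambda>i. c * u i)" using ut by (simp add: dot_scale_right dot_commute[of n t u])
    ultimately have "N dvd u \<cdot> t'" unfolding e by (metis dvd_add diff_add_cancel)
    thus ?thesis unfolding K_def using t' by blast
  qed

  obtain x0 where x0: "\<And>k. k < n \<Longrightarrow> w k \<cdot> x0 = (if k = n - 1 then d else 0)"
    using dual_vector by blast
  have x0X: "x0 \<in> X" unfolding X_def using x0 by simp
  have powX: "(L ^^ k) x0 \<in> X" for k by (induction k) (auto simp: x0X X_lin)
  have pow: "\<exists>c. (\<lambda>i. (L ^^ k) x0 i - c * x0 i) \<in> K" for k
  proof (induction k)
    case 0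
    have "(\<lambda>i. (L ^^ 0) x0 i - 1 * x0 i) \<in> K" unfolding K_def by (intro CollectI exI[of _ "\<lambda>_. 0"]) (simp add: dot_def)
    thus ?case by blast
  next
    case (Suc k)
    then obtain c where c: "(\<lambda>i. (L ^^ k) x0 i - c * x0 i) \<in> K" by blast
    have "(\<lambda>i. (L ((L ^^ k) x0) i - m * (L ^^ k) x0 i) + m * ((L ^^ k) x0 i - c * x0 i)) \<in> K"
      by (intro K_add K_scale c scalar powX)
    also have "(\<lambda>i. (L ((L ^^ k) x0) i - m * (L ^^ k) x0 i) + m * ((L ^^ k) x0 i - c * x0 i))
        = (\<lambda>i. (L ^^ Suc k) x0 i - (m * c) * x0 i)"
      by (simp add: algebra_simps)
    finally show ?case by blast
  qed
  \<comment> \<open>Induction on the number \<open>k\<close> of trailing pairings with walk vectors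
    that may be nonzero. The vector A^k x0 pairs to 0 with \<open>w i\<close> for
    \<open>i < n - 1 - k\<close> and to \<open>d\<close> for \<open>i = n - 1 - k\<close>, so
    subtracting a multiple of it clears one more pairing.\<close>
  have gen_X: "\<exists>c. (\<lambda>i. x i - c * x0 i) \<in> K" if "x \<in> X" "k \<le> n" "\<And>i. i < n - k \<Longrightarrow> w i \<cdot> x = 0" for k x
    using that
  proof (induction k arbitrary: x)
    case 0
    hence "x i = 0" if "i < n" for i
      using inner_wk_eq_0[of x i] that by simp
    hence "(\<lambda>i. x i - 0 * x0 i) \<in> K" unfolding K_def by (intro CollectI exI[of _ "\<lambda>_. 0"]) (simp add: dot_def)
    thus ?case by blast
  next
    case (Suc k)
    define l where "l = n - Suc k"
    have l: "l < n" "l + k = n - 1" using Suc.prems(2) by (auto simp: l_def)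
    obtain g where g: "w l \<cdot> x = d * g" using Suc.prems(1) l(1) unfolding X_def by (auto elim: dvdE)
    define y where "y = (\<lambda>i. x i - g * (L ^^ k) x0 i)"
    have wy: "w i \<cdot> y = w i \<cdot> x - g * (w (i + k) \<cdot> x0)" for i
      unfolding y_def by (simp add: dot_linear mat_apply_pow_adjoint[symmetric] walk_vec_add[symmetric] add.commute)
    have "y \<in> X" using Suc.prems(1) powX[of k] unfolding X_def y_def by (auto simp: dot_linear)
    moreover have "w i \<cdot> y = 0" if "i < n - k" for i
    proof (cases "i = l")
      case True
      thus ?thesis unfolding wy using g l x0[of "l + k"] by auto
    next
      case False
      hence "i < l" using that l by auto
      moreover from this have "i + k < n - 1" using l by auto
      ultimately show ?thesis unfolding wy using Suc.prems(3)[of i] x0[of "i + k"] by (auto simp: l_def)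
    qed
    ultimately obtain c where c: "(\<lambda>i. y i - c * x0 i) \<in> K" using Suc.IH[of y] Suc.prems(2) by auto
    obtain c' where c': "(\<lambda>i. (L ^^ k) x0 i - c' * x0 i) \<in> K" using pow by blast
    have "(\<lambda>i. (y i - c * x0 i) + g * ((L ^^ k) x0 i - c' * x0 i)) \<in> K"
      by (intro K_add K_scale c c')
    also have "(\<lambda>i. (y i - c * x0 i) + g * ((L ^^ k) x0 i - c' * x0 i)) = (\<lambda>i. x i - (c + g * c') * x0 i)"
      by (simp add: y_def algebra_simps)
    finally show ?case by blast
  qed

  \<comment> \<open>Both d' u and d times the \<open>i\<close>-th unit vector are multiples of
    \<open>x0\<close> modulo \<open>K\<close>. Reading these two relations at coordinate
    \<open>i\<close> and pairing them with \<open>u\<close> produces the contradiction.\<close>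
  have "(\<lambda>i. d' * u i) \<in> X" unfolding X_def using u by (auto simp: dot_linear N(2) mult.commute[of _ d'])
  from gen_X[OF this, of n] obtain c1 where "(\<lambda>i. d' * u i - c1 * x0 i) \<in> K" by auto
  then obtain t1 where t1: "\<And>i. i < n \<Longrightarrow> d' * u i - c1 * x0 i = N * t1 i" "N dvd u \<cdot> t1"
    unfolding K_def by blast
  let ?e = "\<lambda>j. if j = i then 1 else 0 :: int"
  have "(\<lambda>j. d * ?e j) \<in> X" unfolding X_def by (simp only: dot_scale_right mem_Collect_eq) auto
  from gen_X[OF this, of n] obtain c2 where "(\<lambda>j. d * ?e j - c2 * x0 j) \<in> K" by auto
  then obtain t2 where t2: "\<And>j. j < n \<Longrightarrow> d * ?e j - c2 * x0 j = N * t2 j" "N dvd u \<cdot> t2"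
    unfolding K_def by blast
  have c1: "\<not> q dvd c1 * x0 i"
  proof
    assume "q dvd c1 * x0 i"
    moreover have "q dvd d' * u i - c1 * x0 i" using t1(1)[OF i(1)] qN by simp
    ultimately have "q dvd d' * u i" by (metis dvd_add_right_iff diff_add_cancel)
    thus False using q(1) i(2) N(3) by (simp add: prime_dvd_mult_iff)
  qed
  \<comment> \<open>Coordinate \<open>i\<close> of the second relation: \<open>x0 i\<close> is a
    unit modulo \<open>N\<close>, so \<open>N\<close> must divide \<open>c2\<close>.\<close>
  have "N dvd d * ?e i - c2 * x0 i" using t2(1)[OF i(1)] by simp
  hence "N dvd c2 * x0 i" using Nd by (metis dvd_mult2 dvd_diff_right_iff dvd_diff_commute)
  moreover have "coprime (x0 i) N" using c1 by (intro cop) auto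
  ultimately have "N dvd c2" by (simp add: coprime_commute coprime_dvd_mult_left_iff)
  then obtain g where g: "c2 = N * g" by (elim dvdE)
  have "c1 * (u \<cdot> x0) = d' * (u \<cdot> u) - N * (u \<cdot> t1)"
  proof -
    have "N * (u \<cdot> t1) = u \<cdot> (\<lambda>i. d' * u i - c1 * x0 i)"
      unfolding dot_scale_right[symmetric] by (intro dot_cong) (simp_all add: t1)
    thus ?thesis by (simp add: dot_linear)
  qed
  moreover have "N * N dvd d' * (u \<cdot> u) - N * (u \<cdot> t1)"
    using iso(1) t1(2) by (auto simp: power2_eq_square)
  ultimately have "N * N dvd c1 * (u \<cdot> x0)" by simp
  moreover have "\<not> q dvd c1" using c1 by auto
  hence "coprime c1 (N * N)" using cop[of c1] by simp
  ultimately have "N * N dvd u \<cdot> x0" by (simp add: coprime_commute coprime_dvd_mult_right_iff)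
  hence ux0: "N dvd u \<cdot> x0" by (rule dvd_mult_left)
  \<comment> \<open>The second relation paired with \<open>u\<close>, with one factor
    \<open>N\<close> cancelled: what remains would make \<open>N\<close> divide
    \<open>d' * u i\<close>, which is prime to \<open>q\<close>.\<close>
  have "N * (u \<cdot> t2) = u \<cdot> (\<lambda>j. d * ?e j - c2 * x0 j)"
    unfolding dot_scale_right[symmetric] by (intro dot_cong) (simp_all add: t2)
  also have "\<dots> = N * (d' * u i - g * (u \<cdot> x0))"
    using i(1) by (simp only: dot_linear dot_unit_right N(2) g) (simp add: algebra_simps)
  finally have "u \<cdot> t2 = d' * u i - g * (u \<cdot> x0)" using N0 by simp
  hence "N dvd d' * u i" using t2(2) ux0 by (metis dvd_mult dvd_add diff_add_cancel)
  hence "q dvd d' * u i" using qN dvd_trans by blast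
  thus False using q(1) i(2) N(3) by (simp add: prime_dvd_mult_iff)
qed

end

section \<open>Isotropic kernel vectors modulo 2\<close>

lemma even_symmetric_double_sum:
  fixes f :: "nat \<Rightarrow> nat \<Rightarrow> int"
  assumes "\<And>i j. f i j = f j i" "\<And>i. f i i = 0"
  shows "even (\<Sum>i<n. \<Sum>j<n. f i j)"
proof (induction n)
  case (Suc n)
  have "(\<Sum>i<Suc n. \<Sum>j<Suc n. f i j) = (\<Sum>i<n. \<Sum>j<n. f i j) + 2 * (\<Sum>i<n. f i n)"
    by (simp add: sum.distrib assms(2) assms(1)[of n])
  thus ?case using Suc by simp
qed simp

text \<open>Off-diagonal terms occur in equal pairs, and twice an even number vanishes modulo
  4.\<close>

lemma symmetric_double_sum_cong_4:
  fixes g :: "nat \<Rightarrow> nat \<Rightarrow> int"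
  assumes "finite I" "\<And>i j. g i j = g j i" "\<And>i j. i \<in> I \<Longrightarrow> j \<in> I \<Longrightarrow> even (g i j)"
  shows "4 dvd (\<Sum>i\<in>I. \<Sum>j\<in>I. g i j) - (\<Sum>i\<in>I. g i i)"
  using assms(1,3)
proof (induction I rule: finite_induct)
  case (insert x F)
  have "(\<Sum>i\<in>insert x F. \<Sum>j\<in>insert x F. g i j) - (\<Sum>i\<in>insert x F. g i i)
     = ((\<Sum>i\<in>F. \<Sum>j\<in>F. g i j) - (\<Sum>i\<in>F. g i i)) + 2 * (\<Sum>i\<in>F. g i x)"
  proof -
    have "(\<Sum>j\<in>F. g x j) = (\<Sum>i\<in>F. g i x)" by (intro sum.cong refl assms(2))
    thus ?thesis using insert.hyps by (simp add: sum.distrib)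
  qed
  moreover have "even (\<Sum>i\<in>F. g i x)" using insert.prems by (intro dvd_sum) auto
  hence "4 dvd 2 * (\<Sum>i\<in>F. g i x)" by presburger
  moreover have "4 dvd (\<Sum>i\<in>F. \<Sum>j\<in>F. g i j) - (\<Sum>i\<in>F. g i i)"
    using insert.prems by (intro insert.IH) simp
  ultimately show ?case by (simp only: dvd_add)
qed simp

locale graph_matrix = symmetric_walks n a for n :: nat and a :: "nat \<Rightarrow> nat \<Rightarrow> int" +
  assumes diag_0: "a i i = 0"
begin

lemma even_inner_lin: "even (x \<cdot> L x)"
proof -
  have "x \<cdot> L x = (\<Sum>i<n. \<Sum>j<n. a i j * x i * x j)"
    by (simp add: dot_def mat_apply_def sum_distrib_left mult_ac)
  moreover have "a i j * x i * x j = a j i * x j * x i" for i j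
    using sym[of i j] by simp
  ultimately show ?thesis
    using even_symmetric_double_sum[of "\<lambda>i j. a i j * x i * x j" n] diag_0 by simp
qed

text \<open>For m = 2 l the count is the squared length of A^l e, which has the parity of the sum of
  the entries of A^l e because t^2 and t agree modulo 2; induction applies to \<open>l\<close>. For
  odd \<open>m\<close> the count is a value of the quadratic form of A, which is even since A is
  symmetric with zero diagonal.\<close>

lemma even_walk_count: "m > 0 \<Longrightarrow> even (w 0 \<cdot> w m)"
proof (induction m rule: less_induct)
  case (less m)
  show ?case
  proof (cases "even m")
    case True
    then obtain l where l: "m = l + l" by (metis evenE mult_2)
    have "even (\<Sum>i<n. w l i * w l i - w l i)" by (intro dvd_sum) simp
    moreover have "(\<Sum>i<n. w l i * w l i - w l i) = w 0 \<cdot> w m - w 0 \<cdot> w l"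
      using walk_vec_inner_wk[of l l] by (simp add: l dot_def walk_vec_0 sum_subtractf)
    moreover have "even (w 0 \<cdot> w l)" using less l by simp
    ultimately show ?thesis by simp
  next
    case False
    then obtain l where l: "m = l + Suc l" by (metis oddE Suc_eq_plus1 add_Suc_right mult_2)
    show ?thesis unfolding l walk_vec_inner_wk[symmetric] walk_vec_Suc by (rule even_inner_lin)
  qed
qed

lemma mat_apply_pow_add: "(L ^^ k) (\<lambda>i. x i + y i) = (\<lambda>i. (L ^^ k) x i + (L ^^ k) y i)"
  by (induction k) (auto simp: mat_apply_add)

end

text \<open>The first two assumptions reflect that no invariant factor is divisible by 4, once for
  W^T and once for W. The index range in \<open>kernel_2\<close> has floor(n/2) elements, the
  dimension of the kernel of W^T modulo 2 for the graphs of the family. It starts at 1 for odd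
  \<open>n\<close> because then e^T e = n is odd and \<open>e\<close> is not in the kernel.\<close>

locale graph_walks = smith_walks n a d r + graph_matrix n a for n a d r +
  assumes inner_wk_dvd_4: "(\<And>k. k < n \<Longrightarrow> 4 dvd w k \<cdot> x) \<Longrightarrow> i < n \<Longrightarrow> even (x i)"
    and comb_wk_dvd_4: "(\<And>i. i < n \<Longrightarrow> 4 dvd (\<Sum>k<n. c k * w k i)) \<Longrightarrow> k < n \<Longrightarrow> even (c k)"
    and kernel_2: "(\<And>k. k < n \<Longrightarrow> even (w k \<cdot> x)) \<Longrightarrow>
      \<exists>f. \<forall>i<n. even (x i - (\<Sum>k\<in>{n mod 2..<(n + 1) div 2}. f k * w k i))"
begin

text \<open>Modulo 2 the vector \<open>u\<close> is \<open>f(A) e\<close>; since squaring is additive modulo 2 and all walk counts that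
  occur are even, \<open>u\<^sup>T A\<^sup>j u\<close> is \<open>e\<^sup>T A\<^sup>j f(A\<^sup>2) e\<close> modulo 4.\<close>

lemma isotropic_kernel_vector_even:
  assumes u: "\<And>k. k < n \<Longrightarrow> even (w k \<cdot> u)" and iso: "\<And>k. 4 dvd u \<cdot> (L ^^ k) u" and i: "i < n"
  shows "even (u i)"
proof -
  define I where "I = {n mod 2..<(n + 1) div 2}"
  have fin: "finite I" by (simp add: I_def)
  have Ilt: "2 * k < n" if "k \<in> I" for k using that by (auto simp: I_def)
  have walk_even: "even (w 0 \<cdot> w m)" if "m > 0 \<or> 0 \<in> I" for m
  proof (cases "m > 0")
    case False
    hence "m = 0" "n mod 2 = 0" using that by (auto simp: I_def)
    thus ?thesis by (simp add: dot_def walk_vec_0 mod_eq_0_iff_dvd)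
  qed (rule even_walk_count)
  obtain f where f: "\<And>i. i < n \<Longrightarrow> even (u i - (\<Sum>k\<in>I. f k * w k i))"
    using kernel_2[of u] u unfolding I_def by blast
  define x where "x = (\<lambda>i. \<Sum>k\<in>I. f k * w k i)"
  define D where "D = (\<lambda>i. u i - x i)"
  have D_even: "even (D i)" if "i < n" for i using f[OF that] by (simp add: D_def x_def)
  have u_eq: "u = (\<lambda>i. x i + D i)" by (simp add: D_def)
  define y where "y = (\<lambda>i. \<Sum>k\<in>I. f k * w (2 * k) i)"
  have "4 dvd w j \<cdot> y" for j
  proof -
    \<comment> \<open>The cross term carries a factor 2 besides the even vector \<open>D\<close>,
      and the last term contains \<open>D\<close> twice, so \<open>D\<close> drops out modulo
      4.\<close>
    have "u \<cdot> (L ^^ j) u = x \<cdot> (L ^^ j) x + 2 * (D \<cdot> (L ^^ j) x) + D \<cdot> (L ^^ j) D"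
      unfolding u_eq mat_apply_pow_add
      by (simp add: dot_linear mat_apply_pow_adjoint[symmetric, of x j] dot_commute[of n "(L ^^ j) x" D])
    moreover have "4 dvd D \<cdot> (L ^^ j) D"
      unfolding dot_def
    proof (rule dvd_sum)
      fix i assume "i \<in> {..<n}"
      hence "2 dvd D i" "2 dvd (L ^^ j) D i" using D_even mat_apply_pow_dvd[where x = D and N = 2 and n = n and k = j] by simp_all
      from mult_dvd_mono[OF this] show "4 dvd D i * (L ^^ j) D i" by simp
    qed
    moreover have "even ((L ^^ j) x \<cdot> D)" using D_even by (intro dot_dvd_right) auto
    hence "4 dvd 2 * (D \<cdot> (L ^^ j) x)" by (auto simp: dot_commute elim!: evenE)
    ultimately have 1: "4 dvd x \<cdot> (L ^^ j) x"
      using iso[of j] by (metis dvd_add_left_iff)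
    define g where "g k l = f k * f l * (w 0 \<cdot> w (k + l + j))" for k l
    have "(L ^^ j) x = (\<lambda>i. \<Sum>k\<in>I. f k * w (k + j) i)"
      unfolding x_def by (induction j) (auto simp: mat_apply_sum mat_apply_scale walk_vec_Suc)
    hence "x \<cdot> (L ^^ j) x = (\<Sum>k\<in>I. \<Sum>l\<in>I. f k * (f l * (w k \<cdot> w (l + j))))"
      by (simp add: x_def dot_sum_left dot_sum_right dot_linear sum_distrib_left mult_ac)
    also have "\<dots> = (\<Sum>k\<in>I. \<Sum>l\<in>I. g k l)"
      unfolding g_def by (simp add: walk_vec_inner_wk[of _ "_ + j"] mult_ac add_ac)
    finally have 2: "x \<cdot> (L ^^ j) x = (\<Sum>k\<in>I. \<Sum>l\<in>I. g k l)" .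
    have g_even: "even (w 0 \<cdot> w (k + l + j))" if "k \<in> I" "l \<in> I" for k l
      using that by (intro walk_even) (cases "k = 0", auto)
    have 3: "4 dvd (\<Sum>k\<in>I. \<Sum>l\<in>I. g k l) - (\<Sum>k\<in>I. g k k)"
      using fin g_even by (intro symmetric_double_sum_cong_4) (auto simp: g_def mult_ac add_ac)
    have "4 dvd (\<Sum>k\<in>I. g k k - f k * (w 0 \<cdot> w (k + k + j)))"
    proof (rule dvd_sum)
      fix k assume "k \<in> I"
      then obtain t where t: "w 0 \<cdot> w (k + k + j) = 2 * t" using g_even[of k k] by (auto elim: evenE)
      \<comment> \<open>The square of \<open>f k\<close> agrees with \<open>f k\<close> modulo 2;
        multiplied by an even walk count, this becomes an agreement modulo 4.\<close>
      have "even (f k * f k - f k)" by simp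
      then obtain s where s: "f k * f k - f k = 2 * s" by (elim evenE)
      have "g k k - f k * (w 0 \<cdot> w (k + k + j)) = (f k * f k - f k) * (w 0 \<cdot> w (k + k + j))"
        by (simp add: g_def algebra_simps)
      also have "\<dots> = 4 * (s * t)" by (simp add: s t)
      finally show "4 dvd g k k - f k * (w 0 \<cdot> w (k + k + j))" by simp
    qed
    hence 4: "4 dvd (\<Sum>k\<in>I. g k k) - (\<Sum>k\<in>I. f k * (w 0 \<cdot> w (k + k + j)))"
      by (simp add: sum_subtractf)
    have "w j \<cdot> y = (\<Sum>k\<in>I. f k * (w 0 \<cdot> w (k + k + j)))"
      unfolding y_def dot_sum_right dot_scale_right walk_vec_inner_wk[of j]
      by (simp add: mult_2 add_ac)
    thus ?thesis using 1 2 3 4 by (metis dvd_diff_right_iff dvd_diff_commute)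
  qed
  note y4 = this
  have "\<forall>i. \<exists>t. i < n \<longrightarrow> y i = 2 * t" using inner_wk_dvd_4[OF y4] by (auto elim!: evenE)
  then obtain y' where y': "\<And>i. i < n \<Longrightarrow> y i = 2 * y' i" by metis
  have "even (w k \<cdot> y')" for k
  proof -
    have "w k \<cdot> y = 2 * (w k \<cdot> y')"
      unfolding dot_scale_right[symmetric] using y' by (intro dot_cong) auto
    thus ?thesis using y4[of k] by presburger
  qed
  then obtain h where h: "\<And>i. i < n \<Longrightarrow> even (y' i - (\<Sum>k\<in>I. h k * w k i))"
    using kernel_2[of y'] unfolding I_def by blast
  \<comment> \<open>The coefficients of f(A^2) e - 2 h(A) e with respect to the walk vectors; the
    exponents \<open>2 * k\<close> stay below \<open>n\<close> for \<open>k\<close> in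
    \<open>I\<close>. This combination vanishes modulo 4, so its coefficients are even, and
    therefore so are those of \<open>f\<close>.\<close>
  define c where "c m = (if even m \<and> m div 2 \<in> I then f (m div 2) else 0) - 2 * (if m \<in> I then h m else 0)" for m
  have c_even: "even (c k)" if "k < n" for k
  proof (rule comb_wk_dvd_4[OF _ that])
    fix i assume i: "i < n"
    have "(\<Sum>k<n. (if even k \<and> k div 2 \<in> I then f (k div 2) else 0) * w k i)
      = (\<Sum>k\<in>(\<lambda>k. 2 * k) ` I. f (k div 2) * w k i)"
      using Ilt by (intro sum.mono_neutral_cong_right) (auto simp: image_iff elim!: evenE)
    also have "\<dots> = y i" unfolding y_def by (subst sum.reindex) (auto simp: inj_on_def)
    finally have 1: "(\<Sum>k<n. (if even k \<and> k div 2 \<in> I then f (k div 2) else 0) * w k i) = y i" .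
    have 2: "(\<Sum>k<n. (if k \<in> I then h k else 0) * w k i) = (\<Sum>k\<in>I. h k * w k i)"
      using Ilt by (intro sum.mono_neutral_cong_right) force+
    have "(\<Sum>k<n. c k * w k i) = y i - 2 * (\<Sum>k\<in>I. h k * w k i)"
      unfolding c_def left_diff_distrib sum_subtractf mult.assoc sum_distrib_left[symmetric] 1 2 ..
    also have "\<dots> = 2 * (y' i - (\<Sum>k\<in>I. h k * w k i))" using y'[OF i] by simp
    finally show "4 dvd (\<Sum>k<n. c k * w k i)" using h[OF i] by presburger
  qed
  have "even (f k)" if "k \<in> I" for k
    using c_even[OF Ilt[OF that]] that by (simp add: c_def)
  hence "even (x i)" unfolding x_def by (intro dvd_sum) auto
  thus ?thesis using D_even[OF i] by (simp add: D_def)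
qed

end

section \<open>The walk matrix and its Smith normal form\<close>

definition adj_fun :: "nat set set \<Rightarrow> nat \<Rightarrow> nat \<Rightarrow> int" where
  "adj_fun E i j = (if {i, j} \<in> E then 1 else 0)"

lemma adj_mat_eq: "Defs.adj_mat n E = mat n n (\<lambda>(i, j). adj_fun E i j)"
  by (simp add: Defs.adj_mat_def adj_fun_def)

lemma adj_fun_graph_matrix:
  assumes "simple_graph n E"
  shows "graph_matrix (adj_fun E)"
proof
  show "adj_fun E i j = adj_fun E j i" for i j by (simp add: adj_fun_def insert_commute)
  have "{i, i} \<notin> E" for i
  proof
    assume "{i, i} \<in> E"
    hence "{i, i} \<in> complete_edges n" using assms by (auto simp: simple_graph_def)
    thus False by (simp add: complete_edges_def)
  qed
  thus "adj_fun E i i = 0" for i by (simp add: adj_fun_def)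
qed

lemma mult_mat_vec_index_sum:
  assumes "A \<in> carrier_mat n m" "x \<in> carrier_vec m" "i < n"
  shows "(A *\<^sub>v x) $ i = (\<Sum>j<m. A $$ (i, j) * x $ j)"
proof -
  have "dim_row A = n" "dim_col A = m" "dim_vec x = m" using assms by auto
  thus ?thesis using assms(3) by (simp add: scalar_prod_def lessThan_atLeast0)
qed

lemma mat_apply_pow_cong:
  "(\<And>i. i < n \<Longrightarrow> x i = y i) \<Longrightarrow> i < n \<Longrightarrow> (mat_apply n a ^^ k) x i = (mat_apply n a ^^ k) y i"
  using mat_apply_cong[of n x y a] by (cases k) (simp_all add: funpow_Suc_right del: funpow.simps(2))

lemma pow_mat_mult_vec_index:
  fixes a :: "nat \<Rightarrow> nat \<Rightarrow> 'a :: comm_ring_1"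
  assumes "x \<in> carrier_vec n" "i < n"
  shows "(mat n n (\<lambda>(i, j). a i j) ^\<^sub>m k *\<^sub>v x) $ i = (mat_apply n a ^^ k) (\<lambda>i. x $ i) i"
  using assms
proof (induction k arbitrary: x)
  case (Suc k)
  let ?A = "mat n n (\<lambda>(i, j). a i j)"
  have A: "?A \<in> carrier_mat n n" by simp
  have Ax: "?A *\<^sub>v x \<in> carrier_vec n" using mult_mat_vec_carrier[OF A] Suc.prems by simp
  have "(?A ^\<^sub>m Suc k *\<^sub>v x) $ i = (?A ^\<^sub>m k *\<^sub>v (?A *\<^sub>v x)) $ i"
    using assoc_mult_mat_vec[OF pow_carrier_mat[OF A] A Suc.prems(1)] by simp
  also have "\<dots> = (mat_apply n a ^^ k) (\<lambda>i. (?A *\<^sub>v x) $ i) i"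
    using Suc.IH[OF Ax] Suc.prems by simp
  also have "\<dots> = (mat_apply n a ^^ k) (mat_apply n a (\<lambda>i. x $ i)) i"
    using Suc.prems mult_mat_vec_index_sum[OF A] by (intro mat_apply_pow_cong) (auto simp: mat_apply_def)
  finally show ?case by (simp add: funpow_swap1)
qed simp

lemma walk_mat_carrier: "walk_mat n E \<in> carrier_mat n n"
  by (simp add: walk_mat_def mat_of_cols_def)

lemma walk_mat_index:
  assumes "i < n" "k < n"
  shows "walk_mat n E $$ (i, k) = walk_vec n (adj_fun E) k i"
proof -
  have "walk_mat n E $$ (i, k) = (Defs.adj_mat n E ^\<^sub>m k *\<^sub>v all_ones_vec n) $ i"
    unfolding walk_mat_def using assms by (simp add: mat_of_cols_index)
  also have "\<dots> = (mat_apply n (adj_fun E) ^^ k) (\<lambda>i. all_ones_vec n $ i) i"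
    unfolding adj_mat_eq using assms by (intro pow_mat_mult_vec_index) (auto simp: all_ones_vec_def)
  also have "\<dots> = walk_vec n (adj_fun E) k i"
    unfolding walk_vec_def using assms by (intro mat_apply_pow_cong) (auto simp: all_ones_vec_def)
  finally show ?thesis .
qed

lemma det_mat_diag: "det (mat_diag n f) = (\<Prod>i<n. f i)"
proof -
  have "det (mat_diag n f) = prod_list (diag_mat (mat_diag n f))"
    by (rule det_upper_triangular[of _ n]) (auto simp: mat_diag_def)
  also have "\<dots> = (\<Prod>i<n. f i)"
    unfolding diag_mat_def by (simp add: mat_diag_def prod.list_conv_set_nth lessThan_atLeast0)
  finally show ?thesis .
qed

lemma power_dvd_det:
  fixes W :: "int mat"
  assumes W: "W \<in> carrier_mat n n" and m: "m \<le> n"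
    and even: "\<And>i j. i < n \<Longrightarrow> m \<le> j \<Longrightarrow> j < n \<Longrightarrow> q dvd W $$ (i, j)"
  shows "q ^ (n - m) dvd det W"
proof -
  define W' where "W' = mat n n (\<lambda>(i, j). if j < m then W $$ (i, j) else W $$ (i, j) div q)"
  define f where "f j = (if j < m then 1 else q)" for j
  have "W = W' * mat_diag n f"
  proof (rule eq_matI)
    fix i j assume "i < dim_row (W' * mat_diag n f)" "j < dim_col (W' * mat_diag n f)"
    hence ij: "i < n" "j < n" by (auto simp: W'_def mat_diag_def)
    have "(W' * mat_diag n f) $$ (i, j) = (\<Sum>l<n. W' $$ (i, l) * mat_diag n f $$ (l, j))"
      using ij by (intro index_mult_mat_sum) (auto simp: W'_def mat_diag_def)
    also have "\<dots> = (\<Sum>l<n. if l = j then W' $$ (i, l) * f l else 0)"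
      using ij by (intro sum.cong) (auto simp: mat_diag_def)
    also have "\<dots> = W' $$ (i, j) * f j" using ij by simp
    also have "\<dots> = W $$ (i, j)" using ij even[of i j] by (auto simp: W'_def f_def)
    finally show "W $$ (i, j) = (W' * mat_diag n f) $$ (i, j)" ..
  qed (use W in \<open>auto simp: W'_def mat_diag_def\<close>)
  hence "det W = det W' * det (mat_diag n f)"
    using det_mult[of W' n "mat_diag n f"] by (simp add: W'_def mat_diag_def)
  also have "det (mat_diag n f) = (\<Prod>i<n. f i)" by (rule det_mat_diag)
  also have "\<dots> = (\<Prod>i<m. f i) * (\<Prod>i=m..<n. f i)"
    using m by (simp add: lessThan_atLeast0 prod.atLeastLessThan_concat)
  also have "\<dots> = q ^ (n - m)" by (simp add: f_def)
  finally show ?thesis by simp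
qed

lemma mat_apply_pow_sum: "(mat_apply n a ^^ k) (\<lambda>i. \<Sum>t\<in>T. x t i) i = (\<Sum>t\<in>T. (mat_apply n a ^^ k) (x t) i)"
proof (induction k arbitrary: i)
  case (Suc k)
  have "(mat_apply n a ^^ k) (\<lambda>i. \<Sum>t\<in>T. x t i) = (\<lambda>i. \<Sum>t\<in>T. (mat_apply n a ^^ k) (x t) i)" using Suc by auto
  thus ?case by (simp add: mat_apply_sum)
qed simp

text \<open>A linear dependence of the first columns is a monic relation \<open>g(A) e = 0\<close> modulo \<open>q\<close>; all its
  multiples by powers of \<open>A\<close> then allow clearing the remaining columns.\<close>

lemma walk_dependence_dvd_det:
  fixes a :: "nat \<Rightarrow> nat \<Rightarrow> int"
  assumes T: "T \<noteq> {}" "T \<subseteq> {..m}" "m \<in> T" and m: "m < n"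
    and dep: "\<And>i. i < n \<Longrightarrow> q dvd (\<Sum>k\<in>T. walk_vec n a k i)"
  shows "q ^ (n - m) dvd det (mat n n (\<lambda>(i, k). walk_vec n a k i))"
proof -
  let ?W = "mat n n (\<lambda>(i, k). walk_vec n a k i)"
  \<comment> \<open>For \<open>j \<ge> m\<close> column \<open>j\<close> has its ones at
    \<open>T\<close> shifted by \<open>j - m\<close>, so column \<open>j\<close> of W R is A^(j-m)
    applied to the dependence. Since \<open>m\<close> is the maximum of \<open>T\<close>, the matrix
    is upper triangular with unit diagonal.\<close>
  define R where "R = mat n n (\<lambda>(k, j). if j < m then (if k = j then 1 else 0)
      else if k \<in> (\<lambda>t. t + (j - m)) ` T then 1 else 0 :: int)"
  have R: "R \<in> carrier_mat n n" by (simp add: R_def)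
  have ut: "upper_triangular R"
    using T by (auto simp: R_def upper_triangular_def)
  have "R $$ (j, j) = 1" if "j < n" for j
  proof -
    have "j \<in> (\<lambda>t. t + (j - m)) ` T" if "\<not> j < m" using T that by (intro image_eqI[of _ _ m]) auto
    thus ?thesis using that by (simp add: R_def)
  qed
  hence "diag_mat R = map (\<lambda>_. 1) [0..<n]" using R by (auto simp: diag_mat_def)
  hence "prod_list (diag_mat R) = 1" by (simp add: map_replicate_const)
  hence detR: "det R = 1" using det_upper_triangular[OF ut R] by simp
  have "q ^ (n - m) dvd det (?W * R)"
  proof (rule power_dvd_det)
    fix i j assume ij: "i < n" "m \<le> j" "j < n"
    have sub: "(\<lambda>t. t + (j - m)) ` T \<subseteq> {..<n}" using T ij by auto
    have "(?W * R) $$ (i, j) = (\<Sum>k<n. ?W $$ (i, k) * R $$ (k, j))"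
      using R ij by (intro index_mult_mat_sum) auto
    also have "\<dots> = (\<Sum>k\<in>(\<lambda>t. t + (j - m)) ` T. walk_vec n a k i)"
      using ij sub by (intro sum.mono_neutral_cong_right) (auto simp: R_def)
    also have "\<dots> = (\<Sum>t\<in>T. walk_vec n a (j - m + t) i)"
      by (subst sum.reindex) (auto simp: inj_on_def add.commute)
    also have "\<dots> = (mat_apply n a ^^ (j - m)) (\<lambda>i. \<Sum>t\<in>T. walk_vec n a t i) i"
      by (simp add: mat_apply_pow_sum walk_vec_def funpow_add)
    also have "q dvd \<dots>" using dep ij by (intro mat_apply_pow_dvd)
    finally show "q dvd (?W * R) $$ (i, j)" .
  qed (use m R in auto)
  also have "det (?W * R) = det ?W" using det_mult[OF _ R, of ?W] detR by simp
  finally show ?thesis .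
qed

text \<open>The equation U W V = D is kept as U W = D V^-1 with explicit integral inverses. Its
  transpose W^T U^T = V^-T D makes W^T x diagonal in the coordinates U^-T x.\<close>

locale smith_data =
  fixes n :: nat and W U V Ui Vi :: "nat \<Rightarrow> nat \<Rightarrow> int" and dd :: "nat \<Rightarrow> int"
  assumes U_Ui: "i < n \<Longrightarrow> j < n \<Longrightarrow> (\<Sum>l<n. U i l * Ui l j) = (if i = j then 1 else 0)"
    and Ui_U: "i < n \<Longrightarrow> j < n \<Longrightarrow> (\<Sum>l<n. Ui i l * U l j) = (if i = j then 1 else 0)"
    and V_Vi: "i < n \<Longrightarrow> j < n \<Longrightarrow> (\<Sum>l<n. V i l * Vi l j) = (if i = j then 1 else 0)"
    and Vi_V: "i < n \<Longrightarrow> j < n \<Longrightarrow> (\<Sum>l<n. Vi i l * V l j) = (if i = j then 1 else 0)"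
    and U_W: "i < n \<Longrightarrow> k < n \<Longrightarrow> (\<Sum>l<n. U i l * W l k) = dd i * Vi i k"
begin

lemma inverse_sum:
  fixes A B :: "nat \<Rightarrow> nat \<Rightarrow> int"
  assumes "\<And>i j. i < n \<Longrightarrow> j < n \<Longrightarrow> (\<Sum>l<n. A i l * B l j) = (if i = j then 1 else 0)" "i < n"
  shows "(\<Sum>l<n. A i l * (\<Sum>j<n. B l j * x j)) = x i"
proof -
  have "(\<Sum>l<n. A i l * (\<Sum>j<n. B l j * x j)) = (\<Sum>l<n. \<Sum>j<n. A i l * B l j * x j)"
    by (simp add: sum_distrib_left mult_ac)
  also have "\<dots> = (\<Sum>j<n. \<Sum>l<n. A i l * B l j * x j)" by (rule sum.swap)
  also have "\<dots> = (\<Sum>j<n. (if i = j then 1 else 0) * x j)"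
    using assms by (simp add: sum_distrib_right[symmetric])
  also have "\<dots> = x i" using assms(2) by (simp add: if_distrib[of "\<lambda>t. t * _"] cong: if_cong)
  finally show ?thesis .
qed

lemma inverse_sum_left:
  fixes A B :: "nat \<Rightarrow> nat \<Rightarrow> int"
  assumes "\<And>i j. i < n \<Longrightarrow> j < n \<Longrightarrow> (\<Sum>l<n. A i l * B l j) = (if i = j then 1 else 0)" "j < n"
  shows "(\<Sum>l<n. B l j * (\<Sum>i<n. A i l * x i)) = x j"
proof -
  have "(\<Sum>l<n. B l j * (\<Sum>i<n. A i l * x i)) = (\<Sum>l<n. \<Sum>i<n. A i l * B l j * x i)"
    by (simp add: sum_distrib_left mult_ac)
  also have "\<dots> = (\<Sum>i<n. \<Sum>l<n. A i l * B l j * x i)" by (rule sum.swap)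
  also have "\<dots> = (\<Sum>i<n. (if i = j then 1 else 0) * x i)"
    using assms by (simp add: sum_distrib_right[symmetric])
  also have "\<dots> = x j" using assms(2) by (simp add: if_distrib[of "\<lambda>t. t * _"] cong: if_cong)
  finally show ?thesis .
qed

text \<open>\<open>hat x\<close> is \<open>U\<^sup>-\<^sup>T x\<close>.\<close>

definition hat :: "(nat \<Rightarrow> int) \<Rightarrow> nat \<Rightarrow> int" where
  "hat x i = (\<Sum>l<n. Ui l i * x l)"

lemma hat_inverse: "l < n \<Longrightarrow> x l = (\<Sum>i<n. U i l * hat x i)"
  unfolding hat_def by (rule inverse_sum_left[OF Ui_U, symmetric])

lemma W_transpose_sum:
  assumes "k < n"
  shows "(\<Sum>l<n. W l k * (\<Sum>i<n. U i l * y i)) = (\<Sum>i<n. Vi i k * (dd i * y i))"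
proof -
  have "(\<Sum>l<n. W l k * (\<Sum>i<n. U i l * y i)) = (\<Sum>l<n. \<Sum>i<n. U i l * W l k * y i)"
    by (simp add: sum_distrib_left mult_ac)
  also have "\<dots> = (\<Sum>i<n. (\<Sum>l<n. U i l * W l k) * y i)"
    by (subst sum.swap) (simp add: sum_distrib_right)
  also have "\<dots> = (\<Sum>i<n. Vi i k * (dd i * y i))" using assms U_W by (simp add: mult_ac)
  finally show ?thesis .
qed

lemma W_transpose_hat: "k < n \<Longrightarrow> (\<Sum>l<n. W l k * x l) = (\<Sum>i<n. Vi i k * (dd i * hat x i))"
  using W_transpose_sum[of k "hat x"] hat_inverse[of _ x] by simp

lemma hat_W_transpose: "j < n \<Longrightarrow> dd j * hat x j = (\<Sum>k<n. V k j * (\<Sum>l<n. W l k * x l))"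
  using inverse_sum_left[OF Vi_V, of j "\<lambda>i. dd i * hat x i"] by (simp add: W_transpose_hat)

lemma dvd_hat:
  assumes "\<And>k. k < n \<Longrightarrow> N dvd (\<Sum>l<n. W l k * x l)" "j < n"
  shows "N dvd dd j * hat x j"
  unfolding hat_W_transpose[OF assms(2)] using assms(1) by (intro dvd_sum) auto

lemma dvd_of_hat: "(\<And>j. j < n \<Longrightarrow> N dvd hat x j) \<Longrightarrow> i < n \<Longrightarrow> N dvd x i"
  by (subst hat_inverse) (auto intro!: dvd_sum)

text \<open>The counterpart of \<open>dvd_hat\<close> for combinations of columns: D V^-1 c = U W
  c.\<close>

lemma dvd_coeff:
  assumes "\<And>i. i < n \<Longrightarrow> N dvd (\<Sum>k<n. W i k * c k)" "l < n"
  shows "N dvd dd l * (\<Sum>k<n. Vi l k * c k)"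
proof -
  have "dd l * (\<Sum>k<n. Vi l k * c k) = (\<Sum>k<n. (\<Sum>i<n. U l i * W i k) * c k)"
    using U_W[OF assms(2)] by (simp add: sum_distrib_left mult_ac)
  also have "\<dots> = (\<Sum>k<n. \<Sum>i<n. U l i * W i k * c k)" by (simp add: sum_distrib_right)
  also have "\<dots> = (\<Sum>i<n. U l i * (\<Sum>k<n. W i k * c k))"
    by (subst sum.swap) (simp add: sum_distrib_left mult_ac)
  finally show ?thesis using assms(1) by (auto intro!: dvd_sum)
qed

end

section \<open>From the Smith normal form of the family to the abstract kernel data\<close>

lemma smith_dataI:
  assumes W: "W \<in> carrier_mat n n" and snf: "has_smith_normal_form n W dd"
  obtains U V Ui Vi where "smith_data n (\<lambda>i j. W $$ (i, j)) U V Ui Vi dd"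
    and "det W dvd (\<Prod>i<n. dd i)"
proof -
  obtain U V where U: "U \<in> carrier_mat n n" "invertible_mat U" and V: "V \<in> carrier_mat n n" "invertible_mat V"
    and UWV: "U * W * V = mat_diag n dd"
    using snf unfolding has_smith_normal_form_def by blast
  have inv: "\<exists>B\<in>carrier_mat n n. A * B = 1\<^sub>m n \<and> B * A = 1\<^sub>m n"
    if A: "A \<in> carrier_mat n n" "invertible_mat A" for A :: "int mat"
  proof -
    obtain B where B: "A * B = 1\<^sub>m n" "B * A = 1\<^sub>m (dim_row B)"
      using A unfolding invertible_mat_def inverts_mat_def by auto
    have "dim_col B = n" using arg_cong[OF B(1), of dim_col] by simp
    moreover have "dim_row B = n" using arg_cong[OF B(2), of dim_col] A by simp
    ultimately show ?thesis using B by (intro bexI[of _ B]) auto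
  qed
  obtain Ui where Ui: "Ui \<in> carrier_mat n n" "U * Ui = 1\<^sub>m n" "Ui * U = 1\<^sub>m n" using inv[OF U] by blast
  obtain Vi where Vi: "Vi \<in> carrier_mat n n" "V * Vi = 1\<^sub>m n" "Vi * V = 1\<^sub>m n" using inv[OF V] by blast
  have D: "mat_diag n dd \<in> carrier_mat n n" by (simp add: mat_diag_def)
  have UW: "U * W \<in> carrier_mat n n" using U W by simp
  have "U * W = U * W * (V * Vi)" using right_mult_one_mat[OF UW] Vi(2) by simp
  also have "\<dots> = mat_diag n dd * Vi" unfolding UWV[symmetric] using UW V(1) Vi(1)
    by (simp add: assoc_mult_mat[of _ n n _ n _ n])
  finally have UW_eq: "U * W = mat_diag n dd * Vi" .
  have ind: "(\<Sum>l<n. A $$ (i, l) * B $$ (l, j)) = (if i = j then 1 else 0)"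
    if "A \<in> carrier_mat n n" "B \<in> carrier_mat n n" "A * B = 1\<^sub>m n" "i < n" "j < n" for A B :: "int mat" and i j
    using index_mult_mat_sum[OF that(1,2,4,5)] that by simp
  have sd: "smith_data n (\<lambda>i j. W $$ (i, j)) (\<lambda>i j. U $$ (i, j)) (\<lambda>i j. V $$ (i, j))
      (\<lambda>i j. Ui $$ (i, j)) (\<lambda>i j. Vi $$ (i, j)) dd"
  proof
    fix i k assume ik: "i < n" "k < n"
    have "(\<Sum>l<n. U $$ (i, l) * W $$ (l, k)) = (U * W) $$ (i, k)"
      using index_mult_mat_sum[OF U(1) W ik] by simp
    also have "\<dots> = (\<Sum>l<n. mat_diag n dd $$ (i, l) * Vi $$ (l, k))"
      unfolding UW_eq by (rule index_mult_mat_sum[OF D Vi(1) ik])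
    also have "\<dots> = (\<Sum>l<n. if l = i then dd i * Vi $$ (i, k) else 0)"
      using ik by (intro sum.cong) (auto simp: mat_diag_def)
    also have "\<dots> = dd i * Vi $$ (i, k)" using ik by simp
    finally show "(\<Sum>l<n. U $$ (i, l) * W $$ (l, k)) = dd i * Vi $$ (i, k)" .
  qed (use U V Ui Vi ind in blast)+
  have prod: "(\<Prod>i<n. dd i) = det W * (det U * det V)"
    unfolding det_mat_diag[symmetric] UWV[symmetric]
    using det_mult[OF UW V(1)] det_mult[OF U(1) W] by simp
  show ?thesis by (rule that[OF sd dvdI[OF prod]])
qed

text \<open>For n = 1 the leading ones already fill the diagonal.\<close>

lemma family_diag_last: "n \<ge> 2 \<Longrightarrow> family_diag n p b (n - 1) = 2 * int p ^ 2 * int b"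
  by (auto simp: family_diag_def)

lemma prod_family_diag:
  assumes "n \<ge> 2"
  shows "(\<Prod>i<n. family_diag n p b i) = 2 ^ (n div 2) * (int p ^ 2 * int b)"
proof -
  let ?K = "(n + 1) div 2"
  obtain m where m: "n = Suc m" using assms by (cases n) auto
  have K: "?K \<le> m" using m assms by auto
  have "(\<Prod>i<n. family_diag n p b i) = (\<Prod>i<m. family_diag n p b i) * (2 * int p ^ 2 * int b)"
    using family_diag_last[OF assms, of p b] by (simp add: m)
  also have "(\<Prod>i<m. family_diag n p b i) = (\<Prod>i<?K. family_diag n p b i) * (\<Prod>i=?K..<m. family_diag n p b i)"
    using K by (simp add: lessThan_atLeast0 prod.atLeastLessThan_concat)
  also have "(\<Prod>i<?K. family_diag n p b i) = 1" by (simp add: family_diag_def)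
  also have "(\<Prod>i=?K..<m. family_diag n p b i) = (\<Prod>i=?K..<m. 2)"
    by (intro prod.cong) (auto simp: family_diag_def m)
  finally have "(\<Prod>i<n. family_diag n p b i) = 2 ^ (m - ?K) * (2 * int p ^ 2 * int b)" by simp
  moreover have "n div 2 = Suc (m - ?K)" using m K by presburger
  ultimately show ?thesis by simp
qed

lemma family_diag_cases:
  assumes "n \<ge> 2" "i < n"
  shows "i < (n + 1) div 2 \<and> family_diag n p b i = 1 \<or>
    \<not> i < (n + 1) div 2 \<and> i < n - 1 \<and> family_diag n p b i = 2 \<or>
    i = n - 1 \<and> \<not> i < (n + 1) div 2 \<and> family_diag n p b i = 2 * int p ^ 2 * int b"
  using assms by (auto simp: family_diag_def)

text \<open>The delicate assumption is \<open>kernel_2\<close>, proved by counting. The walk vectors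
  with index in \<open>I\<close> lie in the kernel modulo 2 because walk counts are even, and they
  are independent modulo 2, since a dependence would force too high a power of 2 into det W. Their
  subset sums thus represent 2^|I| distinct classes. A class of the kernel is determined by a subset
  of \<open>{K..<n}\<close>, a set as large as \<open>I\<close>, so the subset sums exhaust the
  kernel.\<close>

lemma family_graph_walks:
  assumes E: "simple_graph n E" and n: "n \<ge> 2" and p: "odd p" and b: "odd b"
    and snf: "has_smith_normal_form n (walk_mat n E) (family_diag n p b)"
  obtains r where "graph_walks n (adj_fun E) (2 * int p ^ 2 * int b) r"
proof -
  define a where "a = adj_fun E"
  interpret gm: graph_matrix n a unfolding a_def by (rule adj_fun_graph_matrix[OF E])
  define dd where "dd = family_diag n p b"
  define d where "d = 2 * int p ^ 2 * int b"
  define K where "K = (n + 1) div 2"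
  obtain U V Ui Vi where "smith_data n (\<lambda>i j. walk_mat n E $$ (i, j)) U V Ui Vi dd"
    and det: "det (walk_mat n E) dvd (\<Prod>i<n. dd i)"
    using smith_dataI[OF walk_mat_carrier snf] unfolding dd_def by metis
  then interpret sd: smith_data n "\<lambda>i j. walk_mat n E $$ (i, j)" U V Ui Vi dd by simp
  have pb: "odd (int p ^ 2 * int b)" using p b by simp
  have p0: "p > 0" "b > 0" using p b by (auto intro!: Nat.gr0I)
  have inner: "(\<Sum>l<n. walk_mat n E $$ (l, k) * x l) = dot n (walk_vec n a k) x" if "k < n" for k x
    using that by (simp add: dot_def walk_mat_index a_def)
  have comb: "(\<Sum>k<n. walk_mat n E $$ (i, k) * c k) = (\<Sum>k<n. c k * walk_vec n a k i)" if "i < n" for i c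
    using that by (simp add: walk_mat_index a_def mult.commute)
  have dvd_hat: "N dvd dd j * sd.hat x j" if "\<And>k. k < n \<Longrightarrow> N dvd dot n (walk_vec n a k) x" "j < n" for N x j
    using sd.dvd_hat[of N x j] that inner by simp
  have dd_cases: "j < K \<and> dd j = 1 \<or> \<not> j < K \<and> j < n - 1 \<and> dd j = 2 \<or> j = n - 1 \<and> \<not> j < K \<and> dd j = d"
    if "j < n" for j
    using family_diag_cases[OF n that, of p b] unfolding dd_def d_def K_def .
  have dd_last: "dd (n - 1) = d" using family_diag_last[OF n] by (simp add: dd_def d_def)
  have dd_dvd: "dd j dvd d" if "j < n" for j using dd_cases[OF that] by (auto simp: d_def)
  have dd_nz: "dd j \<noteq> 0" if "j < n" for j using dd_cases[OF that] p0 by (auto simp: d_def)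
  have four: "even t" if "4 dvd dd j * t" "j < n" for j t
  proof -
    have "4 dvd d * t" using that dd_dvd[OF that(2)] by (metis dvd_trans mult_dvd_mono dvd_refl)
    then obtain s where "d * t = 4 * s" by (elim dvdE)
    hence "(int p ^ 2 * int b) * t = 2 * s" by (simp add: d_def mult_ac)
    hence "even ((int p ^ 2 * int b) * t)" by simp
    thus ?thesis using pb by (simp only: even_mult_iff) blast
  qed
  define r where "r = U (n - 1)"

  have dep: "T = {}" if T: "T \<subseteq> {..<K}" and ev: "\<And>i. i < n \<Longrightarrow> even (\<Sum>k\<in>T. walk_vec n a k i)" for T
  proof (rule ccontr)
    assume ne: "T \<noteq> {}"
    have fin: "finite T" using T finite_subset by blast
    define m where "m = Max T"
    have m: "m \<in> T" using ne fin by (simp add: m_def)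
    hence mK: "m < K" using T by auto
    hence mn: "m < n" using n by (simp add: K_def)
    \<comment> \<open>As \<open>m < K\<close>, the exponent \<open>n - m\<close> exceeds
      \<open>n div 2\<close>, whereas det W divides a number with exactly \<open>n div 2\<close>
      factors 2.\<close>
    have "2 ^ (n - m) dvd det (mat n n (\<lambda>(i, k). walk_vec n a k i))"
      using fin by (intro walk_dependence_dvd_det[OF ne _ m mn ev]) (auto simp: m_def)
    also have "mat n n (\<lambda>(i, k). walk_vec n a k i) = walk_mat n E"
      using walk_mat_carrier[of n E] by (intro eq_matI) (auto simp: walk_mat_index a_def)
    also note det
    finally have "2 ^ (n - m) dvd 2 ^ (n div 2) * (int p ^ 2 * int b)" 
      using prod_family_diag[OF n] by (simp add: dd_def)
    moreover have "2 ^ Suc (n div 2) dvd (2 :: int) ^ (n - m)"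
      using mK mn n unfolding K_def by (intro le_imp_power_dvd) presburger
    ultimately have "2 ^ (n div 2) * 2 dvd 2 ^ (n div 2) * (int p ^ 2 * int b)"
      by (metis dvd_trans power_Suc2)
    thus False using pb by simp
  qed

  define I where "I = {n mod 2..<K}"
  have "graph_walks n a d r"
  proof
    show "d > 0" using p0 by (simp add: d_def)
  next
    fix N :: int and x :: "nat \<Rightarrow> int"
    assume N: "odd N" "N dvd d" and x: "\<And>k. k < n \<Longrightarrow> N dvd dot n (walk_vec n a k) x"
    \<comment> \<open>All invariant factors before the last are 1 or 2, hence units modulo the odd
      \<open>N\<close>; only the last coordinate of U^-T x survives.\<close>
    have hat: "N dvd sd.hat x j" if "j < n - 1" for j
    proof -
      have j: "j < n" using that by simp
      have "N dvd dd j * sd.hat x j" by (rule dvd_hat[OF x j])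
      moreover have "dd j = 1 \<or> dd j = 2" using dd_cases[OF j] that by auto
      ultimately have "N dvd 2 * sd.hat x j" by auto
      thus ?thesis using N(1) by (simp add: coprime_dvd_mult_right_iff)
    qed
    have "N dvd x l - sd.hat x (n - 1) * r l" if l: "l < n" for l
    proof -
      obtain m where m: "n = Suc m" using n by (cases n) auto
      have "x l = (\<Sum>i<m. U i l * sd.hat x i) + U (n - 1) l * sd.hat x (n - 1)"
        using sd.hat_inverse[OF l, of x] by (simp add: m)
      moreover have "N dvd (\<Sum>i<m. U i l * sd.hat x i)" using hat m by (intro dvd_sum) auto
      ultimately show ?thesis by (simp add: r_def)
    qed
    thus "\<exists>c. \<forall>i<n. N dvd x i - c * r i" by blast
  next
    fix k assume k: "k < n"
    have "dot n (walk_vec n a k) r = (\<Sum>l<n. U (n - 1) l * walk_mat n E $$ (l, k))"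
      unfolding inner[OF k, symmetric] by (simp add: r_def mult.commute)
    also have "\<dots> = d * Vi (n - 1) k" using sd.U_W[of "n - 1" k] k n dd_last by simp
    finally show "d dvd dot n (walk_vec n a k) r" by simp
  next
    fix q :: int assume q: "\<not> is_unit q"
    show "\<exists>i<n. \<not> q dvd r i"
    proof (rule ccontr)
      assume "\<not> ?thesis"
      hence "q dvd (\<Sum>l<n. U (n - 1) l * Ui l (n - 1))" by (auto simp: r_def intro!: dvd_sum)
      thus False using q sd.U_Ui[of "n - 1" "n - 1"] n by simp
    qed
  next
    \<comment> \<open>This is d W^-T applied to the last unit vector, with W^-T = U^T D^-1 V^T; it
      is integral because every invariant factor divides \<open>d\<close>.\<close>
    define x where "x l = (\<Sum>i<n. U i l * (d div dd i * V (n - 1) i))" for l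
    have "dot n (walk_vec n a k) x = (if k = n - 1 then d else 0)" if k: "k < n" for k
    proof -
      have "dot n (walk_vec n a k) x = (\<Sum>i<n. Vi i k * (dd i * (d div dd i * V (n - 1) i)))"
        unfolding inner[OF k, symmetric] x_def by (rule sd.W_transpose_sum[OF k])
      also have "\<dots> = (\<Sum>i<n. d * (V (n - 1) i * Vi i k))"
        using dd_dvd by (intro sum.cong) (auto simp: mult_ac elim!: dvdE)
      also have "\<dots> = d * (if n - 1 = k then 1 else 0)"
        unfolding sum_distrib_left[symmetric] using sd.V_Vi[of "n - 1" k] n k by simp
      finally show ?thesis by auto
    qed
    thus "\<exists>x. \<forall>k<n. dot n (walk_vec n a k) x = (if k = n - 1 then d else 0)" by blast
  next
    fix x i assume x: "\<And>k. k < n \<Longrightarrow> dot n (walk_vec n a k) x = 0" and i: "i < n"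
    \<comment> \<open>Divisibility by 0 encodes equality with 0.\<close>
    have "0 dvd sd.hat x j" if "j < n" for j using dvd_hat[of 0 x j] x that dd_nz[of j] by simp
    thus "x i = 0" using sd.dvd_of_hat[of 0 x i] i by simp
  next
    fix x i assume x: "\<And>k. k < n \<Longrightarrow> 4 dvd dot n (walk_vec n a k) x" and i: "i < n"
    have "even (sd.hat x j)" if "j < n" for j using four[OF dvd_hat[OF x that] that] by simp
    thus "even (x i)" using sd.dvd_of_hat[of 2 x i] i by simp
  next
    fix c :: "nat \<Rightarrow> int" and k assume c: "\<And>i. i < n \<Longrightarrow> 4 dvd (\<Sum>k<n. c k * walk_vec n a k i)" and k: "k < n"
    have "even (\<Sum>k<n. Vi l k * c k)" if "l < n" for l
      using four[OF _ that] sd.dvd_coeff[of 4 c l] comb c that by simp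
    hence "even (\<Sum>l<n. V k l * (\<Sum>j<n. Vi l j * c j))" by (intro dvd_sum) auto
    thus "even (c k)" using sd.inverse_sum[OF sd.V_Vi k, of c] by simp
  next
    fix u :: "nat \<Rightarrow> int" assume u: "\<And>k. k < n \<Longrightarrow> even (dot n (walk_vec n a k) u)"
    have hat_even: "even (sd.hat x j)" if x: "\<And>k. k < n \<Longrightarrow> even (dot n (walk_vec n a k) x)" and j: "j < K" for x j
      using dvd_hat[OF x, of j] dd_cases[of j] j n by (auto simp: K_def)
    define xs where "xs S i = (\<Sum>k\<in>S. walk_vec n a k i)" for S i
    have xs_kernel: "even (dot n (walk_vec n a k) (xs S))" if S: "S \<subseteq> I" for k S
      unfolding xs_def dot_sum_right
    proof (rule dvd_sum)
      fix l assume "l \<in> S"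
      hence l: "l \<in> I" using S by blast
      show "even (dot n (walk_vec n a k) (walk_vec n a l))"
      proof (cases "k + l = 0")
        case True
        hence "n mod 2 = 0" using l by (auto simp: I_def)
        thus ?thesis using True by (simp add: walk_vec_0 dot_def mod_eq_0_iff_dvd)
      qed (unfold gm.walk_vec_inner_wk[of k l], rule gm.even_walk_count, simp)
    qed
    \<comment> \<open>Coordinates below \<open>K\<close> belong to invariant factors 1 and are even
      for kernel vectors, so the odd coordinates from \<open>K\<close> on determine the class modulo
      2.\<close>
    define Phi where "Phi x = {j \<in> {K..<n}. odd (sd.hat x j)}" for x
    have Phi_eq: "even (x i - y i)"
      if x: "\<And>k. k < n \<Longrightarrow> even (dot n (walk_vec n a k) x)" and y: "\<And>k. k < n \<Longrightarrow> even (dot n (walk_vec n a k) y)"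
        and eq: "Phi x = Phi y" and i: "i < n" for x y i
    proof -
      have "even (sd.hat x j) = even (sd.hat y j)" if "j < n" for j
      proof (cases "j < K")
        case True
        thus ?thesis using hat_even[OF x True] hat_even[OF y True] by simp
      next
        case False
        have "j \<in> Phi x \<longleftrightarrow> j \<in> Phi y" using eq by simp
        thus ?thesis using False that by (simp add: Phi_def)
      qed
      moreover have "sd.hat (\<lambda>i. x i - y i) j = sd.hat x j - sd.hat y j" for j
        by (simp add: sd.hat_def right_diff_distrib sum_subtractf)
      ultimately have "even (sd.hat (\<lambda>i. x i - y i) j)" if "j < n" for j using that by simp
      thus ?thesis using sd.dvd_of_hat[of 2 "\<lambda>i. x i - y i" i] i by simp
    qed
    have finI: "finite I" by (simp add: I_def)
    have inj: "inj_on (\<lambda>S. Phi (xs S)) (Pow I)"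
    proof (rule inj_onI)
      fix S T assume S: "S \<in> Pow I" and T: "T \<in> Pow I" and eq: "Phi (xs S) = Phi (xs T)"
      have fin: "finite S" "finite T" using S T finI finite_subset by auto
      \<comment> \<open>Modulo 2 the difference of two subset sums is the sum over the symmetric
        difference.\<close>
      have "even (\<Sum>k\<in>(S - T) \<union> (T - S). walk_vec n a k i)" if i: "i < n" for i
      proof -
        have "(\<Sum>k\<in>(S - T) \<union> (T - S). walk_vec n a k i) = (\<Sum>k\<in>S - T. walk_vec n a k i) + (\<Sum>k\<in>T - S. walk_vec n a k i)"
          using fin by (intro sum.union_disjoint) auto
        moreover have "xs S i = (\<Sum>k\<in>S - T. walk_vec n a k i) + (\<Sum>k\<in>S \<inter> T. walk_vec n a k i)"
          unfolding xs_def using fin by (subst sum.union_disjoint[symmetric]) (auto intro!: sum.cong)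
        moreover have "xs T i = (\<Sum>k\<in>T - S. walk_vec n a k i) + (\<Sum>k\<in>S \<inter> T. walk_vec n a k i)"
          unfolding xs_def using fin by (subst sum.union_disjoint[symmetric]) (auto intro!: sum.cong)
        moreover have "even (xs S i - xs T i)"
          using S T xs_kernel by (intro Phi_eq eq i) auto
        ultimately show ?thesis by simp
      qed
      moreover have "(S - T) \<union> (T - S) \<subseteq> {..<K}" using S T by (auto simp: I_def)
      ultimately have "(S - T) \<union> (T - S) = {}" using dep by blast
      thus "S = T" by blast
    qed
    have "(\<lambda>S. Phi (xs S)) ` Pow I \<subseteq> Pow {K..<n}" by (auto simp: Phi_def)
    moreover have "card ((\<lambda>S. Phi (xs S)) ` Pow I) = card (Pow {K..<n})"
    proof -
      have "(n + 1) div 2 - n mod 2 = n - (n + 1) div 2"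
        by (cases "even n") (auto elim!: evenE oddE)
      hence "card I = card {K..<n}" by (simp add: I_def K_def)
      thus ?thesis unfolding card_image[OF inj] using finI by (simp add: card_Pow)
    qed
    ultimately have "(\<lambda>S. Phi (xs S)) ` Pow I = Pow {K..<n}"
      by (intro card_subset_eq) auto
    moreover have "Phi u \<in> Pow {K..<n}" by (auto simp: Phi_def)
    ultimately have "Phi u \<in> (\<lambda>S. Phi (xs S)) ` Pow I" by simp
    then obtain S where "Phi u = Phi (xs S)" "S \<in> Pow I" by (rule imageE)
    hence S: "S \<subseteq> I" "Phi u = Phi (xs S)" by simp_all
    define f where "f k = (if k \<in> S then 1 else 0 :: int)" for k
    have "even (u i - (\<Sum>k\<in>I. f k * walk_vec n a k i))" if i: "i < n" for i
    proof -
      have "(\<Sum>k\<in>I. f k * walk_vec n a k i) = xs S i"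
        unfolding xs_def using S(1) finI by (intro sum.mono_neutral_cong_right) (auto simp: f_def)
      moreover have "even (u i - xs S i)"
        by (rule Phi_eq[of u "xs S"]) (use u xs_kernel[OF S(1)] S(2) i in simp_all)
      ultimately show ?thesis by simp
    qed
    thus "\<exists>f. \<forall>i<n. even (u i - (\<Sum>k\<in>{n mod 2..<(n + 1) div 2}. f k * walk_vec n a k i))"
      unfolding I_def K_def by blast
  qed
  thus ?thesis using that unfolding a_def d_def by blast
qed

section \<open>Cospectral graphs and their walk counts\<close>

lemma char_poly_eq_of_spectrum_eq:
  assumes A: "A \<in> carrier_mat n n" and B: "B \<in> carrier_mat m m"
    and eq: "mat_spectrum A = mat_spectrum B"
  shows "n = m" "char_poly A = char_poly B"
proof -
  let ?h = "of_int :: int \<Rightarrow> complex"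
  have A': "map_mat ?h A \<in> carrier_mat n n" and B': "map_mat ?h B \<in> carrier_mat m m" using A B by auto
  let ?f = "char_poly (map_mat ?h A)" and ?g = "char_poly (map_mat ?h B)"
  have f: "degree ?f = n" "coeff ?f n = 1" using degree_monic_char_poly[OF A'] by auto
  have g: "degree ?g = m" "coeff ?g m = 1" using degree_monic_char_poly[OF B'] by auto
  have pr: "proots ?f = proots ?g" using eq by (simp add: mat_spectrum_def)
  show "n = m" using arg_cong[OF pr, of size] f g by (simp add: size_proots_complex)
  have "?f = ?g"
    using complex_poly_decompose_multiset[of ?f] complex_poly_decompose_multiset[of ?g] f g pr by simp
  hence "map_poly ?h (char_poly A) = map_poly ?h (char_poly B)"
    using of_int_hom.char_poly_hom[OF A, where ?'a = complex] of_int_hom.char_poly_hom[OF B, where ?'a = complex]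
    by simp
  thus "char_poly A = char_poly B" by (simp add: poly_eq_iff coeff_map_poly)
qed

text \<open>The matrix determinant lemma. Factors of determinant 1 relate the block matrix with rows
  (I, v) and (-u^T, 1) to block triangular matrices, in \<open>X\<close> with diagonal blocks I + v
  u^T and 1, in \<open>Y\<close> with diagonal blocks I and 1 + u^T v.\<close>

lemma det_one_plus_rank_one:
  fixes v u :: "nat \<Rightarrow> 'a :: idom"
  shows "det (mat n n (\<lambda>(i, j). (if i = j then 1 else 0) + v i * u j)) = 1 + (\<Sum>i<n. v i * u i)"
proof -
  define V where "V = mat n 1 (\<lambda>(i, j). v i)"
  define R where "R = mat 1 n (\<lambda>(i, j). u j)"
  define S where "S = mat n n (\<lambda>(i, j). (if i = j then 1 else 0) + v i * u j)"
  define M where "M = mat 1 1 (\<lambda>(i, j). 1 + (\<Sum>i<n. v i * u i))"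
  have V: "V \<in> carrier_mat n 1" and R: "R \<in> carrier_mat 1 n" and S: "S \<in> carrier_mat n n"
    and M: "M \<in> carrier_mat 1 1" by (auto simp: V_def R_def S_def M_def)
  have e1: "S + V * (- R) = 1\<^sub>m n"
    by (rule eq_matI) (auto simp: S_def V_def R_def scalar_prod_def)
  have e2: "R * 1\<^sub>m n + 1\<^sub>m 1 * (- R) = 0\<^sub>m 1 n"
    using R by (intro eq_matI) auto
  have e3: "R * V + 1\<^sub>m 1 * 1\<^sub>m 1 = M"
    by (rule eq_matI) (auto simp: M_def V_def R_def scalar_prod_def lessThan_atLeast0 mult.commute)
  have "four_block_mat S V (0\<^sub>m 1 n) (1\<^sub>m 1) * four_block_mat (1\<^sub>m n) (0\<^sub>m n 1) (- R) (1\<^sub>m 1)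
      = four_block_mat (S * 1\<^sub>m n + V * (- R)) (S * 0\<^sub>m n 1 + V * 1\<^sub>m 1)
          (0\<^sub>m 1 n * 1\<^sub>m n + 1\<^sub>m 1 * (- R)) (0\<^sub>m 1 n * 0\<^sub>m n 1 + 1\<^sub>m 1 * 1\<^sub>m 1)"
    using S V R by (intro mult_four_block_mat) auto
  also have "\<dots> = four_block_mat (1\<^sub>m n) V (- R) (1\<^sub>m 1)"
    using S V R e1 by (intro cong_four_block_mat) auto
  finally have X: "four_block_mat S V (0\<^sub>m 1 n) (1\<^sub>m 1) * four_block_mat (1\<^sub>m n) (0\<^sub>m n 1) (- R) (1\<^sub>m 1)
      = four_block_mat (1\<^sub>m n) V (- R) (1\<^sub>m 1)" .
  have "four_block_mat (1\<^sub>m n) (0\<^sub>m n 1) R (1\<^sub>m 1) * four_block_mat (1\<^sub>m n) V (- R) (1\<^sub>m 1)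
      = four_block_mat (1\<^sub>m n * 1\<^sub>m n + 0\<^sub>m n 1 * (- R)) (1\<^sub>m n * V + 0\<^sub>m n 1 * 1\<^sub>m 1)
          (R * 1\<^sub>m n + 1\<^sub>m 1 * (- R)) (R * V + 1\<^sub>m 1 * 1\<^sub>m 1)"
    using V R by (intro mult_four_block_mat) auto
  also have "\<dots> = four_block_mat (1\<^sub>m n) V (0\<^sub>m 1 n) M"
    using V R e2 e3 by (intro cong_four_block_mat) auto
  finally have Y: "four_block_mat (1\<^sub>m n) (0\<^sub>m n 1) R (1\<^sub>m 1) * four_block_mat (1\<^sub>m n) V (- R) (1\<^sub>m 1)
      = four_block_mat (1\<^sub>m n) V (0\<^sub>m 1 n) M" .
  have d1: "det (four_block_mat S V (0\<^sub>m 1 n) (1\<^sub>m 1)) = det S"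
    using S V by (subst det_four_block_mat_lower_left_zero[of _ n _ 1]) auto
  have d2: "det (four_block_mat (1\<^sub>m n) (0\<^sub>m n 1) Z (1\<^sub>m 1)) = 1" if "Z \<in> carrier_mat 1 n" for Z :: "'a mat"
    using that by (subst det_four_block_mat_upper_right_zero[of _ n _ 1]) auto
  have d3: "det (four_block_mat (1\<^sub>m n) V (0\<^sub>m 1 n) M) = 1 + (\<Sum>i<n. v i * u i)"
    using V M by (subst det_four_block_mat_lower_left_zero[of _ n _ 1]) (auto simp: M_def det_single)
  have "det (four_block_mat (1\<^sub>m n) V (- R) (1\<^sub>m 1)) = det S"
    unfolding X[symmetric] using S V R d1 d2[of "- R"]
    by (subst det_mult[of _ "n + 1"]) auto
  moreover have "det (four_block_mat (1\<^sub>m n) V (0\<^sub>m 1 n) M) = det (four_block_mat (1\<^sub>m n) V (- R) (1\<^sub>m 1))"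
    unfolding Y[symmetric] using V R d2[OF R]
    by (subst det_mult[of _ "n + 1"]) auto
  ultimately show ?thesis using d3 by (simp add: S_def)
qed

lemma det_scaled_char_poly:
  fixes x y :: "'a :: field"
  assumes "y \<noteq> 0" and A: "A \<in> carrier_mat n n"
  shows "det (mat n n (\<lambda>(i, j). (if i = j then x else 0) - y * A $$ (i, j))) = y ^ n * poly (char_poly A) (x / y)"
proof -
  have "mat n n (\<lambda>(i, j). (if i = j then x else 0) - y * A $$ (i, j)) = y \<cdot>\<^sub>m (- char_matrix A (x / y))"
    using assms by (intro eq_matI) (auto simp: char_matrix_def algebra_simps)
  moreover have "dim_col (- char_matrix A (x / y)) = n"
    using char_matrix_closed[OF A, of "x / y"] by simp
  ultimately show ?thesis by (simp add: char_poly_matrix[OF A])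
qed

text \<open>The Neumann series of (I - X A)^-1 x. Laurent series form a field, which is needed to
  evaluate characteristic polynomials at 1/X and -(1+X)/X.\<close>

definition walk_series :: "nat \<Rightarrow> (nat \<Rightarrow> nat \<Rightarrow> int) \<Rightarrow> (nat \<Rightarrow> int) \<Rightarrow> nat \<Rightarrow> rat fls" where
  "walk_series n a x i = fps_to_fls (Abs_fps (\<lambda>k. of_int ((mat_apply n a ^^ k) x i)))"

lemma fps_to_fls_sum: "fps_to_fls (\<Sum>x\<in>S. f x) = (\<Sum>x\<in>S. fps_to_fls (f x))"
  by (induction S rule: infinite_finite_induct) auto

lemma walk_series_resolvent:
  "walk_series n a x i - fls_X * (\<Sum>j<n. of_int (a i j) * walk_series n a x j) = of_int (x i)"
proof -
  let ?G = "\<lambda>i. Abs_fps (\<lambda>k. of_int ((mat_apply n a ^^ k) x i)) :: rat fps"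
  have "?G i - fps_X * (\<Sum>j<n. of_int (a i j) * ?G j) = of_int (x i)"
  proof (rule fps_ext)
    fix k
    show "fps_nth (?G i - fps_X * (\<Sum>j<n. of_int (a i j) * ?G j)) k = fps_nth (of_int (x i)) k"
      by (cases k) (simp_all add: mat_apply_def fps_sum_nth fps_of_int[symmetric] del: fps_of_int)
  qed
  from arg_cong[OF this, of fps_to_fls] show ?thesis
    by (simp add: walk_series_def fls_times_fps_to_fls fps_to_fls_sum)
qed

text \<open>The two characteristic polynomials determine det(I - X A) and det(I - X A + X J), with J
  the all-one matrix. By the rank-one formula their quotient is 1 + X e^T (I - X A)^-1 e, which
  contains the generating function of the walk counts.\<close>

lemma walk_counts_eq:
  fixes a a' :: "nat \<Rightarrow> nat \<Rightarrow> int"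
  assumes eq1: "char_poly (mat n n (\<lambda>(i, j). a i j)) = char_poly (mat n n (\<lambda>(i, j). a' i j))"
    and eq2: "char_poly (mat n n (\<lambda>(i, j). (if i = j then 0 else 1) - a i j)) =
      char_poly (mat n n (\<lambda>(i, j). (if i = j then 0 else 1) - a' i j))"
  shows "(\<Sum>i<n. walk_vec n a k i) = (\<Sum>i<n. walk_vec n a' k i)"
proof -
  let ?h = "of_int :: int \<Rightarrow> rat fls"
  let ?X = "fls_X :: rat fls"
  define M where "M a = mat n n (\<lambda>(i, j). (if i = j then 1 else 0) - ?X * ?h (a i j))" for a
  define MJ where "MJ a = mat n n (\<lambda>(i, j). (if i = j then 1 else 0) - ?X * ?h (a i j) + ?X)" for a
  have M[simp]: "M a \<in> carrier_mat n n" for a by (simp add: M_def)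
  have detM: "det (M a) = ?X ^ n * poly (map_poly ?h (char_poly (mat n n (\<lambda>(i, j). a i j)))) (1 / ?X)" for a
  proof -
    let ?A = "mat n n (\<lambda>(i, j). a i j)"
    have "M a = mat n n (\<lambda>(i, j). (if i = j then 1 else 0) - ?X * map_mat ?h ?A $$ (i, j))"
      by (intro eq_matI) (auto simp: M_def)
    thus ?thesis using det_scaled_char_poly[of ?X "map_mat ?h ?A" n 1] of_int_hom.char_poly_hom[of ?A n, where ?'a = "rat fls"] by simp
  qed
  have detMJ: "det (MJ a) = (- ?X) ^ n *
      poly (map_poly ?h (char_poly (mat n n (\<lambda>(i, j). (if i = j then 0 else 1) - a i j)))) ((1 + ?X) / (- ?X))" for a
  proof -
    let ?A = "mat n n (\<lambda>(i, j). (if i = j then 0 else 1) - a i j)"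
    \<comment> \<open>I - X A + X J = (1 + X) I + X (J - I - A), where J - I - A belongs to the
      complement.\<close>
    have "MJ a = mat n n (\<lambda>(i, j). (if i = j then 1 + ?X else 0) - (- ?X) * map_mat ?h ?A $$ (i, j))"
      by (intro eq_matI) (auto simp: MJ_def algebra_simps)
    thus ?thesis using det_scaled_char_poly[of "- ?X" "map_mat ?h ?A" n "1 + ?X"] of_int_hom.char_poly_hom[of ?A n, where ?'a = "rat fls"] by simp
  qed
  have res: "(\<Sum>j<n. M a $$ (i, j) * walk_series n a x j) = ?h (x i)" if i: "i < n" for a x i
  proof -
    have "(\<Sum>j<n. M a $$ (i, j) * walk_series n a x j) =
      (\<Sum>j<n. (if i = j then walk_series n a x j else 0) - ?X * (?h (a i j) * walk_series n a x j))"
      using i by (intro sum.cong) (auto simp: M_def algebra_simps)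
    also have "\<dots> = ?h (x i)"
      using i walk_series_resolvent[of n a x i] by (simp add: sum_subtractf sum_distrib_left)
    finally show ?thesis .
  qed
  have nz: "det (M a) \<noteq> 0" for a
  proof -
    \<comment> \<open>The Neumann series of the unit vectors form an explicit right inverse of I - X
      A.\<close>
    define N where "N = mat n n (\<lambda>(i, j). walk_series n a (\<lambda>i. if i = j then 1 else 0) i)"
    have "M a * N = 1\<^sub>m n"
    proof (rule eq_matI)
      fix i j assume "i < dim_row (1\<^sub>m n)" "j < dim_col (1\<^sub>m n)"
      hence ij: "i < n" "j < n" by auto
      have "(M a * N) $$ (i, j) = (\<Sum>l<n. M a $$ (i, l) * N $$ (l, j))"
        using ij by (intro index_mult_mat_sum) (auto simp: N_def)
      thus "(M a * N) $$ (i, j) = 1\<^sub>m n $$ (i, j)"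
        using res[of i a "\<lambda>i. if i = j then 1 else 0"] ij by (simp add: N_def)
    qed (simp_all add: N_def M_def)
    hence "det (M a) * det N = 1" using det_mult[of "M a" n N] by (simp add: N_def)
    thus ?thesis by auto
  qed
  define s where "s a = (\<Sum>i<n. walk_series n a (\<lambda>_. 1) i)" for a
  have fac: "det (MJ a) = det (M a) * (1 + ?X * s a)" for a
  proof -
    define R where "R = mat n n (\<lambda>(i, j). (if i = j then 1 else 0) + ?X * walk_series n a (\<lambda>_. 1) i * 1)"
    have "MJ a = M a * R"
    proof (rule eq_matI)
      fix i j assume "i < dim_row (M a * R)" "j < dim_col (M a * R)"
      hence ij: "i < n" "j < n" by (auto simp: M_def R_def)
      have "(M a * R) $$ (i, j) = (\<Sum>l<n. M a $$ (i, l) * R $$ (l, j))"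
        using ij by (intro index_mult_mat_sum) (auto simp: R_def)
      also have "\<dots> = (\<Sum>l<n. (if l = j then M a $$ (i, l) else 0) + ?X * (M a $$ (i, l) * walk_series n a (\<lambda>_. 1) l))"
        using ij by (intro sum.cong) (auto simp: R_def algebra_simps)
      also have "\<dots> = M a $$ (i, j) + ?X"
        using ij res[of i a "\<lambda>_. 1"] by (simp add: sum.distrib sum_distrib_left[symmetric])
      finally show "MJ a $$ (i, j) = (M a * R) $$ (i, j)" using ij by (simp add: MJ_def M_def)
    qed (simp_all add: MJ_def M_def R_def)
    moreover have "det R = 1 + ?X * s a"
      unfolding R_def det_one_plus_rank_one by (simp add: s_def sum_distrib_left)
    ultimately show ?thesis using det_mult[of "M a" n R] by (simp add: R_def)
  qed
  have "det (M a) = det (M a')" unfolding detM eq1 ..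
  moreover have "det (MJ a) = det (MJ a')" unfolding detMJ eq2 ..
  ultimately have "s a = s a'" using nz[of a'] fac[of a] fac[of a'] by simp
  hence "fps_to_fls (\<Sum>i<n. Abs_fps (\<lambda>k. of_int ((mat_apply n a ^^ k) (\<lambda>_. 1) i)) :: rat fps)
      = fps_to_fls (\<Sum>i<n. Abs_fps (\<lambda>k. of_int ((mat_apply n a' ^^ k) (\<lambda>_. 1) i)))"
    unfolding s_def walk_series_def fps_to_fls_sum .
  hence "(\<Sum>i<n. Abs_fps (\<lambda>k. of_int ((mat_apply n a ^^ k) (\<lambda>_. 1) i)) :: rat fps)
      = (\<Sum>i<n. Abs_fps (\<lambda>k. of_int ((mat_apply n a' ^^ k) (\<lambda>_. 1) i)))" by simp
  from arg_cong[OF this, of "\<lambda>F. fps_nth F k"] have "(of_int (\<Sum>i<n. walk_vec n a k i) :: rat) = of_int (\<Sum>i<n. walk_vec n a' k i)"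
    by (simp add: fps_sum_nth walk_vec_def)
  thus ?thesis by (simp only: of_int_eq_iff)
qed

section \<open>Walk matrices of generalized cospectral graphs\<close>

lemma complement_adj_fun:
  assumes "simple_graph n E" "i < n" "j < n"
  shows "adj_fun (complement_graph n E) i j = (if i = j then 0 else 1) - adj_fun E i j"
proof (cases "i = j")
  case True
  have "{i} \<notin> complete_edges n" by (simp add: complete_edges_def)
  hence "{i} \<notin> E" "{i} \<notin> complement_graph n E"
    using assms by (auto simp: simple_graph_def complement_graph_def)
  thus ?thesis using True by (simp add: adj_fun_def)
next
  case False
  hence "{i, j} \<in> complete_edges n" using assms by (simp add: complete_edges_def)
  thus ?thesis using False by (simp add: adj_fun_def complement_graph_def)
qed

lemma complement_adj_mat:
  assumes "simple_graph n E"
  shows "Defs.adj_mat n (complement_graph n E) = mat n n (\<lambda>(i, j). (if i = j then 0 else 1) - adj_fun E i j)"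
  unfolding adj_mat_eq using complement_adj_fun[OF assms] by (intro eq_matI) auto

lemma adj_mat_carrier [simp]: "Defs.adj_mat n E \<in> carrier_mat n n"
  by (simp add: Defs.adj_mat_def)

lemma adj_mat_transpose: "transpose_mat (Defs.adj_mat n E) = Defs.adj_mat n E"
  by (intro eq_matI) (auto simp: Defs.adj_mat_def insert_commute)

definition companion :: "nat \<Rightarrow> int poly \<Rightarrow> int mat" where
  "companion n f = mat n n (\<lambda>(l, k). if k = n - 1 then - coeff f l else if l = k + 1 then 1 else 0)"

text \<open>The companion matrix depends only on the characteristic polynomial, so cospectral graphs
  share it; this is why W(G) W(H)^-1 intertwines their adjacency matrices.\<close>

lemma adj_mat_walk_mat:
  "Defs.adj_mat n E * walk_mat n E = walk_mat n E * companion n (char_poly (Defs.adj_mat n E))"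
proof (rule eq_matI)
  let ?f = "char_poly (Defs.adj_mat n E)" and ?a = "adj_fun E"
  fix i k assume "i < dim_row (walk_mat n E * companion n ?f)" "k < dim_col (walk_mat n E * companion n ?f)"
  hence ik: "i < n" "k < n" using walk_mat_carrier[of n E] by (auto simp: companion_def)
  have "(Defs.adj_mat n E * walk_mat n E) $$ (i, k) = (\<Sum>l<n. Defs.adj_mat n E $$ (i, l) * walk_mat n E $$ (l, k))"
    using ik by (intro index_mult_mat_sum) (auto simp: walk_mat_carrier)
  also have "\<dots> = walk_vec n ?a (Suc k) i"
    using ik by (simp add: adj_mat_eq walk_mat_index walk_vec_Suc mat_apply_def)
  finally have 1: "(Defs.adj_mat n E * walk_mat n E) $$ (i, k) = walk_vec n ?a (Suc k) i" .
  have "(walk_mat n E * companion n ?f) $$ (i, k) = (\<Sum>l<n. walk_mat n E $$ (i, l) * companion n ?f $$ (l, k))"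
    using ik by (intro index_mult_mat_sum) (auto simp: companion_def walk_mat_carrier)
  also have "\<dots> = (\<Sum>l<n. walk_vec n ?a l i * (if k = n - 1 then - coeff ?f l else if l = k + 1 then 1 else 0))"
    using ik by (simp add: walk_mat_index companion_def)
  also have "\<dots> = walk_vec n ?a (Suc k) i"
  proof (cases "k = n - 1")
    case True
    have "coeff ?f n = 1" using degree_monic_char_poly[of "Defs.adj_mat n E" n] by simp
    hence "(\<Sum>l<n. coeff ?f l * walk_vec n ?a l i) + walk_vec n ?a n i = 0"
      using cayley_hamilton_walk[OF ik(1), of ?a] by (simp add: adj_mat_eq lessThan_Suc_atMost[symmetric])
    moreover have "Suc k = n" using True ik by simp
    ultimately show ?thesis using True by (simp add: sum_negf mult.commute eq_neg_iff_add_eq_0 add.commute)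
  next
    case False
    hence "k + 1 < n" using ik by simp
    thus ?thesis using False by (simp add: if_distrib[of "\<lambda>t. _ * t"] cong: if_cong)
  qed
  finally show "(Defs.adj_mat n E * walk_mat n E) $$ (i, k) = (walk_mat n E * companion n ?f) $$ (i, k)"
    using 1 by simp
qed (use walk_mat_carrier[of n E] carrier_matD[OF adj_mat_carrier[of n E]] in \<open>auto simp: companion_def\<close>)

lemma walk_mat_gram:
  assumes "simple_graph n E"
  shows "transpose_mat (walk_mat n E) * walk_mat n E = mat n n (\<lambda>(i, j). \<Sum>l<n. walk_vec n (adj_fun E) (i + j) l)"
proof (rule eq_matI)
  interpret graph_matrix n "adj_fun E" by (rule adj_fun_graph_matrix[OF assms])
  let ?W = "walk_mat n E"
  have W: "?W \<in> carrier_mat n n" by (rule walk_mat_carrier)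
  fix i j assume "i < dim_row (mat n n (\<lambda>(i, j). \<Sum>l<n. walk_vec n (adj_fun E) (i + j) l))"
    "j < dim_col (mat n n (\<lambda>(i, j). \<Sum>l<n. walk_vec n (adj_fun E) (i + j) l))"
  hence ij: "i < n" "j < n" by auto
  have "(transpose_mat ?W * ?W) $$ (i, j) = (\<Sum>l<n. transpose_mat ?W $$ (i, l) * ?W $$ (l, j))"
    using ij W by (intro index_mult_mat_sum) auto
  also have "\<dots> = dot n (w i) (w j)"
    unfolding dot_def using ij carrier_matD[OF W] by (intro sum.cong) (auto simp: walk_mat_index)
  also have "\<dots> = (\<Sum>l<n. w (i + j) l)" using walk_vec_inner_wk[of i j] by (simp add: dot_def walk_vec_0)
  finally show "(transpose_mat ?W * ?W) $$ (i, j) = mat n n (\<lambda>(i, j). \<Sum>l<n. walk_vec n (adj_fun E) (i + j) l) $$ (i, j)"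
    using ij by simp
qed (use walk_mat_carrier[of n E] in auto)

abbreviation rmat :: "int mat \<Rightarrow> rat mat" where "rmat \<equiv> map_mat of_int"

text \<open>Only W(G) is assumed nonsingular, so the matrix D W(H) W(G)^-1 is formed with the
  adjugate of W(G), where D = det W(G). Equality of the Gram matrices makes it D times an orthogonal
  matrix, whose transpose is \<open>Q\<close>; integrality of the adjugate shows that D clears the
  denominators of \<open>Q\<close>.\<close>

lemma cospectral_imp_similar:
  assumes E: "simple_graph n E" and F: "simple_graph m F" and cosp: "generalized_cospectral m F n E"
    and det: "det (walk_mat n E) \<noteq> 0"
  obtains Q where "m = n" "regular_orthogonal n Q"
    "rmat (Defs.adj_mat n E) * Q = Q * rmat (Defs.adj_mat n F)"
    "\<And>i j. i < n \<Longrightarrow> j < n \<Longrightarrow> of_int (det (walk_mat n E)) * Q $$ (i, j) \<in> \<int>"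
proof -
  have mn: "m = n" and cp: "char_poly (Defs.adj_mat m F) = char_poly (Defs.adj_mat n E)"
    using char_poly_eq_of_spectrum_eq[of "Defs.adj_mat m F" m "Defs.adj_mat n E" n] cosp
    by (auto simp: generalized_cospectral_def)
  have cpc: "char_poly (Defs.adj_mat n (complement_graph n F)) = char_poly (Defs.adj_mat n (complement_graph n E))"
    using char_poly_eq_of_spectrum_eq(2)[of "Defs.adj_mat n (complement_graph n F)" n "Defs.adj_mat n (complement_graph n E)" n]
      cosp mn by (auto simp: generalized_cospectral_def)
  have F': "simple_graph n F" and cp': "char_poly (Defs.adj_mat n F) = char_poly (Defs.adj_mat n E)"
    using F cp mn by simp_all
  have counts: "(\<Sum>i<n. walk_vec n (adj_fun F) k i) = (\<Sum>i<n. walk_vec n (adj_fun E) k i)" for k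
    by (rule walk_counts_eq[OF cp'[unfolded adj_mat_eq] cpc[unfolded complement_adj_mat[OF E] complement_adj_mat[OF F']]])
  define WE WF where "WE = walk_mat n E" and "WF = walk_mat n F"
  have WE: "WE \<in> carrier_mat n n" and WF: "WF \<in> carrier_mat n n"
    by (simp_all add: WE_def WF_def walk_mat_carrier)
  have gram: "transpose_mat WF * WF = transpose_mat WE * WE"
    unfolding WE_def WF_def walk_mat_gram[OF E] walk_mat_gram[OF F'] counts ..
  define D where "D = det WE"
  have D0: "D \<noteq> 0" using det by (simp add: D_def WE_def)
  define Adj where "Adj = Determinant.adj_mat WE"
  have Adj: "Adj \<in> carrier_mat n n" "WE * Adj = D \<cdot>\<^sub>m 1\<^sub>m n" "Adj * WE = D \<cdot>\<^sub>m 1\<^sub>m n"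
    unfolding Adj_def D_def using adj_mat[OF WE] by auto
  define C where "C = companion n (char_poly (Defs.adj_mat n E))"
  have C: "C \<in> carrier_mat n n" by (simp add: C_def companion_def)
  define A B where "A = Defs.adj_mat n E" and "B = Defs.adj_mat n F"
  have A: "A \<in> carrier_mat n n" and B: "B \<in> carrier_mat n n" by (simp_all add: A_def B_def)
  have AW: "A * WE = WE * C" unfolding A_def WE_def C_def by (rule adj_mat_walk_mat)
  have BW: "B * WF = WF * C" unfolding B_def WF_def C_def cp'[symmetric] by (rule adj_mat_walk_mat)
  \<comment> \<open>\<open>S\<close> is \<open>D\<close> times the inverse of \<open>Q\<close>.\<close>
  define S where "S = WF * Adj"
  have S: "S \<in> carrier_mat n n" using WF Adj by (simp add: S_def)
  note assoc = assoc_mult_mat[of _ n n _ n _ n]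
  have SW: "S * WE = D \<cdot>\<^sub>m WF"
    using WF Adj WE by (simp add: S_def assoc mult_smult_distrib[of _ n n _ n])
  have SS: "transpose_mat S * S = D\<^sup>2 \<cdot>\<^sub>m 1\<^sub>m n"
  proof -
    have "transpose_mat S * S = transpose_mat Adj * ((transpose_mat WF * WF) * Adj)"
      using WF Adj by (simp add: S_def transpose_mult[of _ n n _ n] assoc)
    also have "\<dots> = transpose_mat (WE * Adj) * (WE * Adj)"
      unfolding gram using WE Adj(1) by (simp add: transpose_mult[of _ n n _ n] assoc)
    also have "\<dots> = D\<^sup>2 \<cdot>\<^sub>m 1\<^sub>m n" unfolding Adj(2)
      by (intro eq_matI) (auto simp: scalar_prod_def power2_eq_square if_distrib[of "\<lambda>t. _ * t"] cong: if_cong)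
    finally show ?thesis .
  qed
  have "S * A * WE = B * S * WE"
  proof -
    have "S * A * WE = S * WE * C" using S A WE C AW by (simp add: assoc)
    also have "\<dots> = D \<cdot>\<^sub>m (WF * C)" unfolding SW using WF C by (simp add: mult_smult_assoc_mat[of _ n n _ n])
    also have "\<dots> = B * (D \<cdot>\<^sub>m WF)" unfolding BW[symmetric] using B WF by (simp add: mult_smult_distrib[of _ n n _ n])
    also have "\<dots> = B * S * WE" unfolding SW[symmetric] using B S WE by (simp add: assoc)
    finally show ?thesis .
  qed
  hence "S * A * WE * Adj = B * S * WE * Adj" by simp
  moreover have cancel: "X * WE * Adj = D \<cdot>\<^sub>m X" if "X \<in> carrier_mat n n" for X
    using that WE Adj by (simp add: assoc mult_smult_distrib[of _ n n _ n])
  ultimately have "D \<cdot>\<^sub>m (S * A) = D \<cdot>\<^sub>m (B * S)" using S A B by simp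
  hence SA: "S * A = B * S"
  proof (intro eq_matI)
    fix i j assume eq: "D \<cdot>\<^sub>m (S * A) = D \<cdot>\<^sub>m (B * S)" and ij: "i < dim_row (B * S)" "j < dim_col (B * S)"
    from arg_cong[OF eq, of "\<lambda>M. M $$ (i, j)"] show "(S * A) $$ (i, j) = (B * S) $$ (i, j)"
      using ij S A B D0 by simp
  qed (use S A B in auto)
  define Q where "Q = (1 / of_int D) \<cdot>\<^sub>m rmat (transpose_mat S)"
  have Q: "Q \<in> carrier_mat n n" using S by (simp add: Q_def)
  have rS: "rmat S \<in> carrier_mat n n" "rmat (transpose_mat S) \<in> carrier_mat n n" using S by auto
  have Qt: "transpose_mat Q = (1 / of_int D) \<cdot>\<^sub>m rmat S" using S by (intro eq_matI) (auto simp: Q_def)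
  have hom: "rmat (X * Y) = rmat X * rmat Y" if "X \<in> carrier_mat n n" "Y \<in> carrier_mat n n" for X Y
    using of_int_hom.mat_hom_mult[OF that, where ?'a = rat] .
  have smult2: "c \<cdot>\<^sub>m (c' \<cdot>\<^sub>m X) = (c * c') \<cdot>\<^sub>m X" for c c' and X :: "rat mat" by (intro eq_matI) auto
  have QQ: "Q * transpose_mat Q = 1\<^sub>m n"
  proof -
    have "Q * transpose_mat Q = (1 / of_int D * (1 / of_int D)) \<cdot>\<^sub>m (rmat (transpose_mat S) * rmat S)"
      unfolding Qt unfolding Q_def using rS
      by (simp add: mult_smult_assoc_mat[of _ n n _ n] mult_smult_distrib[of _ n n _ n] smult2)
    also have "rmat (transpose_mat S) * rmat S = rmat (D\<^sup>2 \<cdot>\<^sub>m 1\<^sub>m n)"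
      unfolding SS[symmetric] using S by (subst hom) auto
    finally show ?thesis using D0 by (auto intro!: eq_matI simp: power2_eq_square)
  qed
  have QQ': "transpose_mat Q * Q = 1\<^sub>m n"
    using mat_mult_left_right_inverse[OF Q _ QQ] Q by simp
  have AQ: "rmat A * Q = Q * rmat B"
  proof -
    have "transpose_mat (S * A) = transpose_mat (B * S)" using SA by simp
    hence "A * transpose_mat S = transpose_mat S * B"
      using S A B by (simp add: transpose_mult[of _ n n _ n] A_def B_def adj_mat_transpose)
    hence "rmat A * rmat (transpose_mat S) = rmat (transpose_mat S) * rmat B"
      using hom[of A "transpose_mat S"] hom[of "transpose_mat S" B] S A B by simp
    thus ?thesis unfolding Q_def using rS A B
      by (simp add: mult_smult_assoc_mat[of _ n n _ n] mult_smult_distrib[of _ n n _ n])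
  qed
  have Qe: "Q *\<^sub>v all_ones_vec n = all_ones_vec n"
  proof -
    have one: "(all_ones_vec n :: rat vec) \<in> carrier_vec n" by (simp add: all_ones_vec_def)
    have "transpose_mat Q *\<^sub>v all_ones_vec n = all_ones_vec n"
    proof (rule eq_vecI)
      fix i assume "i < dim_vec (all_ones_vec n :: rat vec)"
      hence i: "i < n" by (simp add: all_ones_vec_def)
      \<comment> \<open>Column 0 of either walk matrix is the all-one vector.\<close>
      have "(\<Sum>l<n. S $$ (i, l) * WE $$ (l, 0)) = D * WF $$ (i, 0)"
        using index_mult_mat_sum[OF S WE i, of 0] i WF unfolding SW by simp
      hence "(\<Sum>l<n. S $$ (i, l)) = D"
        using i by (simp add: WE_def WF_def walk_mat_index walk_vec_0)
      moreover have "(transpose_mat Q *\<^sub>v all_ones_vec n) $ i = (\<Sum>l<n. transpose_mat Q $$ (i, l) * (all_ones_vec n :: rat vec) $ l)"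
        using i Q one by (intro mult_mat_vec_index_sum) auto
      moreover have "\<dots> = (\<Sum>l<n. of_int (S $$ (i, l))) / of_int D"
        unfolding Qt sum_divide_distrib using i S by (intro sum.cong) (auto simp: all_ones_vec_def)
      ultimately show "(transpose_mat Q *\<^sub>v all_ones_vec n) $ i = (all_ones_vec n :: rat vec) $ i"
        using i D0 by (simp add: all_ones_vec_def flip: of_int_sum)
    qed (use Q in \<open>auto simp: all_ones_vec_def\<close>)
    hence "Q *\<^sub>v all_ones_vec n = Q *\<^sub>v (transpose_mat Q *\<^sub>v all_ones_vec n)" by simp
    also have "\<dots> = (Q * transpose_mat Q) *\<^sub>v all_ones_vec n"
      using assoc_mult_mat_vec[OF Q _ one, of "transpose_mat Q"] Q by simp
    finally show ?thesis unfolding QQ using one by simp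
  qed
  have int: "of_int (det (walk_mat n E)) * Q $$ (i, j) \<in> \<int>" if "i < n" "j < n" for i j
  proof -
    have "of_int (det (walk_mat n E)) * Q $$ (i, j) = of_int (S $$ (j, i))"
      using that S D0 by (simp add: Q_def D_def WE_def)
    thus ?thesis by simp
  qed
  show ?thesis
    using that[OF mn _ AQ[unfolded A_def B_def] int] Q QQ QQ' Qe by (simp add: regular_orthogonal_def)
qed

section \<open>Levels of rational orthogonal matrices\<close>

lemma common_denominator:
  assumes "finite (S :: rat set)"
  shows "\<exists>k>0. \<forall>x\<in>S. of_nat k * x \<in> \<int>"
  using assms
proof (induction S rule: finite_induct)
  case (insert y S)
  then obtain k where k: "k > 0" "\<forall>x\<in>S. of_nat k * x \<in> \<int>" by blast
  obtain a c where ac: "quotient_of y = (a, c)" by (cases "quotient_of y")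
  have c: "c > 0" "y = of_int a / of_int c"
    using quotient_of_denom_pos[OF ac] quotient_of_div[OF ac] by auto
  have "of_nat (k * nat c) * x \<in> \<int>" if "x \<in> insert y S" for x
  proof (cases "x = y")
    case True
    have "of_nat (k * nat c) * x = of_int (int k * a)" using True c by simp
    thus ?thesis by (metis Ints_of_int)
  next
    case False
    hence "of_nat k * x \<in> \<int>" using that k by auto
    hence "of_int c * (of_nat k * x) \<in> \<int>" by (rule Ints_mult[OF Ints_of_int])
    moreover have "of_nat (k * nat c) * x = of_int c * (of_nat k * x)" using c(1) by (simp add: mult_ac)
    ultimately show ?thesis by (simp only:)
  qed
  moreover have "k * nat c > 0" using k c by simp
  ultimately show ?case by blast
qed (auto intro: exI[of _ 1])

lemma elements_mat_scaled_subset_Ints: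
  assumes "Q \<in> carrier_mat n n"
  shows "elements_mat (of_nat k \<cdot>\<^sub>m Q) \<subseteq> \<int> \<longleftrightarrow> (\<forall>i<n. \<forall>j<n. of_nat k * Q $$ (i, j) \<in> \<int>)"
proof -
  have "dim_row Q = n" "dim_col Q = n" using assms by auto
  thus ?thesis by (fastforce simp: elements_mat_def)
qed

lemma mat_level:
  assumes Q: "Q \<in> carrier_mat n n"
  shows mat_level_pos: "mat_level Q > 0"
    and mat_level_integral: "\<And>i j. i < n \<Longrightarrow> j < n \<Longrightarrow> of_nat (mat_level Q) * Q $$ (i, j) \<in> \<int>"
proof -
  let ?P = "\<lambda>k. k > 0 \<and> elements_mat (of_nat k \<cdot>\<^sub>m Q) \<subseteq> \<int>"
  have "finite ((\<lambda>(i, j). Q $$ (i, j)) ` ({..<n} \<times> {..<n}))" by simp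
  from common_denominator[OF this] obtain k where "k > 0" "\<forall>i<n. \<forall>j<n. of_nat k * Q $$ (i, j) \<in> \<int>"
    by auto
  hence "?P k" using elements_mat_scaled_subset_Ints[OF Q] by simp
  hence P: "?P (mat_level Q)" unfolding mat_level_def by (rule LeastI)
  show "mat_level Q > 0" using P by simp
  show "\<And>i j. i < n \<Longrightarrow> j < n \<Longrightarrow> of_nat (mat_level Q) * Q $$ (i, j) \<in> \<int>"
    using P elements_mat_scaled_subset_Ints[OF Q] by simp
qed

lemma mat_level_le:
  assumes Q: "Q \<in> carrier_mat n n" and "k > 0" "\<And>i j. i < n \<Longrightarrow> j < n \<Longrightarrow> of_nat k * Q $$ (i, j) \<in> \<int>"
  shows "mat_level Q \<le> k"
  unfolding mat_level_def using assms(2,3) elements_mat_scaled_subset_Ints[OF Q] by (intro Least_le) simp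

text \<open>The remainder of \<open>k\<close> modulo the level clears all denominators too, so
  minimality of the level forces it to be 0.\<close>

lemma mat_level_dvd:
  assumes Q: "Q \<in> carrier_mat n n" and k: "\<And>i j. i < n \<Longrightarrow> j < n \<Longrightarrow> of_nat k * Q $$ (i, j) \<in> \<int>"
  shows "mat_level Q dvd k"
proof (rule ccontr)
  let ?l = "mat_level Q"
  assume "\<not> ?l dvd k"
  hence r: "k mod ?l > 0" by (simp add: mod_greater_zero_iff_not_dvd)
  have "of_nat (k mod ?l) * Q $$ (i, j) \<in> \<int>" if "i < n" "j < n" for i j
  proof -
    have "(of_nat k :: rat) = of_nat (k div ?l) * of_nat ?l + of_nat (k mod ?l)"
      by (metis div_mult_mod_eq of_nat_add of_nat_mult)
    hence "of_nat (k mod ?l) * Q $$ (i, j) =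
        of_nat k * Q $$ (i, j) - of_nat (k div ?l) * (of_nat ?l * Q $$ (i, j))"
      by (simp add: algebra_simps)
    also have "\<dots> \<in> \<int>" by (rule Ints_diff[OF k[OF that] Ints_mult[OF Ints_of_nat mat_level_integral[OF Q that]]])
    finally show ?thesis .
  qed
  hence "?l \<le> k mod ?l" using r by (intro mat_level_le[OF Q])
  moreover have "k mod ?l < ?l" using mat_level_pos[OF Q] by simp
  ultimately show False by simp
qed

lemma scaled_int_mat_index:
  assumes Q: "Q \<in> carrier_mat n n" and "i < n" "j < n"
  shows "of_int (scaled_int_mat (mat_level Q) Q $$ (i, j)) = of_nat (mat_level Q) * Q $$ (i, j)"
proof -
  have "dim_row Q = n" "dim_col Q = n" using Q by auto
  moreover have "of_nat (mat_level Q) * Q $$ (i, j) \<in> \<int>" using mat_level_integral[OF assms] .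
  ultimately show ?thesis using assms(2,3) by (simp add: scaled_int_mat_def of_int_floor)
qed

lemma mat_level_primitive:
  assumes Q: "Q \<in> carrier_mat n n" and q: "q > 1" "q dvd mat_level Q"
  shows "\<exists>i<n. \<exists>j<n. \<not> int q dvd scaled_int_mat (mat_level Q) Q $$ (i, j)"
proof (rule ccontr)
  assume *: "\<not> ?thesis"
  obtain t where t: "mat_level Q = q * t" using q(2) by (elim dvdE)
  have "of_nat t * Q $$ (i, j) \<in> \<int>" if ij: "i < n" "j < n" for i j
  proof -
    have "int q dvd scaled_int_mat (mat_level Q) Q $$ (i, j)" using * ij by blast
    then obtain c where c: "scaled_int_mat (mat_level Q) Q $$ (i, j) = int q * c" by (elim dvdE)
    have "of_nat q * of_int c = (of_nat (mat_level Q) * Q $$ (i, j) :: rat)"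
      using scaled_int_mat_index[OF Q ij] by (simp add: c)
    hence "of_nat q * (of_int c :: rat) = of_nat q * (of_nat t * Q $$ (i, j))" by (simp add: t)
    hence "of_nat t * Q $$ (i, j) = of_int c" using q(1) by simp
    thus ?thesis by simp
  qed
  moreover have "t > 0" using mat_level_pos[OF Q] t by (cases t) auto
  ultimately have "mat_level Q \<le> t" by (intro mat_level_le[OF Q])
  thus False using t q(1) \<open>t > 0\<close> by simp
qed

text \<open>The matrix \<open>M\<close> is \<open>l\<close> times a regular orthogonal matrix; with
  it the divisibility arguments take place over the integers.\<close>

locale scaled_orthogonal =
  fixes n :: nat and l :: int and M :: "nat \<Rightarrow> nat \<Rightarrow> int"
  assumes l_pos: "l > 0"
    and cols: "i < n \<Longrightarrow> j < n \<Longrightarrow> (\<Sum>t<n. M t i * M t j) = (if i = j then l\<^sup>2 else 0)"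
    and rows: "i < n \<Longrightarrow> j < n \<Longrightarrow> (\<Sum>t<n. M i t * M j t) = (if i = j then l\<^sup>2 else 0)"
    and col_sum: "j < n \<Longrightarrow> (\<Sum>t<n. M t j) = l"
    and row_sum: "i < n \<Longrightarrow> (\<Sum>t<n. M i t) = l"

lemma regular_orthogonal_sums:
  assumes "regular_orthogonal n Q"
  shows "i < n \<Longrightarrow> j < n \<Longrightarrow> (\<Sum>t<n. Q $$ (t, i) * Q $$ (t, j)) = (if i = j then 1 else 0)"
    and "i < n \<Longrightarrow> j < n \<Longrightarrow> (\<Sum>t<n. Q $$ (i, t) * Q $$ (j, t)) = (if i = j then 1 else 0)"
    and "i < n \<Longrightarrow> (\<Sum>t<n. Q $$ (i, t)) = 1"
    and "j < n \<Longrightarrow> (\<Sum>t<n. Q $$ (t, j)) = 1"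
proof -
  have Q: "Q \<in> carrier_mat n n" "Q * transpose_mat Q = 1\<^sub>m n" "transpose_mat Q * Q = 1\<^sub>m n"
    "Q *\<^sub>v all_ones_vec n = all_ones_vec n" using assms by (auto simp: regular_orthogonal_def)
  have dim: "dim_row Q = n" "dim_col Q = n" using Q by auto
  show c: "(\<Sum>t<n. Q $$ (t, i) * Q $$ (t, j)) = (if i = j then 1 else 0)" if "i < n" "j < n" for i j
    using index_mult_mat_sum[of "transpose_mat Q" n n Q n i j] Q that dim by simp
  show "(\<Sum>t<n. Q $$ (i, t) * Q $$ (j, t)) = (if i = j then 1 else 0)" if "i < n" "j < n" for i j
    using index_mult_mat_sum[of Q n n "transpose_mat Q" n i j] Q that dim by simp
  show r: "(\<Sum>t<n. Q $$ (i, t)) = 1" if "i < n" for i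
    using mult_mat_vec_index_sum[OF Q(1), of "all_ones_vec n" i] that
    unfolding Q(4) by (simp add: all_ones_vec_def)
  show "(\<Sum>t<n. Q $$ (t, j)) = 1" if j: "j < n" for j
  proof -
    \<comment> \<open>This computes Q^T e = Q^T Q e = e.\<close>
    have "(\<Sum>t<n. Q $$ (t, j)) = (\<Sum>t<n. Q $$ (t, j) * (\<Sum>s<n. Q $$ (t, s)))" using r by simp
    also have "\<dots> = (\<Sum>s<n. \<Sum>t<n. Q $$ (t, j) * Q $$ (t, s))"
      unfolding sum_distrib_left by (rule sum.swap)
    also have "\<dots> = (\<Sum>s<n. if j = s then 1 else 0)" using j by (intro sum.cong refl c) auto
    also have "\<dots> = 1" using j by simp
    finally show ?thesis .
  qed
qed

lemma scaled_orthogonal_level: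
  assumes "regular_orthogonal n Q"
  shows "scaled_orthogonal n (int (mat_level Q)) (\<lambda>i j. scaled_int_mat (mat_level Q) Q $$ (i, j))"
proof
  let ?l = "mat_level Q"
  let ?M = "scaled_int_mat ?l Q"
  have Q: "Q \<in> carrier_mat n n" using assms by (simp add: regular_orthogonal_def)
  note s = regular_orthogonal_sums[OF assms]
  show "0 < int ?l" using mat_level_pos[OF Q] by simp
  have two: "(of_int (\<Sum>t<n. ?M $$ f t * ?M $$ g t) :: rat) = of_nat ?l ^ 2 * (\<Sum>t<n. Q $$ f t * Q $$ g t)"
    if "\<And>t. t < n \<Longrightarrow> f t \<in> {..<n} \<times> {..<n}" "\<And>t. t < n \<Longrightarrow> g t \<in> {..<n} \<times> {..<n}" for f g
  proof -
    have "of_int (?M $$ f t * ?M $$ g t) = of_nat ?l ^ 2 * (Q $$ f t * Q $$ g t)" if t: "t < n" for t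
    proof -
      obtain a b c d where e: "f t = (a, b)" "g t = (c, d)" "a < n" "b < n" "c < n" "d < n"
        using \<open>\<And>t. t < n \<Longrightarrow> f t \<in> _\<close>[OF t] \<open>\<And>t. t < n \<Longrightarrow> g t \<in> _\<close>[OF t] by auto
      show ?thesis using scaled_int_mat_index[OF Q e(3,4)] scaled_int_mat_index[OF Q e(5,6)]
        by (simp add: e power2_eq_square mult_ac)
    qed
    thus ?thesis unfolding of_int_sum sum_distrib_left by (intro sum.cong) auto
  qed
  have one: "(of_int (\<Sum>t<n. ?M $$ f t) :: rat) = of_nat ?l * (\<Sum>t<n. Q $$ f t)"
    if "\<And>t. t < n \<Longrightarrow> f t \<in> {..<n} \<times> {..<n}" for f
  proof -
    have "of_int (?M $$ f t) = of_nat ?l * Q $$ f t" if t: "t < n" for t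
    proof -
      obtain a b where e: "f t = (a, b)" "a < n" "b < n" using \<open>\<And>t. t < n \<Longrightarrow> f t \<in> _\<close>[OF t] by auto
      show ?thesis using scaled_int_mat_index[OF Q e(2,3)] by (simp add: e)
    qed
    thus ?thesis unfolding of_int_sum sum_distrib_left by (intro sum.cong) auto
  qed
  have inj: "x = y" if "(of_int x :: rat) = of_int y" for x y using that by (simp only: of_int_eq_iff)
  fix i j assume i: "i < n"
  show "(\<Sum>t<n. ?M $$ (i, t)) = int ?l"
    by (rule inj) (use one[of "\<lambda>t. (i, t)"] s(3) i in simp)
  show "(\<Sum>t<n. ?M $$ (t, i)) = int ?l"
    by (rule inj) (use one[of "\<lambda>t. (t, i)"] s(4) i in simp)
  assume j: "j < n"
  show "(\<Sum>t<n. ?M $$ (t, i) * ?M $$ (t, j)) = (if i = j then (int ?l)\<^sup>2 else 0)"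
    by (rule inj) (use two[of "\<lambda>t. (t, i)" "\<lambda>t. (t, j)"] s(1)[OF i j] i j in simp)
  show "(\<Sum>t<n. ?M $$ (i, t) * ?M $$ (j, t)) = (if i = j then (int ?l)\<^sup>2 else 0)"
    by (rule inj) (use two[of "\<lambda>t. (i, t)" "\<lambda>t. (j, t)"] s(2)[OF i j] i j in simp)
qed

locale scaled_similarity = scaled_orthogonal n l M + A: graph_matrix n a + B: graph_matrix n b
  for n l M a b +
  assumes intertwine: "i < n \<Longrightarrow> j < n \<Longrightarrow> (\<Sum>t<n. a i t * M t j) = (\<Sum>t<n. M i t * b t j)"
begin

abbreviation column :: "nat \<Rightarrow> nat \<Rightarrow> int" where "column j \<equiv> (\<lambda>i. M i j)"

lemma mat_apply_column: "i < n \<Longrightarrow> j < n \<Longrightarrow> mat_apply n a (column j) i = (\<Sum>t<n. b t j * M i t)"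
  using intertwine[of i j] by (simp add: mat_apply_def mult.commute)

lemma inner_columns: "i < n \<Longrightarrow> j < n \<Longrightarrow> dot n (column i) (column j) = (if i = j then l\<^sup>2 else 0)"
  by (simp add: dot_def cols)

text \<open>From e^T A^k M = e^T M B^k = l e^T B^k. In particular every column of \<open>M\<close>
  lies in the kernel of W(G)^T modulo \<open>l\<close>.\<close>

lemma inner_walk_column: "j < n \<Longrightarrow> dot n (walk_vec n a k) (column j) = l * walk_vec n b k j"
proof (induction k arbitrary: j)
  case 0
  thus ?case by (simp add: dot_def walk_vec_0 col_sum)
next
  case (Suc k)
  have "dot n (walk_vec n a (Suc k)) (column j) = dot n (walk_vec n a k) (mat_apply n a (column j))"
    by (simp add: A.walk_vec_inner_lin)
  also have "\<dots> = dot n (walk_vec n a k) (\<lambda>i. \<Sum>t<n. b t j * M i t)"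
    using Suc.prems by (intro dot_cong refl mat_apply_column)
  also have "\<dots> = (\<Sum>t<n. b t j * dot n (walk_vec n a k) (column t))"
    by (simp add: dot_sum_right dot_scale_right)
  also have "\<dots> = (\<Sum>t<n. l * (b j t * walk_vec n b k t))"
    using Suc.IH B.sym by (intro sum.cong refl) (auto simp: mult_ac)
  also have "\<dots> = l * walk_vec n b (Suc k) j" by (simp add: walk_vec_Suc mat_apply_def sum_distrib_left)
  finally show ?case .
qed

lemma mat_apply_pow_column:
  assumes j: "j < n"
  shows "\<exists>c. \<forall>i<n. (mat_apply n a ^^ k) (column j) i = (\<Sum>t<n. c t * M i t)"
proof (induction k)
  case 0
  have "M i j = (\<Sum>t<n. (if t = j then 1 else 0) * M i t)" for i
    using j by (simp add: if_distrib[of "\<lambda>t. t * _"] cong: if_cong)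
  thus ?case by (intro exI[of _ "\<lambda>t. if t = j then 1 else 0"]) simp
next
  case (Suc k)
  then obtain c where c: "\<And>i. i < n \<Longrightarrow> (mat_apply n a ^^ k) (column j) i = (\<Sum>t<n. c t * M i t)" by blast
  have "(mat_apply n a ^^ Suc k) (column j) i = (\<Sum>s<n. (\<Sum>t<n. c t * b s t) * M i s)" if i: "i < n" for i
  proof -
    have "(mat_apply n a ^^ Suc k) (column j) i = mat_apply n a (\<lambda>i. \<Sum>t<n. c t * M i t) i"
      using c by (simp add: mat_apply_def)
    also have "\<dots> = (\<Sum>t<n. c t * (\<Sum>s<n. b s t * M i s))"
      using mat_apply_column[OF i] by (simp add: mat_apply_sum mat_apply_scale)
    also have "\<dots> = (\<Sum>s<n. \<Sum>t<n. c t * (b s t * M i s))"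
      unfolding sum_distrib_left by (rule sum.swap)
    finally show ?thesis by (simp add: sum_distrib_right mult.assoc)
  qed
  thus ?case by (intro exI[of _ "\<lambda>s. \<Sum>t<n. c t * b s t"] allI impI)
qed

text \<open>M^T A^k M = M^T M B^k = l^2 B^k; this is the source of isotropic vectors.\<close>

lemma dvd_inner_lin_pow_column:
  assumes j: "j < n"
  shows "l\<^sup>2 dvd dot n (column j) ((mat_apply n a ^^ k) (column j))"
proof -
  obtain c where c: "\<And>i. i < n \<Longrightarrow> (mat_apply n a ^^ k) (column j) i = (\<Sum>t<n. c t * M i t)"
    using mat_apply_pow_column[OF j] by blast
  have "dot n (column j) ((mat_apply n a ^^ k) (column j)) = dot n (column j) (\<lambda>i. \<Sum>t<n. c t * M i t)"
    using c by (intro dot_cong) auto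
  also have "\<dots> = (\<Sum>t<n. c t * dot n (column j) (column t))"
    by (simp add: dot_sum_right dot_scale_right)
  also have "l\<^sup>2 dvd \<dots>" using j inner_columns by (intro dvd_sum) auto
  finally show ?thesis .
qed

end

lemma scaled_similarity_level:
  assumes E: "simple_graph n E" and F: "simple_graph n F" and reg: "regular_orthogonal n Q"
    and AQ: "rmat (Defs.adj_mat n E) * Q = Q * rmat (Defs.adj_mat n F)"
  shows "scaled_similarity n (int (mat_level Q)) (\<lambda>i j. scaled_int_mat (mat_level Q) Q $$ (i, j)) (adj_fun E) (adj_fun F)"
proof -
  interpret A: graph_matrix n "adj_fun E" by (rule adj_fun_graph_matrix[OF E])
  interpret B: graph_matrix n "adj_fun F" by (rule adj_fun_graph_matrix[OF F])
  interpret scaled_orthogonal n "int (mat_level Q)" "\<lambda>i j. scaled_int_mat (mat_level Q) Q $$ (i, j)"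
    by (rule scaled_orthogonal_level[OF reg])
  have Q: "Q \<in> carrier_mat n n" using reg by (simp add: regular_orthogonal_def)
  let ?M = "scaled_int_mat (mat_level Q) Q" and ?l = "mat_level Q"
  show ?thesis
  proof
    fix i j assume ij: "i < n" "j < n"
    have "(\<Sum>t<n. of_int (adj_fun E i t) * Q $$ (t, j)) = (\<Sum>t<n. Q $$ (i, t) * of_int (adj_fun F t j))"
    proof -
      have A: "rmat (Defs.adj_mat n E) \<in> carrier_mat n n" and B: "rmat (Defs.adj_mat n F) \<in> carrier_mat n n" by simp_all
      have "(\<Sum>t<n. rmat (Defs.adj_mat n E) $$ (i, t) * Q $$ (t, j)) = (\<Sum>t<n. Q $$ (i, t) * rmat (Defs.adj_mat n F) $$ (t, j))"
        unfolding index_mult_mat_sum[OF A Q ij, symmetric] index_mult_mat_sum[OF Q B ij, symmetric] AQ ..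
      thus ?thesis using ij by (simp add: adj_mat_eq)
    qed
    hence "(of_nat ?l :: rat) * (\<Sum>t<n. of_int (adj_fun E i t) * Q $$ (t, j)) =
        of_nat ?l * (\<Sum>t<n. Q $$ (i, t) * of_int (adj_fun F t j))" by simp
    hence "(of_int (\<Sum>t<n. adj_fun E i t * ?M $$ (t, j)) :: rat) = of_int (\<Sum>t<n. ?M $$ (i, t) * adj_fun F t j)"
      using scaled_int_mat_index[OF Q] ij by (simp add: sum_distrib_left mult_ac)
    thus "(\<Sum>t<n. adj_fun E i t * ?M $$ (t, j)) = (\<Sum>t<n. ?M $$ (i, t) * adj_fun F t j)"
      by (simp only: of_int_eq_iff)
  qed
qed

section \<open>Similar adjacency matrices\<close>

text \<open>Makes x^2 - x nonnegative on integers, so that a vanishing sum of such terms forces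
  every x to be 0 or 1.\<close>

lemma int_le_mult_self: "(x :: int) \<le> x * x"
proof (cases "x \<le> 0")
  case True
  thus ?thesis using order_trans zero_le_square by blast
next
  case False
  thus ?thesis using mult_right_mono[of 1 x x] by simp
qed

text \<open>A column of integers whose entries and squared entries both sum to 1 is a unit vector.
  Orthogonality then makes \<open>M\<close> a permutation matrix, and \<open>f j\<close> is the
  position of the 1 in column \<open>j\<close>.\<close>

lemma integral_similarity_iso:
  assumes "scaled_similarity n 1 M (adj_fun E) (adj_fun F)"
  shows "graph_iso n F n E"
proof -
  interpret scaled_similarity n 1 M "adj_fun E" "adj_fun F" by (rule assms)
  have ex: "\<exists>i<n. \<forall>t<n. M t j = (if t = i then 1 else 0)" if j: "j < n" for j
  proof -
    have "(\<Sum>t<n. M t j * M t j - M t j) = 0" using cols[OF j j] col_sum[OF j] by (simp add: sum_subtractf)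
    hence "M t j * M t j - M t j = 0" if "t < n" for t
      using that by (subst (asm) sum_nonneg_eq_0_iff) (auto simp: int_le_mult_self)
    hence z1: "M t j = 0 \<or> M t j = 1" if "t < n" for t using that by fastforce
    have "1 = (\<Sum>t<n. M t j)" using col_sum[OF j] by simp
    also have "\<dots> = (\<Sum>t<n. if M t j = 1 then 1 else 0)" using z1 by (intro sum.cong) auto
    also have "\<dots> = int (card {t \<in> {..<n}. M t j = 1})" by (simp flip: sum.inter_filter)
    finally have "card {t \<in> {..<n}. M t j = 1} = 1" by simp
    then obtain i where i: "{t \<in> {..<n}. M t j = 1} = {i}" by (rule card_1_singletonE)
    have "i < n" using i by auto
    moreover have "M t j = (if t = i then 1 else 0)" if "t < n" for t
    proof -
      have "t \<in> {t \<in> {..<n}. M t j = 1} \<longleftrightarrow> t \<in> {i}" using i by simp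
      thus ?thesis using z1[OF that] that by auto
    qed
    ultimately show ?thesis by blast
  qed
  have "\<forall>j. \<exists>i. j < n \<longrightarrow> i < n \<and> (\<forall>t<n. M t j = (if t = i then 1 else 0))"
    using ex by blast
  then obtain f where "\<forall>j. j < n \<longrightarrow> f j < n \<and> (\<forall>t<n. M t j = (if t = f j then 1 else 0))"
    by (rule choice[THEN exE])
  hence f: "f j < n" "\<And>t. t < n \<Longrightarrow> M t j = (if t = f j then 1 else 0)" if "j < n" for j
    using that by simp_all
  have inj: "inj_on f {0..<n}"
  proof (rule inj_onI, rule ccontr)
    fix i j assume ij: "i \<in> {0..<n}" "j \<in> {0..<n}" "f i = f j" "i \<noteq> j"
    hence "(\<Sum>t<n. M t i * M t j) = (\<Sum>t<n. if t = f i then 1 else 0)"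
      using f by (intro sum.cong) auto
    also have "\<dots> = 1" using f ij by simp
    finally show False using cols[of i j] ij by simp
  qed
  moreover have "f ` {0..<n} \<subseteq> {0..<n}" using f by auto
  ultimately have "bij_betw f {0..<n} {0..<n}"
    unfolding bij_betw_def by (auto simp: endo_inj_surj)
  moreover have "adj_fun F u v = adj_fun E (f u) (f v)" if uv: "u < n" "v < n" for u v
  proof -
    have "(\<Sum>t<n. adj_fun E (f u) t * M t v) = (\<Sum>t<n. if t = f v then adj_fun E (f u) t else 0)"
      using f[OF uv(2)] by (intro sum.cong) auto
    also have "\<dots> = adj_fun E (f u) (f v)" using f[OF uv(2)] by simp
    finally have 1: "(\<Sum>t<n. adj_fun E (f u) t * M t v) = adj_fun E (f u) (f v)" .
    have "M (f u) t = (if t = u then 1 else 0)" if "t < n" for t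
      using f[OF that] f[OF uv(1)] inj_onD[OF inj, of u t] that uv by auto
    hence "(\<Sum>t<n. M (f u) t * adj_fun F t v) = (\<Sum>t<n. if t = u then adj_fun F t v else 0)"
      by (intro sum.cong) auto
    also have "\<dots> = adj_fun F u v" using uv by simp
    finally show ?thesis using intertwine[OF f(1)[OF uv(1)] uv(2)] 1 by simp
  qed
  hence "\<forall>u\<in>{0..<n}. \<forall>v\<in>{0..<n}. {u, v} \<in> F \<longleftrightarrow> {f u, f v} \<in> E"
    by (force simp: adj_fun_def split: if_splits)
  ultimately show ?thesis unfolding graph_iso_def by blast
qed

text \<open>For two columns congruent to \<open>cj\<close> and \<open>ck\<close> times
  \<open>z\<close>, the cross combination with coefficients \<open>ck\<close> and
  \<open>- cj\<close> vanishes modulo \<open>p\<close>. Independence would make these coefficients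
  zero, hence both columns zero, which is a dependence.\<close>

lemma rank_mod_eq_1:
  assumes p: "prime p" and M: "M \<in> carrier_mat n n"
    and mult: "\<And>j. j < n \<Longrightarrow> \<exists>c. \<forall>i<n. int p dvd M $$ (i, j) - c * z i"
    and nz: "i0 < n" "j0 < n" "\<not> int p dvd M $$ (i0, j0)"
  shows "rank_mod p M = 1"
proof -
  have dim: "dim_row M = n" "dim_col M = n" using M by auto
  have pp: "prime (int p)" using p by simp
  have le: "card J \<le> 1" if J: "J \<subseteq> {0..<n}" "cols_indep_mod p M J" for J
  proof (rule ccontr)
    assume "\<not> card J \<le> 1"
    moreover have fin: "finite J" using J finite_subset by blast
    ultimately obtain j k where jk: "j \<in> J" "k \<in> J" "j \<noteq> k"
      using card_le_Suc0_iff_eq[OF fin] by auto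
    obtain cj where cj: "\<And>i. i < n \<Longrightarrow> int p dvd M $$ (i, j) - cj * z i" using mult[of j] jk(1) J(1) by fastforce
    obtain ck where ck: "\<And>i. i < n \<Longrightarrow> int p dvd M $$ (i, k) - ck * z i" using mult[of k] jk(2) J(1) by fastforce
    have sum2: "(\<Sum>t\<in>J. (if t = j then x else if t = k then y else 0) * M $$ (i, t)) = x * M $$ (i, j) + y * M $$ (i, k)" for x y i
    proof -
      have "(\<Sum>t\<in>J. (if t = j then x else if t = k then y else 0) * M $$ (i, t))
        = (\<Sum>t\<in>{j, k}. (if t = j then x else if t = k then y else 0) * M $$ (i, t))"
        using fin jk by (intro sum.mono_neutral_right) auto
      thus ?thesis using jk by simp
    qed
    have indep: "int p dvd x \<and> int p dvd y" if "\<And>i. i < n \<Longrightarrow> int p dvd x * M $$ (i, j) + y * M $$ (i, k)" for x y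
    proof -
      let ?c = "\<lambda>t. if t = j then x else if t = k then y else 0"
      have "\<forall>i<dim_row M. [(\<Sum>t\<in>J. ?c t * M $$ (i, t)) = 0] (mod int p)"
        using that unfolding sum2 by (simp add: dim cong_0_iff)
      hence c0: "[?c t = 0] (mod int p)" if "t \<in> J" for t
        using J(2) that unfolding cols_indep_mod_def by (elim allE[of _ ?c]) auto
      show ?thesis using c0[OF jk(1)] c0[OF jk(2)] jk by (simp add: cong_0_iff)
    qed
    have "int p dvd ck \<and> int p dvd - cj"
    proof (rule indep)
      fix i assume i: "i < n"
      have "int p dvd ck * (M $$ (i, j) - cj * z i) - cj * (M $$ (i, k) - ck * z i)"
        using cj[OF i] ck[OF i] by auto
      thus "int p dvd ck * M $$ (i, j) + (- cj) * M $$ (i, k)" by (simp add: algebra_simps)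
    qed
    hence "int p dvd cj" "int p dvd ck" by auto
    hence "int p dvd M $$ (i, j)" "int p dvd M $$ (i, k)" if "i < n" for i
      using cj[OF that] ck[OF that] by (metis dvd_mult2 diff_add_cancel dvd_add)+
    hence "int p dvd 1 \<and> int p dvd 1" by (intro indep) auto
    thus False using pp by simp
  qed
  have "cols_indep_mod p M {j0}"
    unfolding cols_indep_mod_def
  proof (intro allI impI ballI)
    fix c :: "nat \<Rightarrow> int" and j
    assume c: "\<forall>i<dim_row M. [(\<Sum>j\<in>{j0}. c j * M $$ (i, j)) = 0] (mod int p)" and j: "j \<in> {j0}"
    have "int p dvd c j0 * M $$ (i0, j0)" using c nz(1) by (simp add: dim cong_0_iff)
    thus "[c j = 0] (mod int p)" using j nz(3) pp by (simp add: prime_dvd_mult_iff cong_0_iff)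
  qed
  hence "1 \<in> card ` {J. J \<subseteq> {0..<dim_col M} \<and> cols_indep_mod p M J}"
    using nz by (intro image_eqI[of _ _ "{j0}"]) (auto simp: dim)
  moreover have "finite {J. J \<subseteq> {0..<dim_col M} \<and> cols_indep_mod p M J}" by simp
  ultimately show ?thesis unfolding rank_mod_def using le by (intro Max_eqI) (auto simp: dim)
qed

text \<open>The prime in the definition of the family is existentially quantified and must be
  identified with \<open>p\<close>: otherwise p^2 would divide the square-free \<open>b\<close>. For
  n < 2 the product of the invariant factors is 1, which p^2 cannot divide.\<close>

lemma family_Fp_data:
  assumes "prime p" "odd p" "E \<in> family_Fp n p"
  obtains b r where "simple_graph n E" "n \<ge> 2" "odd b" "squarefree b" "\<not> p dvd b"
    "graph_walks n (adj_fun E) (2 * int p ^ 2 * int b) r"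
    "det (walk_mat n E) dvd 2 ^ (n div 2) * (int p ^ 2 * int b)" "det (walk_mat n E) \<noteq> 0"
proof -
  obtain p' b where E: "simple_graph n E" and p': "prime p'" "odd p'" and b: "odd b" "squarefree b" "\<not> p' dvd b"
    and snf: "has_smith_normal_form n (walk_mat n E) (family_diag n p' b)"
    and dvd: "int p ^ 2 dvd det (walk_mat n E)"
    using assms(3) unfolding family_Fp_def family_F_def by blast
  let ?D = "\<Prod>i<n. family_diag n p' b i"
  obtain U V Ui Vi where "smith_data n (\<lambda>i j. walk_mat n E $$ (i, j)) U V Ui Vi (family_diag n p' b)"
    and D2: "det (walk_mat n E) dvd ?D"
    using smith_dataI[OF walk_mat_carrier snf] by metis
  have pD: "int p ^ 2 dvd ?D" using dvd D2 dvd_trans by blast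
  have n: "n \<ge> 2"
  proof (rule ccontr)
    assume "\<not> n \<ge> 2"
    hence "n = 0 \<or> n = 1" by auto
    hence "?D = 1" by (auto simp: family_diag_def)
    hence "int p dvd 1" using pD by (metis dvd_mult_left power2_eq_square)
    thus False using assms(1) by (simp add: prime_nat_iff)
  qed
  have D: "?D = 2 ^ (n div 2) * (int p' ^ 2 * int b)" by (rule prod_family_diag[OF n])
  have "int p ^ 2 dvd int p' ^ 2 * int b"
  proof -
    have "coprime (int p ^ 2) (2 ^ (n div 2))" using assms(2) by simp
    thus ?thesis using pD unfolding D by (simp add: coprime_dvd_mult_right_iff)
  qed
  hence "int (p ^ 2) dvd int (p' ^ 2 * b)" by simp
  hence p2: "p ^ 2 dvd p' ^ 2 * b" by (simp only: int_dvd_int_iff)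
  have "p = p'"
  proof (rule ccontr)
    assume "p \<noteq> p'"
    hence "coprime (p ^ 2) (p' ^ 2)" using assms(1) p'(1) by (simp add: primes_coprime)
    hence "p ^ 2 dvd b" using p2 by (simp add: coprime_dvd_mult_right_iff)
    hence "is_unit p" using b(2) by (simp add: squarefree_def)
    thus False using assms(1) by simp
  qed
  note pp = this
  obtain r where "graph_walks n (adj_fun E) (2 * int p ^ 2 * int b) r"
    using family_graph_walks[OF E n p'(2) b(1) snf] pp by blast
  moreover have "det (walk_mat n E) \<noteq> 0"
  proof
    assume "det (walk_mat n E) = 0"
    hence "?D = 0" using D2 by simp
    thus False using D p'(2) b(1) by auto
  qed
  ultimately show ?thesis using that[of b r] E n b D2 D pp by simp
qed

text \<open>If a prime q divides the level, some column of the scaled matrix is nonzero modulo q,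
  while it lies in the kernel modulo each power of q dividing the level and is isotropic modulo the
  square of that power. This excludes 2, the primes dividing \<open>b\<close>, and the level
  p^2.\<close>

lemma similarity_level:
  assumes p: "prime p" "odd p" and b: "odd b" "squarefree b" "\<not> p dvd b"
    and gw: "graph_walks n (adj_fun E) (2 * int p ^ 2 * int b) r"
    and E: "simple_graph n E" and F: "simple_graph n F" and reg: "regular_orthogonal n Q"
    and AQ: "rmat (Defs.adj_mat n E) * Q = Q * rmat (Defs.adj_mat n F)"
    and int: "\<And>i j. i < n \<Longrightarrow> j < n \<Longrightarrow> of_nat (2 ^ m * (p ^ 2 * b)) * Q $$ (i, j) \<in> \<int>"
  shows "mat_level Q = 1 \<or> mat_level Q = p"
proof -
  define l where "l = mat_level Q"
  let ?M = "\<lambda>i j. scaled_int_mat l Q $$ (i, j)"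
  let ?a = "adj_fun E"
  have Q: "Q \<in> carrier_mat n n" using reg by (simp add: regular_orthogonal_def)
  interpret graph_walks n ?a "2 * int p ^ 2 * int b" r by (rule gw)
  interpret ss: scaled_similarity n "int l" ?M ?a "adj_fun F"
    unfolding l_def by (rule scaled_similarity_level[OF E F reg AQ])
  have dvd: "l dvd 2 ^ m * (p ^ 2 * b)" unfolding l_def by (rule mat_level_dvd[OF Q int])
  have prim: "\<exists>i<n. \<exists>j<n. \<not> int q dvd ?M i j" if "q > 1" "q dvd l" for q
    unfolding l_def using mat_level_primitive[OF Q that(1)] that(2) by (simp add: l_def)
  have oddl: "odd l"
  proof
    assume even: "even l"
    then obtain i j where ij: "i < n" "j < n" "odd (?M i j)" using prim[of 2] by auto
    have "(2::int) dvd int l" using even by simp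
    hence four: "4 dvd (int l)\<^sup>2" using mult_dvd_mono[of 2 "int l" 2 "int l"] by (simp add: power2_eq_square)
    have "even (?M i j)"
    proof (rule isotropic_kernel_vector_even[of "ss.column j"])
      show "even (dot n (walk_vec n ?a k) (ss.column j))" for k using ss.inner_walk_column[OF ij(2)] even by simp
      show "4 dvd dot n (ss.column j) ((mat_apply n ?a ^^ k) (ss.column j))" for k
        using dvd_trans[OF four ss.dvd_inner_lin_pow_column[OF ij(2)]] .
    qed (rule ij(1))
    thus False using ij(3) by simp
  qed
  \<comment> \<open>The cofactor \<open>d'\<close> is prime to \<open>q\<close>, so
    \<open>q ^ s\<close> is the exact power of \<open>q\<close> in d. It is applied with
    \<open>s = 1\<close> to primes dividing \<open>b\<close> and with \<open>s = 2\<close> to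
    \<open>p\<close>.\<close>
  have no_power: False if q: "prime q" "odd q" and s: "s > 0" "q ^ s dvd l"
    and d: "2 * p ^ 2 * b = q ^ s * d'" "\<not> q dvd d'" for q s d' :: nat
  proof -
    have "q dvd l" using s dvd_trans[of q "q ^ s" l] by (simp add: dvd_power)
    then obtain i j where ij: "i < n" "j < n" "\<not> int q dvd ?M i j" using prim[of q] prime_gt_1_nat[OF q(1)] by auto
    have N: "int q ^ s dvd int l" using s(2) by (metis int_dvd_int_iff of_nat_power)
    hence N2: "(int q ^ s)\<^sup>2 dvd (int l)\<^sup>2" by (rule dvd_power_same)
    have "\<not> int q dvd int d'" using d(2) by simp
    moreover have "2 * int p ^ 2 * int b = int q ^ s * int d'"
      using arg_cong[OF d(1), of int] by simp
    ultimately show False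
      using no_isotropic_kernel_vector[of "int q" "int q ^ s" s "int d'" "ss.column j" i] q s ij
        ss.inner_walk_column[OF ij(2)] dvd_trans[OF N2 ss.dvd_inner_lin_pow_column[OF ij(2), of 0]]
        dvd_trans[OF N2 ss.dvd_inner_lin_pow_column[OF ij(2), of 1]] N
      by simp
  qed
  have "coprime l (2 ^ m)" using oddl by simp
  hence "l dvd p ^ 2 * b" using dvd by (simp add: coprime_dvd_mult_right_iff)
  moreover have "coprime l b"
  proof (rule ccontr)
    assume "\<not> coprime l b"
    hence "gcd l b \<noteq> 1" by (simp add: coprime_iff_gcd_eq_1)
    then obtain q where "prime q" "q dvd gcd l b" using prime_factor_nat by blast
    hence q: "prime q" "q dvd l" "q dvd b" by simp_all
    obtain c where c: "b = q * c" using q(3) by (elim dvdE)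
    have "odd q" using q(3) b(1) dvd_trans by blast
    moreover have "\<not> q dvd c"
    proof
      assume "q dvd c"
      hence "q ^ 2 dvd b" using c by (simp add: power2_eq_square)
      thus False using b(2) q(1) by (auto simp: squarefree_def)
    qed
    moreover have "\<not> q dvd p" using q p(1) b(3) primes_dvd_imp_eq by blast
    ultimately have "\<not> q dvd 2 * p ^ 2 * c"
      using q(1) by (auto simp: prime_dvd_mult_iff prime_dvd_power_iff dest: primes_dvd_imp_eq[of q 2])
    thus False using no_power[of q 1 "2 * p ^ 2 * c"] q \<open>odd q\<close> c by simp
  qed
  ultimately have "l dvd p ^ 2" by (simp add: coprime_dvd_mult_left_iff)
  then obtain i where i: "i \<le> 2" "l = p ^ i" using divides_primepow_nat[OF p(1)] by blast
  moreover have "i \<noteq> 2"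
  proof
    assume "i = 2"
    hence "p ^ 2 dvd l" using i by simp
    moreover have "\<not> p dvd 2 * b" using p b(3) by (auto simp: prime_dvd_mult_iff dest: primes_dvd_imp_eq[of p 2])
    ultimately show False using no_power[of p 2 "2 * b"] p by simp
  qed
  ultimately have "i = 0 \<or> i = 1" by auto
  thus ?thesis using i(2) by (auto simp: l_def)
qed

section \<open>From a regular orthogonal similarity back to cospectral graphs\<close>

lemma char_poly_intertwine:
  fixes a b :: "nat \<Rightarrow> nat \<Rightarrow> int"
  assumes reg: "regular_orthogonal n Q"
    and eq: "\<And>i j. i < n \<Longrightarrow> j < n \<Longrightarrow> (\<Sum>t<n. of_int (a i t) * Q $$ (t, j)) = (\<Sum>t<n. Q $$ (i, t) * of_int (b t j))"
  shows "char_poly (mat n n (\<lambda>(i, j). a i j)) = char_poly (mat n n (\<lambda>(i, j). b i j))"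
proof -
  let ?A = "mat n n (\<lambda>(i, j). a i j)" and ?B = "mat n n (\<lambda>(i, j). b i j)"
  have Q: "Q \<in> carrier_mat n n" "Q * transpose_mat Q = 1\<^sub>m n" "transpose_mat Q * Q = 1\<^sub>m n"
    using reg by (auto simp: regular_orthogonal_def)
  have A: "rmat ?A \<in> carrier_mat n n" and B: "rmat ?B \<in> carrier_mat n n" by auto
  have "rmat ?A * Q = Q * rmat ?B"
  proof (rule eq_matI)
    fix i j assume "i < dim_row (Q * rmat ?B)" "j < dim_col (Q * rmat ?B)"
    hence ij: "i < n" "j < n" using Q by auto
    show "(rmat ?A * Q) $$ (i, j) = (Q * rmat ?B) $$ (i, j)"
      unfolding index_mult_mat_sum[OF A Q(1) ij] index_mult_mat_sum[OF Q(1) B ij]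
      using eq[OF ij] ij by simp
  qed (use Q in auto)
  hence "rmat ?A * Q * transpose_mat Q = Q * rmat ?B * transpose_mat Q" by simp
  hence "rmat ?A = Q * rmat ?B * transpose_mat Q"
    using Q A by (simp add: assoc_mult_mat[of _ n n _ n _ n])
  hence "similar_mat (rmat ?A) (rmat ?B)"
    using Q A B by (intro similar_matI[of _ _ Q "transpose_mat Q" n]) auto
  hence "char_poly (rmat ?A) = char_poly (rmat ?B)" by (rule char_poly_similar)
  hence "map_poly (of_int :: int \<Rightarrow> rat) (char_poly ?A) = map_poly of_int (char_poly ?B)"
    using of_int_hom.char_poly_hom[of ?A n, where ?'a = rat] of_int_hom.char_poly_hom[of ?B n, where ?'a = rat] by simp
  thus ?thesis by (simp add: poly_eq_iff coeff_map_poly)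
qed

lemma mat_spectrum_eqI:
  assumes "A \<in> carrier_mat n n" "B \<in> carrier_mat m m" "char_poly A = char_poly B"
  shows "mat_spectrum A = mat_spectrum B"
  unfolding mat_spectrum_def
  using of_int_hom.char_poly_hom[OF assms(1), where ?'a = complex]
    of_int_hom.char_poly_hom[OF assms(2), where ?'a = complex] assms(3) by simp

text \<open>The complement has adjacency matrix J - I - A, and J Q = J = Q J because
  \<open>Q\<close> and its transpose fix \<open>e\<close>.\<close>

lemma similar_imp_cospectral:
  assumes E: "simple_graph n E" and F: "simple_graph n F" and reg: "regular_orthogonal n Q"
    and eq: "\<And>i j. i < n \<Longrightarrow> j < n \<Longrightarrow>
      (\<Sum>t<n. of_int (adj_fun E i t) * Q $$ (t, j)) = (\<Sum>t<n. Q $$ (i, t) * of_int (adj_fun F t j))"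
  shows "generalized_cospectral n F n E"
proof -
  note s = regular_orthogonal_sums[OF reg]
  have "char_poly (Defs.adj_mat n E) = char_poly (Defs.adj_mat n F)"
    unfolding adj_mat_eq by (rule char_poly_intertwine[OF reg eq])
  moreover have "char_poly (Defs.adj_mat n (complement_graph n E)) = char_poly (Defs.adj_mat n (complement_graph n F))"
    unfolding complement_adj_mat[OF E] complement_adj_mat[OF F]
  proof (rule char_poly_intertwine[OF reg])
    fix i j assume ij: "i < n" "j < n"
    have "(\<Sum>t<n. of_int ((if i = t then 0 else 1) - adj_fun E i t) * Q $$ (t, j))
      = (\<Sum>t<n. Q $$ (t, j) - (if t = i then Q $$ (t, j) else 0) - of_int (adj_fun E i t) * Q $$ (t, j))"
      by (intro sum.cong) (auto simp: algebra_simps)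
    also have "\<dots> = 1 - Q $$ (i, j) - (\<Sum>t<n. of_int (adj_fun E i t) * Q $$ (t, j))"
      using s(4)[OF ij(2)] ij by (simp add: sum_subtractf)
    also have "\<dots> = 1 - Q $$ (i, j) - (\<Sum>t<n. Q $$ (i, t) * of_int (adj_fun F t j))" using eq[OF ij] by simp
    also have "\<dots> = (\<Sum>t<n. Q $$ (i, t) - (if t = j then Q $$ (i, t) else 0) - Q $$ (i, t) * of_int (adj_fun F t j))"
      using s(3)[OF ij(1)] ij by (simp add: sum_subtractf)
    also have "\<dots> = (\<Sum>t<n. Q $$ (i, t) * of_int ((if t = j then 0 else 1) - adj_fun F t j))"
      by (intro sum.cong) (auto simp: algebra_simps)
    finally show "(\<Sum>t<n. of_int ((if i = t then 0 else 1) - adj_fun E i t) * Q $$ (t, j))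
      = (\<Sum>t<n. Q $$ (i, t) * of_int ((if t = j then 0 else 1) - adj_fun F t j))" .
  qed
  ultimately show ?thesis unfolding generalized_cospectral_def
    by (auto intro!: mat_spectrum_eqI[of _ n _ n])
qed

text \<open>Conjugation by a regular orthogonal matrix preserves the sum of the entries, the sum of their
  squares and the trace, hence an integral conjugate of an adjacency matrix is again one.\<close>

lemma (in scaled_orthogonal) integral_conjugate_graph:
  assumes E: "simple_graph n E"
    and int: "\<And>i j. i < n \<Longrightarrow> j < n \<Longrightarrow> l\<^sup>2 dvd dot n (\<lambda>t. M t i) (mat_apply n (adj_fun E) (\<lambda>t. M t j))"
  obtains F where "simple_graph n F"
    "\<And>i j. i < n \<Longrightarrow> j < n \<Longrightarrow> (\<Sum>t<n. adj_fun E i t * M t j) = (\<Sum>t<n. M i t * adj_fun F t j)"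
proof -
  let ?a = "adj_fun E"
  interpret A: graph_matrix n ?a by (rule adj_fun_graph_matrix[OF E])
  define col where "col j = (\<lambda>t. M t j)" for j
  \<comment> \<open>The conjugate M^T A M / l^2; by \<open>int\<close> the division is exact for
    indices below \<open>n\<close>.\<close>
  define b where "b i j = dot n (col i) (mat_apply n ?a (col j)) div l\<^sup>2" for i j
  have b: "l\<^sup>2 * b i j = dot n (col i) (mat_apply n ?a (col j))" if "i < n" "j < n" for i j
    using int[OF that] by (simp add: b_def col_def)
  have l0: "l\<^sup>2 \<noteq> 0" using l_pos by simp
  have bsym: "b i j = b j i" for i j
    unfolding b_def by (metis A.mat_apply_adjoint dot_commute)
  have row: "(\<Sum>t<n. M i t * (\<Sum>s<n. M s t * y s)) = l\<^sup>2 * y i" if i: "i < n" for i y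
  proof -
    have "(\<Sum>t<n. M i t * (\<Sum>s<n. M s t * y s)) = (\<Sum>t<n. \<Sum>s<n. M i t * M s t * y s)"
      by (simp add: sum_distrib_left mult.assoc)
    also have "\<dots> = (\<Sum>s<n. (\<Sum>t<n. M i t * M s t) * y s)"
      by (subst sum.swap) (simp add: sum_distrib_right)
    also have "\<dots> = (\<Sum>s<n. if s = i then l\<^sup>2 * y s else 0)"
      using rows[OF i] by (intro sum.cong) auto
    also have "\<dots> = l\<^sup>2 * y i" using i by simp
    finally show ?thesis .
  qed
  have mat_apply_col: "mat_apply n ?a (col j) i = (\<Sum>t<n. M i t * b t j)" if ij: "i < n" "j < n" for i j
  proof -
    have "l\<^sup>2 * (\<Sum>t<n. M i t * b t j) = (\<Sum>t<n. M i t * (\<Sum>s<n. M s t * mat_apply n ?a (col j) s))"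
      unfolding sum_distrib_left using ij b by (intro sum.cong) (auto simp: dot_def col_def mult.left_commute sum_distrib_left)
    also have "\<dots> = l\<^sup>2 * mat_apply n ?a (col j) i" by (rule row[OF ij(1)])
    finally show ?thesis using l0 by simp
  qed
  have mat_apply_index: "mat_apply n ?a (col j) i = (\<Sum>s<n. M s j * ?a i s)" for i j
    by (simp add: mat_apply_def col_def mult.commute)
  have sum_b: "(\<Sum>i<n. \<Sum>j<n. b i j) = (\<Sum>i<n. \<Sum>j<n. ?a i j)"
  proof -
    \<comment> \<open>Both ends evaluate e^T M b e = e^T A M e.\<close>
    have "l * (\<Sum>t<n. \<Sum>j<n. b t j) = (\<Sum>t<n. (\<Sum>i<n. M i t) * (\<Sum>j<n. b t j))"
      using col_sum by (simp add: sum_distrib_left)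
    also have "\<dots> = (\<Sum>t<n. \<Sum>i<n. \<Sum>j<n. M i t * b t j)"
      by (simp add: sum_product)
    also have "\<dots> = (\<Sum>i<n. \<Sum>t<n. \<Sum>j<n. M i t * b t j)" by (rule sum.swap)
    also have "\<dots> = (\<Sum>i<n. \<Sum>j<n. \<Sum>t<n. M i t * b t j)" by (intro sum.cong refl sum.swap)
    also have "\<dots> = (\<Sum>i<n. \<Sum>j<n. \<Sum>s<n. M s j * ?a i s)"
      using mat_apply_col mat_apply_index by simp
    also have "\<dots> = (\<Sum>i<n. \<Sum>s<n. \<Sum>j<n. M s j * ?a i s)" by (intro sum.cong refl sum.swap)
    also have "\<dots> = l * (\<Sum>i<n. \<Sum>s<n. ?a i s)"
      using row_sum by (simp add: sum_distrib_left flip: sum_distrib_right)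
    finally show ?thesis using l_pos by simp
  qed
  have sum_sq: "(\<Sum>i<n. \<Sum>j<n. b i j * b i j) = (\<Sum>i<n. \<Sum>j<n. ?a i j * ?a i j)"
  proof -
    have quad: "(\<Sum>i<n. x i * (\<Sum>t<n. M i t * y t)) = (\<Sum>t<n. (\<Sum>i<n. M i t * x i) * y t)" for x y
      unfolding sum_distrib_left sum_distrib_right by (subst sum.swap) (simp add: mult_ac)
    have quad': "(\<Sum>j<n. x j * (\<Sum>s<n. M s j * y s)) = (\<Sum>s<n. (\<Sum>j<n. M s j * x j) * y s)" for x y
      unfolding sum_distrib_left sum_distrib_right by (subst sum.swap) (simp add: mult_ac)
    \<comment> \<open>Frobenius norms: l^2 |b|^2 = |M b|^2 = |A M|^2 = l^2 |A|^2.\<close>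
    have "l\<^sup>2 * (\<Sum>j<n. \<Sum>i<n. b i j * b i j) = (\<Sum>j<n. \<Sum>t<n. (l\<^sup>2 * b t j) * b t j)"
      by (simp add: sum_distrib_left mult.assoc)
    also have "\<dots> = (\<Sum>j<n. \<Sum>t<n. (\<Sum>i<n. M i t * mat_apply n ?a (col j) i) * b t j)"
      using b by (intro sum.cong refl) (auto simp: dot_def col_def)
    also have "\<dots> = (\<Sum>j<n. \<Sum>i<n. mat_apply n ?a (col j) i * mat_apply n ?a (col j) i)"
      unfolding quad[symmetric] using mat_apply_col by (intro sum.cong refl) auto
    also have "\<dots> = (\<Sum>i<n. \<Sum>j<n. mat_apply n ?a (col j) i * (\<Sum>s<n. M s j * ?a i s))"
      unfolding mat_apply_index by (rule sum.swap)
    also have "\<dots> = (\<Sum>i<n. \<Sum>s<n. (\<Sum>j<n. M s j * (\<Sum>r<n. M r j * ?a i r)) * ?a i s)"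
      unfolding quad' mat_apply_index ..
    also have "\<dots> = (\<Sum>i<n. \<Sum>s<n. l\<^sup>2 * ?a i s * ?a i s)"
      using row by (intro sum.cong refl) auto
    also have "\<dots> = l\<^sup>2 * (\<Sum>i<n. \<Sum>j<n. ?a i j * ?a i j)" by (simp add: sum_distrib_left mult.assoc)
    finally have "(\<Sum>j<n. \<Sum>i<n. b i j * b i j) = (\<Sum>i<n. \<Sum>j<n. ?a i j * ?a i j)" using l0 by simp
    thus ?thesis by (subst sum.swap)
  qed
  have trace: "(\<Sum>j<n. b j j) = 0"
  proof -
    have "l\<^sup>2 * (\<Sum>j<n. b j j) = (\<Sum>j<n. \<Sum>i<n. M i j * (\<Sum>s<n. M s j * ?a i s))"
      unfolding sum_distrib_left using b mat_apply_index by (intro sum.cong refl) (auto simp: dot_def col_def sum_distrib_left)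
    also have "\<dots> = (\<Sum>i<n. \<Sum>j<n. M i j * (\<Sum>s<n. M s j * ?a i s))" by (rule sum.swap)
    also have "\<dots> = 0" using row A.diag_0 by simp
    finally show ?thesis using l0 by simp
  qed
  \<comment> \<open>A sum of nonnegative integers b^2 - b, which vanishes because it equals the same
    sum for the 0-1 matrix A; so all entries of \<open>b\<close> are 0 or 1.\<close>
  have "(\<Sum>i<n. \<Sum>j<n. b i j * b i j - b i j) = (\<Sum>i<n. \<Sum>j<n. ?a i j * ?a i j - ?a i j)"
    unfolding sum_subtractf sum_b sum_sq ..
  also have "\<dots> = 0" by (intro sum.neutral ballI) (auto simp: adj_fun_def)
  finally have "(\<Sum>j<n. b i j * b i j - b i j) = 0" if "i < n" for i
    using that by (subst (asm) sum_nonneg_eq_0_iff) (auto simp: int_le_mult_self intro!: sum_nonneg)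
  hence "b i j * b i j - b i j = 0" if "i < n" "j < n" for i j
    using that sum_nonneg_eq_0_iff[of "{..<n}" "\<lambda>j. b i j * b i j - b i j"] by (auto simp: int_le_mult_self)
  hence b01: "b i j = 0 \<or> b i j = 1" if "i < n" "j < n" for i j using that by fastforce
  have diag: "b j j = 0" if "j < n" for j
    using trace sum_nonneg_eq_0_iff[of "{..<n}" "\<lambda>j. b j j"] b01 that by fastforce
  define F where "F = {{i, j} | i j. i < n \<and> j < n \<and> b i j = 1}"
  have adjF: "adj_fun F i j = b i j" if ij: "i < n" "j < n" for i j
  proof -
    have "{i, j} \<in> F \<longleftrightarrow> b i j = 1"
      unfolding F_def using ij bsym by (auto simp: doubleton_eq_iff)
    thus ?thesis using b01[OF ij] by (auto simp: adj_fun_def)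
  qed
  have "simple_graph n F"
    unfolding simple_graph_def complete_edges_def F_def
  proof safe
    fix i j assume ij: "i < n" "j < n" "b i j = 1"
    hence "i \<noteq> j" using diag by auto
    thus "card {i, j} = 2" by simp
  qed auto
  moreover have "(\<Sum>t<n. ?a i t * M t j) = (\<Sum>t<n. M i t * adj_fun F t j)" if ij: "i < n" "j < n" for i j
    using mat_apply_col[OF ij] adjF ij by (simp add: mat_apply_def col_def)
  ultimately show ?thesis using that by blast
qed

section \<open>The two directions of the equivalence\<close>

lemma walk_vec_iso:
  assumes bij: "bij_betw f {0..<n} {0..<n}"
    and adj: "\<And>u v. u < n \<Longrightarrow> v < n \<Longrightarrow> b u v = a (f u) (f v)"
  shows "u < n \<Longrightarrow> walk_vec n b k u = walk_vec n a k (f u)"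
proof (induction k arbitrary: u)
  case (Suc k)
  have "walk_vec n b (Suc k) u = (\<Sum>v<n. a (f u) (f v) * walk_vec n a k (f v))"
    using Suc adj by (simp add: walk_vec_Suc mat_apply_def)
  also have "\<dots> = (\<Sum>v<n. a (f u) v * walk_vec n a k v)"
    using sum.reindex_bij_betw[OF bij, of "\<lambda>v. a (f u) v * walk_vec n a k v"] by (simp add: lessThan_atLeast0)
  finally show ?case by (simp add: walk_vec_Suc mat_apply_def)
qed (simp add: walk_vec_0)

lemma transpose_walk_mat_mult_vec:
  assumes "z \<in> carrier_vec n"
  shows "vec_cong p (transpose_mat (walk_mat n E) *\<^sub>v z) (0\<^sub>v n) \<longleftrightarrow>
    (\<forall>k<n. int p dvd dot n (walk_vec n (adj_fun E) k) (\<lambda>i. z $ i))"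
proof -
  have W: "transpose_mat (walk_mat n E) \<in> carrier_mat n n" using walk_mat_carrier by simp
  have "(transpose_mat (walk_mat n E) *\<^sub>v z) $ k = dot n (walk_vec n (adj_fun E) k) (\<lambda>i. z $ i)" if k: "k < n" for k
    using mult_mat_vec_index_sum[OF W assms k] carrier_matD[OF walk_mat_carrier[of n E]] k
    by (simp add: dot_def walk_mat_index)
  thus ?thesis using carrier_matD[OF W] by (auto simp: vec_cong_def cong_0_iff)
qed

text \<open>The matrix obtained from a cospectral mate serves every solution: the columns of p Q lie
  in the kernel of W^T modulo \<open>p\<close>, and each nontrivial \<open>z\<close> generates that
  kernel.\<close>

lemma non_DGS_imp_generates_primitive:
  assumes p: "prime p" "odd p" and E: "E \<in> family_Fp n p" and dgs: "\<not> DGS n E"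
    and z: "z \<in> carrier_vec n" "\<not> vec_cong p z (0\<^sub>v n)"
      "vec_cong p (transpose_mat (walk_mat n E) *\<^sub>v z) (0\<^sub>v n)"
  shows "\<exists>Q. generates_primitive p z Q"
proof -
  obtain b r where E': "simple_graph n E" "n \<ge> 2" and b: "odd b" "squarefree b" "\<not> p dvd b"
    and gw: "graph_walks n (adj_fun E) (2 * int p ^ 2 * int b) r"
    and det: "det (walk_mat n E) dvd 2 ^ (n div 2) * (int p ^ 2 * int b)" "det (walk_mat n E) \<noteq> 0"
    using family_Fp_data[OF p E] by metis
  obtain m F where F: "simple_graph m F" "generalized_cospectral m F n E" "\<not> graph_iso m F n E"
    using dgs unfolding DGS_def by blast
  obtain Q where mn: "m = n" and reg: "regular_orthogonal n Q"
    and AQ: "rmat (Defs.adj_mat n E) * Q = Q * rmat (Defs.adj_mat n F)"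
    and int: "\<And>i j. i < n \<Longrightarrow> j < n \<Longrightarrow> of_int (det (walk_mat n E)) * Q $$ (i, j) \<in> \<int>"
    using cospectral_imp_similar[OF E'(1) F(1,2) det(2)] by metis
  have F': "simple_graph n F" using F(1) mn by simp
  have Q: "Q \<in> carrier_mat n n" using reg by (simp add: regular_orthogonal_def)
  have "of_nat (2 ^ (n div 2) * (p ^ 2 * b)) * Q $$ (i, j) \<in> \<int>" if ij: "i < n" "j < n" for i j
  proof -
    obtain t where t: "2 ^ (n div 2) * (int p ^ 2 * int b) = det (walk_mat n E) * t" using det(1) by (elim dvdE)
    have "(of_nat (2 ^ (n div 2) * (p ^ 2 * b)) :: rat) = of_int (2 ^ (n div 2) * (int p ^ 2 * int b))" by simp
    hence "of_nat (2 ^ (n div 2) * (p ^ 2 * b)) * Q $$ (i, j) = of_int t * (of_int (det (walk_mat n E)) * Q $$ (i, j))"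
      unfolding t by (simp add: mult_ac)
    thus ?thesis using Ints_mult[OF Ints_of_int int[OF ij], of t] by (simp only:)
  qed
  from similarity_level[OF p b gw E'(1) F' reg AQ this]
  have level: "mat_level Q = 1 \<or> mat_level Q = p" by simp
  interpret ss: scaled_similarity n "int (mat_level Q)" "\<lambda>i j. scaled_int_mat (mat_level Q) Q $$ (i, j)"
      "adj_fun E" "adj_fun F"
    by (rule scaled_similarity_level[OF E'(1) F' reg AQ])
  have lp: "mat_level Q = p"
  proof (rule ccontr)
    assume "mat_level Q \<noteq> p"
    hence "mat_level Q = 1" using level by simp
    hence "graph_iso n F n E"
      using integral_similarity_iso[of n "\<lambda>i j. scaled_int_mat (mat_level Q) Q $$ (i, j)" E F]
        ss.scaled_similarity_axioms by simp
    thus False using F(3) mn by simp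
  qed
  let ?M = "scaled_int_mat p Q"
  have M: "?M \<in> carrier_mat n n" using Q by (simp add: scaled_int_mat_def)
  interpret graph_walks n "adj_fun E" "2 * int p ^ 2 * int b" r by (rule gw)
  have dimz: "dim_vec z = n" using z(1) by simp
  obtain i where i: "i < n" "\<not> int p dvd z $ i"
    using z(1,2) by (auto simp: vec_cong_def cong_0_iff)
  have kz: "int p dvd dot n (walk_vec n (adj_fun E) k) (\<lambda>i. z $ i)" if "k < n" for k
    using z(3) that unfolding transpose_walk_mat_mult_vec[OF z(1)] by blast
  have mult: "\<exists>c. \<forall>i<n. int p dvd ?M $$ (i, j) - c * z $ i" if j: "j < n" for j
  proof (rule kernel_generator[of "int p" "int p" 1 "\<lambda>i. z $ i" i "\<lambda>i. ?M $$ (i, j)"])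
    show "int p dvd dot n (walk_vec n (adj_fun E) k) (\<lambda>i. ?M $$ (i, j))" for k
      using ss.inner_walk_column[OF j, of k] lp by simp
    show "int p dvd 2 * int p ^ 2 * int b" by (simp add: power2_eq_square)
  qed (use p i kz in auto)
  obtain i0 j0 where nz: "i0 < n" "j0 < n" "\<not> int p dvd ?M $$ (i0, j0)"
    using mat_level_primitive[OF Q, of p] prime_gt_1_nat[OF p(1)] lp by auto
  have "primitive_mat p n Q"
    unfolding primitive_mat_def using reg lp rank_mod_eq_1[OF p(1) M mult nz] by simp
  moreover have "\<exists>c. vec_cong p (col ?M j) (c \<cdot>\<^sub>v z)" if j: "j < n" for j
  proof -
    obtain c where "\<forall>i<n. int p dvd ?M $$ (i, j) - c * z $ i" using mult[OF j] by blast
    hence "vec_cong p (col ?M j) (c \<cdot>\<^sub>v z)"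
      using M dimz j carrier_matD[OF M] by (auto simp: vec_cong_def cong_iff_dvd_diff)
    thus ?thesis by blast
  qed
  ultimately show ?thesis unfolding generates_primitive_def dimz by blast
qed

text \<open>The hypothesis is applied to the kernel generator \<open>r\<close>, a solution that is
  nonzero modulo \<open>p\<close>.\<close>

lemma generates_primitive_imp_non_DGS:
  assumes p: "prime p" "odd p" and E: "E \<in> family_Fp n p"
    and gen: "\<forall>z\<in>carrier_vec n. \<not> vec_cong p z (0\<^sub>v n) \<and>
      vec_cong p (transpose_mat (walk_mat n E) *\<^sub>v z) (0\<^sub>v n) \<longrightarrow> (\<exists>Q. generates_primitive p z Q)"
  shows "\<not> DGS n E"
proof -
  obtain b r where E': "simple_graph n E" "n \<ge> 2"
    and gw: "graph_walks n (adj_fun E) (2 * int p ^ 2 * int b) r"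
    using family_Fp_data[OF p E] by metis
  interpret graph_walks n "adj_fun E" "2 * int p ^ 2 * int b" r by (rule gw)
  let ?a = "adj_fun E"
  have pd: "int p dvd 2 * int p ^ 2 * int b" by (simp add: power2_eq_square)
  define z where "z = vec n r"
  have z: "z \<in> carrier_vec n" by (simp add: z_def)
  have rk: "int p dvd dot n (walk_vec n ?a k) r" if "k < n" for k using r_kernel[OF that] pd dvd_trans by blast
  have zk: "vec_cong p (transpose_mat (walk_mat n E) *\<^sub>v z) (0\<^sub>v n)"
    unfolding transpose_walk_mat_mult_vec[OF z]
  proof (intro allI impI)
    fix k assume "k < n"
    moreover have "dot n (walk_vec n ?a k) (\<lambda>i. z $ i) = dot n (walk_vec n ?a k) r" by (intro dot_cong) (simp_all add: z_def)
    ultimately show "int p dvd dot n (walk_vec n ?a k) (\<lambda>i. z $ i)" using rk by simp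
  qed
  have "\<not> is_unit (int p)" using prime_gt_1_nat[OF p(1)] by simp
  then obtain i where "i < n" "\<not> int p dvd r i" using r_nonzero by blast
  hence "\<not> vec_cong p z (0\<^sub>v n)" by (auto simp: vec_cong_def z_def cong_0_iff)
  then obtain Q where "generates_primitive p z Q" using gen z zk by blast
  hence prim: "primitive_mat p n Q"
    and cong: "\<And>j. j < n \<Longrightarrow> \<exists>c. vec_cong p (col (scaled_int_mat p Q) j) (c \<cdot>\<^sub>v z)"
    unfolding generates_primitive_def by (simp_all add: z_def)
  have reg: "regular_orthogonal n Q" and lp: "mat_level Q = p" using prim by (auto simp: primitive_mat_def)
  have Q: "Q \<in> carrier_mat n n" using reg by (simp add: regular_orthogonal_def)
  define M where "M = (\<lambda>i j. scaled_int_mat p Q $$ (i, j))"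
  have dimM: "dim_row (scaled_int_mat p Q) = n" "dim_col (scaled_int_mat p Q) = n"
    using carrier_matD[OF Q] by (simp_all add: scaled_int_mat_def)
  interpret so: scaled_orthogonal n "int p" M
    using scaled_orthogonal_level[OF reg] unfolding lp M_def .
  have kcol: "int p dvd dot n (walk_vec n ?a k) (\<lambda>t. M t j)" if jk: "j < n" "k < n" for j k
  proof -
    obtain c where c: "vec_cong p (col (scaled_int_mat p Q) j) (c \<cdot>\<^sub>v z)" using cong[OF jk(1)] by blast
    have "int p dvd M i j - c * r i" if "i < n" for i
      using c that jk(1) dimM by (auto simp: vec_cong_def z_def M_def cong_iff_dvd_diff)
    hence "int p dvd dot n (walk_vec n ?a k) (\<lambda>t. M t j) - dot n (walk_vec n ?a k) (\<lambda>i. c * r i)"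
      by (rule dot_dvd_diff_right)
    moreover have "int p dvd dot n (walk_vec n ?a k) (\<lambda>i. c * r i)" using rk[OF jk(2)] by (simp add: dot_scale_right)
    ultimately show ?thesis by (metis dvd_add diff_add_cancel)
  qed
  obtain F where F: "simple_graph n F"
    and AM: "\<And>i j. i < n \<Longrightarrow> j < n \<Longrightarrow> (\<Sum>t<n. ?a i t * M t j) = (\<Sum>t<n. M i t * adj_fun F t j)"
  proof (rule so.integral_conjugate_graph[OF E'(1)])
    fix i j assume ij: "i < n" "j < n"
    have "(int p)\<^sup>2 dvd dot n (\<lambda>t. M t i) (\<lambda>t. M t j)" using so.cols[OF ij] by (simp add: dot_def)
    thus "(int p)\<^sup>2 dvd dot n (\<lambda>t. M t i) (mat_apply n ?a (\<lambda>t. M t j))"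
      using p kcol ij by (intro kernel_inner_lin) auto
  qed blast
  have MQ: "of_int (M i j) = of_nat p * Q $$ (i, j)" if "i < n" "j < n" for i j
    using scaled_int_mat_index[OF Q that] by (simp add: lp M_def)
  have "generalized_cospectral n F n E"
  proof (rule similar_imp_cospectral[OF E'(1) F reg])
    fix i j assume ij: "i < n" "j < n"
    have "of_nat p * (\<Sum>t<n. of_int (?a i t) * Q $$ (t, j)) = (of_int (\<Sum>t<n. ?a i t * M t j) :: rat)"
      using ij MQ by (simp add: sum_distrib_left mult_ac)
    also have "\<dots> = of_nat p * (\<Sum>t<n. Q $$ (i, t) * of_int (adj_fun F t j))"
      unfolding AM[OF ij] using ij MQ by (simp add: sum_distrib_left mult_ac)
    finally show "(\<Sum>t<n. of_int (?a i t) * Q $$ (t, j)) = (\<Sum>t<n. Q $$ (i, t) * of_int (adj_fun F t j))"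
      using prime_gt_0_nat[OF p(1)] by simp
  qed
  moreover have "\<not> graph_iso n F n E"
  proof
    assume "graph_iso n F n E"
    then obtain f where bij: "bij_betw f {0..<n} {0..<n}"
      and f: "\<And>u v. u < n \<Longrightarrow> v < n \<Longrightarrow> {u, v} \<in> F \<longleftrightarrow> {f u, f v} \<in> E"
      unfolding graph_iso_def by auto
    interpret B: graph_matrix n "adj_fun F" by (rule adj_fun_graph_matrix[OF F])
    interpret ss: scaled_similarity n "int p" M ?a "adj_fun F"
      by unfold_locales (rule AM)
    have adj: "adj_fun F u v = ?a (f u) (f v)" if "u < n" "v < n" for u v
      using f[OF that] by (simp add: adj_fun_def)
    have walk: "walk_vec n (adj_fun F) k u = walk_vec n ?a k (f u)" if "u < n" for k u
      by (rule walk_vec_iso[of f n "adj_fun F" ?a, OF bij adj that])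
    have "int p dvd M i u" if iu: "i < n" "u < n" for i u
    proof -
      have fu: "f u < n" using bij_betwE[OF bij] iu by auto
      \<comment> \<open>An isomorphism carries walk counts at \<open>u\<close> to those at
        \<open>f u\<close>, so column \<open>u\<close> of \<open>M\<close> and \<open>p\<close>
        times the unit vector at \<open>f u\<close> have the same pairing with every walk vector. As
        W is nonsingular they coincide, so \<open>p\<close> divides all entries of \<open>M\<close>,
        against level \<open>p\<close>.\<close>
      have "dot n (walk_vec n ?a k) (\<lambda>i. M i u - int p * (if i = f u then 1 else 0)) = 0" for k
        using ss.inner_walk_column[OF iu(2), of k] walk[OF iu(2), of k] fu
        by (simp only: dot_diff_right dot_scale_right dot_unit_right)
      hence "M i u - int p * (if i = f u then 1 else 0) = 0"
        using inner_wk_eq_0[of "\<lambda>i. M i u - int p * (if i = f u then 1 else 0)" i] iu by blast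
      thus ?thesis by (metis dvd_triv_left eq_iff_diff_eq_0)
    qed
    thus False
      using mat_level_primitive[OF Q, of p] prime_gt_1_nat[OF p(1)] by (auto simp: lp M_def)
  qed
  ultimately show ?thesis unfolding DGS_def using F by blast
qed

theorem theorem2p19:
  fixes p n :: nat and E :: "nat set set"
  assumes "prime p" and "odd p" and "E \<in> family_Fp n p"
  shows "\<not> DGS n E \<longleftrightarrow>
    (\<forall>z\<in>carrier_vec n.
       \<not> vec_cong p z (0\<^sub>v n) \<and> vec_cong p (transpose_mat (walk_mat n E) *\<^sub>v z) (0\<^sub>v n) \<longrightarrow>
       (\<exists>Q. generates_primitive p z Q))"
  using non_DGS_imp_generates_primitive[OF assms] generates_primitive_imp_non_DGS[OF assms] by blast

end
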